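(* Let $K_1(t)=\mathcal{L}_b[\lambda_1](t)=\int e^{-ts}\,d\lambda_1(s)$ be a generalized completely monotone kernel with $\lambda_1\in\mathcal{M}^{(1)}_{\exp}(\mathbb{R})$, and let $$K_2(t)=\mathcal{L}[s^{-1}\,d\lambda_2(s)](t)=\int e^{-ts}s^{-1}\,d\lambda_2(s)$$ for some $\lambda_2\in\mathcal{M}_{\mathrm{frac}}(\mathbb{R})$. Fix $c_0\in\mathbb{R}$ and $c_1\ge0$, and consider the equation $$y(t)=c_1\dot x(t)-c_0x(t)-\int_0^tK_1(t-\tau)x(\tau)\,d\tau+\frac{d}{dt}\int_0^tK_2(t-\tau)x(\tau)\,d\tau,\qquad x(0)=x_0\ \ (\text{if }c_1\ne0),\qquad(\ast)$$ where $y$ is a sufficiently regular function on $[0,\infty)$. Write $$\mathcal{B}_{\mathrm{reg}}[\lambda_1+\lambda_2,\;c_0-\pi\sigma_{\mathbb{R}}(\lambda_1)-\pi\xi_{\mathrm{frac}}(\lambda_2),\;c_1]=(\mu,\zeta_0',\zeta_1).$$ The measure $\mu\in\mathcal{M}^{(2)}_{\exp}(\mathbb{R})$ can be decomposed as $\mu=\mu_1+\mu_2$, where $\mu_1\in\mathcal{M}^{(1)}_{\exp}(\mathbb{R})$ and $\mu_2\in\mathcal{M}_{\mathrm{frac}}(\mathbb{R})$. Given any such decomposition, let $J_1=\mathcal{L}_b[\mu_1]$ and $J_2=\mathcal{L}[s^{-1}\,d\mu_2(s)]$, and write $\zeta_0=\zeta_0'+\pi\sigma_{\mathbb{R}}(\mu_1)+\pi\xi_{\mathrm{frac}}(\mu_2)$.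 Then $(\ast)$ is satisfied by the $x$ given by $$-\pi^2x(t)=\zeta_1\dot y(t)-\zeta_0y(t)-\int_0^tJ_1(t-\tau)y(\tau)\,d\tau+\frac{d}{dt}\int_0^tJ_2(t-\tau)y(\tau)\,d\tau-c_1x_0\big(J_1(t)-\dot J_2(t)\big).$$
   Context: A smooth non-negative $F$ on $[0,\infty)$ is completely monotone (CM) if $(-1)^jF^{(j)}(t)\ge0$ for all $j\ge0$, $t>0$; $K$ is generalized CM if $K(t)=e^{\sigma t}F(t)$ with $F$ CM and $\sigma\in\mathbb{R}$. $\mathcal{M}^{(n)}_{\exp}(\mathbb{R})$ is the set of non-negative locally finite Borel measures $\lambda$ on $\mathbb{R}$ with $\int(1+s^2)^{-n/2}\,d\lambda(s)<\infty$ and $\operatorname{supp}\lambda$ bounded below. $\mathcal{M}_{\mathrm{frac}}(\mathbb{R})$ is the set of $\lambda\in\mathcal{M}^{(2)}_{\exp}(\mathbb{R})$ with $\operatorname{supp}\lambda\subset[0,\infty)$ and $t^{-1}\,d\lambda(t)$ a locally finite measure, i.e. its restriction to a neighborhood of $t=0$ is a finite measure. The measures $\lambda_1,\lambda_2$ (not both), as well as $\mu,\mu_1,\mu_2$, are allowed to be zero. Put $$\sigma_{\mathbb{R}}(\lambda)=-\int\frac{s\,d\lambda(s)}{\pi(1+s^2)}\ \ (\lambda\in\mathcal{M}^{(1)}_{\exp}(\mathbb{R})),\qquad\xi_{\mathrm{frac}}(\lambda)=\frac1\pi\int\frac{d\lambda(s)}{s(1+s^2)}\ \ (\lambda\in\mathcal{M}_{\mathrm{frac}}(\mathbb{R})).$$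 For $z\in\mathbb{H}=\{\operatorname{Im}z>0\}$, $Q_{\mathrm{reg}}[\lambda](z)=\int\frac{i}{\pi}\left(\frac1{z-s}+\frac{s}{1+s^2}\right)d\lambda(s)$. For a nonzero non-negative $\lambda$ with $\int(1+s^2)^{-1}d\lambda<\infty$, $a_0\in\mathbb{R}$, $c_1\ge0$, $\mathcal{B}_{\mathrm{reg}}[\lambda,a_0,c_1]=(\mu,b_0,\zeta_1)$ is the unique triple with $\mu$ non-negative, $\int(1+s^2)^{-1}d\mu<\infty$, $b_0\in\mathbb{R}$, $\zeta_1\ge0$ and $$\big(Q_{\mathrm{reg}}[\lambda](z)-i\pi^{-1}(a_0+c_1z)\big)\big(Q_{\mathrm{reg}}[\mu](z)-i\pi^{-1}(b_0+\zeta_1z)\big)=1\quad\text{for all }z\in\mathbb{H}.$$ "Sufficiently regular" means that $y$ is regular enough for $(\ast)$ to have a classical solution $x$. *)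

theory Defs
  imports "HOL-Analysis.Analysis"
begin

section \<open>Completely monotone kernels\<close>

text \<open>
  Smoothness is required on the open half-line only: kernels such as \<open>t powr (-1/2)\<close>, which are
  Laplace transforms of infinite measures, are unbounded at the origin.
\<close>

definition completely_monotone :: "(real \<Rightarrow> real) \<Rightarrow> bool" where
  "completely_monotone F \<longleftrightarrow>
     (\<forall>j. \<forall>t>0. (deriv ^^ j) F differentiable (at t) \<and> (- 1) ^ j * (deriv ^^ j) F t \<ge> 0)"

definition generalized_cm :: "(real \<Rightarrow> real) \<Rightarrow> bool" where
  "generalized_cm K \<longleftrightarrow>
     (\<exists>\<sigma> F. completely_monotone F \<and> (\<forall>t>0. K t = exp (\<sigma> * t) * F t))"


section \<open>Classes of measures\<close>

definition locally_finite :: "real measure \<Rightarrow> bool" where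
  "locally_finite M \<longleftrightarrow> (\<forall>s. \<exists>U. open U \<and> s \<in> U \<and> emeasure M U < \<infinity>)"

definition msupp :: "real measure \<Rightarrow> real set" where
  "msupp M = {s. \<forall>U. open U \<longrightarrow> s \<in> U \<longrightarrow> emeasure M U > 0}"

definition M_exp :: "nat \<Rightarrow> real measure set" where
  "M_exp n = {M. sets M = sets borel \<and> locally_finite M \<and>
     (\<integral>\<^sup>+ s. ennreal ((1 + s\<^sup>2) powr (- real n / 2)) \<partial>M) < \<infinity> \<and>
     bdd_below (msupp M)}"

text \<open>
  The measure \<open>s\<^sup>-\<^sup>1 dM(s)\<close>, for \<open>M\<close> supported in \<open>[0,\<infinity>)\<close>. The inverse is taken in the extended
  non-negative reals, so that the density is \<open>\<infinity>\<close> (and not \<open>0\<close>) at \<open>s = 0\<close>; local finiteness of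
  this measure therefore rules out an atom of \<open>M\<close> at the origin.
\<close>

definition inv_weighted :: "real measure \<Rightarrow> real measure" where
  "inv_weighted M = density M (\<lambda>s. inverse (ennreal s))"

definition M_frac :: "real measure set" where
  "M_frac = {M \<in> M_exp 2. msupp M \<subseteq> {0..} \<and> locally_finite (inv_weighted M)}"

definition add_measure :: "real measure \<Rightarrow> real measure \<Rightarrow> real measure" where
  "add_measure M N = measure_of UNIV (sets borel) (\<lambda>A. emeasure M A + emeasure N A)"

lemma sets_add_measure [simp]: "sets (add_measure M N) = sets borel"
  unfolding add_measure_def
  using sets.sigma_sets_eq[of "borel :: real measure"] by simp

lemma emeasure_add_measure:
  assumes "sets M = sets borel" "sets N = sets borel" "A \<in> sets borel"
  shows "emeasure (add_measure M N) A = emeasure M A + emeasure N A"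
proof (rule emeasure_measure_of[OF add_measure_def])
  show "countably_additive (sets (add_measure M N)) (\<lambda>A. emeasure M A + emeasure N A)"
    unfolding countably_additive_def
    by (auto simp: assms suminf_add[symmetric] suminf_emeasure)
qed (use assms in \<open>auto simp: positive_def\<close>)


section \<open>Transforms of measures\<close>

text \<open>
  The bilateral Laplace transform; on measures supported in \<open>[0,\<infinity>)\<close> it is the ordinary one.
\<close>

definition laplace :: "real measure \<Rightarrow> real \<Rightarrow> real" where
  "laplace M t = (LINT s|M. exp (- (t * s)))"

definition sigma_R :: "real measure \<Rightarrow> real" where
  "sigma_R M = - (LINT s|M. s / (pi * (1 + s\<^sup>2)))"

definition xi_frac :: "real measure \<Rightarrow> real" where
  "xi_frac M = 1 / pi * (LINT s|M. 1 / (s * (1 + s\<^sup>2)))"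

definition Q_reg :: "real measure \<Rightarrow> complex \<Rightarrow> complex" where
  "Q_reg M z = (LINT s|M. \<i> / of_real pi *
     (1 / (z - of_real s) + of_real s / (1 + (of_real s)\<^sup>2)))"

text \<open>
  \<open>is_B_reg M a0 c1 N b0 \<zeta>1\<close> says that \<open>(N, b0, \<zeta>1)\<close> is the triple \<open>B_reg[M, a0, c1]\<close>, by the
  properties which characterize it uniquely when \<open>M\<close> is nonzero.
\<close>

definition is_B_reg ::
    "real measure \<Rightarrow> real \<Rightarrow> real \<Rightarrow> real measure \<Rightarrow> real \<Rightarrow> real \<Rightarrow> bool" where
  "is_B_reg M a0 c1 N b0 \<zeta>1 \<longleftrightarrow>
     sets N = sets borel \<and> (\<integral>\<^sup>+ s. ennreal (inverse (1 + s\<^sup>2)) \<partial>N) < \<infinity> \<and> \<zeta>1 \<ge> 0 \<and>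
     (\<forall>z. Im z > 0 \<longrightarrow>
        (Q_reg M z - \<i> / of_real pi * (of_real a0 + of_real c1 * z)) *
        (Q_reg N z - \<i> / of_real pi * (of_real b0 + of_real \<zeta>1 * z)) = 1)"


section \<open>The integro-differential equation\<close>

definition conv :: "(real \<Rightarrow> real) \<Rightarrow> (real \<Rightarrow> real) \<Rightarrow> real \<Rightarrow> real" where
  "conv K x t = (LINT \<tau>:{0..t}|lborel. K (t - \<tau>) * x \<tau>)"

text \<open>Derivative on \<open>[0,\<infinity>)\<close>: one-sided at the origin.\<close>

abbreviation Dt :: "(real \<Rightarrow> real) \<Rightarrow> real \<Rightarrow> real" where
  "Dt f t \<equiv> vector_derivative f (at t within {0..})"

text \<open>
  The common shape of the equation and of its solution formula, together with a predicate saying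
  that all derivatives and integrals occurring in it exist. A derivative with coefficient \<open>0\<close>
  does not occur.
\<close>

definition volterra ::
    "real \<Rightarrow> real \<Rightarrow> (real \<Rightarrow> real) \<Rightarrow> (real \<Rightarrow> real) \<Rightarrow> (real \<Rightarrow> real) \<Rightarrow> real \<Rightarrow> real" where
  "volterra c1 c0 K1 K2 x t = c1 * Dt x t - c0 * x t - conv K1 x t + Dt (conv K2 x) t"

definition volterra_defined ::
    "real \<Rightarrow> (real \<Rightarrow> real) \<Rightarrow> (real \<Rightarrow> real) \<Rightarrow> (real \<Rightarrow> real) \<Rightarrow> real \<Rightarrow> bool" where
  "volterra_defined c1 K1 K2 x t \<longleftrightarrow>
     (c1 \<noteq> 0 \<longrightarrow> x differentiable (at t within {0..})) \<and>
     set_integrable lborel {0..t} (\<lambda>\<tau>. K1 (t - \<tau>) * x \<tau>) \<and>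
     set_integrable lborel {0..t} (\<lambda>\<tau>. K2 (t - \<tau>) * x \<tau>) \<and>
     conv K2 x differentiable (at t within {0..})"

text \<open>
  The kernels may be singular at the origin, so the equation is imposed for \<open>t > 0\<close>. If \<open>c1 = 0\<close>
  the solution may itself have an integrable singularity at the origin, as for Abel's equation.
\<close>

definition classical_solution ::
    "real \<Rightarrow> real \<Rightarrow> (real \<Rightarrow> real) \<Rightarrow> (real \<Rightarrow> real) \<Rightarrow> real \<Rightarrow> (real \<Rightarrow> real) \<Rightarrow> (real \<Rightarrow> real) \<Rightarrow> bool"
  where
  "classical_solution c1 c0 K1 K2 x0 y x \<longleftrightarrow>
     continuous_on {0<..} x \<and> (\<forall>T>0. set_integrable lborel {0..T} x) \<and>
     (c1 \<noteq> 0 \<longrightarrow> continuous_on {0..} x \<and> x 0 = x0) \<and>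
     continuous_on {0..} (conv K2 x) \<and>
     (\<forall>t>0. volterra_defined c1 K1 K2 x t \<and> y t = volterra c1 c0 K1 K2 x t)"

definition sufficiently_regular ::
    "real \<Rightarrow> real \<Rightarrow> (real \<Rightarrow> real) \<Rightarrow> (real \<Rightarrow> real) \<Rightarrow> real \<Rightarrow> (real \<Rightarrow> real) \<Rightarrow> bool" where
  "sufficiently_regular c1 c0 K1 K2 x0 y \<longleftrightarrow>
     continuous_on {0..} y \<and> (\<exists>x. classical_solution c1 c0 K1 K2 x0 y x)"

end

theory Submission
  imports Defs
begin

text \<open>
  The Laplace transform turns the equation into multiplication by its symbol
  \<open>c1 p - c0 - \<integral> 1/(p + s) d\<lambda>1 + \<integral> p/(s (p + s)) d\<lambda>2\<close>, which is the value at \<open>-p\<close> of the Nevanlinna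
  function that defines \<open>B_reg\<close>; hence the symbols of the two equations have product \<open>-\<pi>\<^sup>2\<close>. This
  function is real analytic below the support of \<open>\<lambda>1 + \<lambda>2\<close> and strictly monotone there, so it has at
  most one zero, and \<open>\<mu>\<close> does not charge the rest of that half-line. Because solutions may grow
  arbitrarily fast, they are stopped at a finite time: the integrated equation then has an error
  that vanishes on \<open>[0, T]\<close>, an identity of convolutions follows from Lerch's theorem, and it is
  differentiated. The behaviour of the symbols at infinity decides which kernels are regular at the
  origin: \<open>c1 \<zeta>1 = 0\<close>, the measure \<open>\<mu>\<close> is finite if \<open>c1 \<noteq> 0\<close>, and \<open>\<lambda>1 + \<lambda>2\<close> is finite if \<open>\<zeta>1 \<noteq> 0\<close>,
  in which case \<open>y\<close> is differentiable for positive times.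
\<close>

text \<open>No solution is constructed: sufficient regularity supplies one, the formula is derived
  for it, and whatever the formula defines must agree with it for positive times. The task is thus
  an inversion for a given pair of x and y. The sign of -pi^2 comes from the factor i/pi that
  \<open>Q_reg\<close> carries twice. The corrections by sigma and xi are what turns the regularized
  kernel 1/(z - s) + s/(1 + s^2) into the plain kernels of the symbol. Two obstacles shape the
  proof. The identity that defines \<open>B_reg\<close> lives in the open upper half-plane, whereas
  Laplace variables p correspond to boundary points -p; at these it makes sense only once mu is
  known to be bounded below, so the support of mu has to be settled before any kernel J can be used.
  And the kernels, as well as x if c1 = 0, may be infinite at the origin, so that every identity is
  first proved in integrated form and differentiated last.\<close>

section \<open>Causal functions, convolution and Laplace transform\<close>

text \<open>Extension by 0 to the negative axis lets convolutions be taken over the whole line, and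
  integrability at one exponent q gives the Laplace transform at every p >= q.\<close>

definition causal :: "real \<Rightarrow> (real \<Rightarrow> real) \<Rightarrow> bool" where
  "causal q f \<longleftrightarrow> (\<forall>t<0. f t = 0) \<and> f \<in> borel_measurable borel \<and>
     integrable lborel (\<lambda>t. exp (- (q * t)) * f t)"

definition convolve :: "(real \<Rightarrow> real) \<Rightarrow> (real \<Rightarrow> real) \<Rightarrow> real \<Rightarrow> real" where
  "convolve f g t = (LINT \<tau>|lborel. f (t - \<tau>) * g \<tau>)"

definition lap :: "(real \<Rightarrow> real) \<Rightarrow> real \<Rightarrow> real" where
  "lap f p = (LINT t|lborel. exp (- (p * t)) * f t)"

lemma causalD:
  assumes "causal q f"
  shows "t < 0 \<Longrightarrow> f t = 0" "f \<in> borel_measurable borel"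
    "integrable lborel (\<lambda>t. exp (- (q * t)) * f t)"
  using assms unfolding causal_def by auto

lemma causal_mono:
  assumes f: "causal q f" and "q \<le> p"
  shows "causal p f"
  unfolding causal_def
proof (intro conjI)
  show "\<forall>t<0. f t = 0" "f \<in> borel_measurable borel" using causalD[OF f] by auto
  note [measurable] = causalD(2)[OF f]
  show "integrable lborel (\<lambda>t. exp (- (p * t)) * f t)"
  proof (rule Bochner_Integration.integrable_bound[OF causalD(3)[OF f]])
    show "AE t in lborel. norm (exp (- (p * t)) * f t) \<le> norm (exp (- (q * t)) * f t)"
    proof (rule AE_I2)
      fix t :: real
      show "norm (exp (- (p * t)) * f t) \<le> norm (exp (- (q * t)) * f t)"
      proof (cases "t < 0")
        case True
        then show ?thesis using causalD(1)[OF f] by simp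
      next
        case False
        then have "exp (- (p * t)) \<le> exp (- (q * t))"
          using \<open>q \<le> p\<close> by (simp add: mult_right_mono)
        then show ?thesis by (simp add: abs_mult mult_right_mono)
      qed
    qed
  qed measurable
qed

lemma causal_add: "causal q f \<Longrightarrow> causal q g \<Longrightarrow> causal q (\<lambda>t. f t + g t)"
  unfolding causal_def by (auto simp: distrib_left)

lemma causal_diff: "causal q f \<Longrightarrow> causal q g \<Longrightarrow> causal q (\<lambda>t. f t - g t)"
  unfolding causal_def by (auto simp: right_diff_distrib)

lemma causal_cmult: "causal q f \<Longrightarrow> causal q (\<lambda>t. a * f t)"
  unfolding causal_def by (auto simp: mult.left_commute[of _ a])

lemma causal_integrable:
  assumes "causal q f" "q \<le> p"
  shows "integrable lborel (\<lambda>t. exp (- (p * t)) * f t)"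
  using causalD(3)[OF causal_mono[OF assms]] .

lemma lap_add:
  "causal q f \<Longrightarrow> causal q g \<Longrightarrow> q \<le> p \<Longrightarrow> lap (\<lambda>t. f t + g t) p = lap f p + lap g p"
  unfolding lap_def by (simp add: distrib_left causal_integrable)

lemma lap_diff:
  "causal q f \<Longrightarrow> causal q g \<Longrightarrow> q \<le> p \<Longrightarrow> lap (\<lambda>t. f t - g t) p = lap f p - lap g p"
  unfolding lap_def by (simp add: right_diff_distrib causal_integrable)

lemma lap_cmult: "lap (\<lambda>t. a * f t) p = a * lap f p"
  unfolding lap_def by (simp add: mult.left_commute[of _ a])

lemma convolve_commute: "convolve f g t = convolve g f t"
proof -
  have "convolve f g t = \<bar>-1\<bar> *\<^sub>R (LINT \<tau>|lborel. f (t - (t + (-1) * \<tau>)) * g (t + (-1) * \<tau>))"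
    unfolding convolve_def by (rule lborel_integral_real_affine) simp
  then show ?thesis unfolding convolve_def by (simp add: mult.commute)
qed

lemma convolve_negative:
  assumes "causal q f" "causal q g" "t < 0"
  shows "convolve f g t = 0"
proof -
  have "f (t - \<tau>) * g \<tau> = 0" for \<tau>
    using causalD(1)[OF assms(1), of "t - \<tau>"] causalD(1)[OF assms(2), of \<tau>] assms(3)
    by (cases "\<tau> < 0") auto
  then have "(\<lambda>\<tau>. f (t - \<tau>) * g \<tau>) = (\<lambda>\<tau>. 0)" by blast
  then show ?thesis unfolding convolve_def by simp
qed

text \<open>Causality makes the value at t independent of everything after t. This is what allows an
  error that vanishes up to T to stay invisible up to T after further convolutions.\<close>

lemma convolve_cong_upto:
  assumes f: "causal q f" and g: "causal q g" "causal q g'" and eq: "\<And>s. 0 \<le> s \<Longrightarrow> s \<le> t \<Longrightarrow> g s = g' s"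
  shows "convolve f g t = convolve f g' t"
  unfolding convolve_def
proof (rule Bochner_Integration.integral_cong[OF refl])
  fix \<tau>
  show "f (t - \<tau>) * g \<tau> = f (t - \<tau>) * g' \<tau>"
    using causalD(1)[OF f, of "t - \<tau>"] causalD(1)[OF g(1), of \<tau>] causalD(1)[OF g(2), of \<tau>] eq[of \<tau>]
    by (cases "\<tau> < 0"; cases "t < \<tau>") auto
qed

text \<open>The weight exp(-p t) is multiplicative and can be distributed over the two factors;
  weighted statements on convolutions thereby reduce to integrable functions.\<close>

lemma exp_convolve:
  "exp (- (p * t)) * convolve f g t =
     (LINT \<tau>|lborel. (exp (- (p * (t - \<tau>))) * f (t - \<tau>)) * (exp (- (p * \<tau>)) * g \<tau>))"
proof -
  have "exp (- (p * t)) * (f (t - \<tau>) * g \<tau>) =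
     (exp (- (p * (t - \<tau>))) * f (t - \<tau>)) * (exp (- (p * \<tau>)) * g \<tau>)" for \<tau>
  proof -
    have "exp (- (p * t)) = exp (- (p * (t - \<tau>))) * exp (- (p * \<tau>))"
      by (simp add: exp_add[symmetric] algebra_simps)
    then show ?thesis by simp
  qed
  then have "(\<lambda>\<tau>. exp (- (p * t)) * (f (t - \<tau>) * g \<tau>)) =
     (\<lambda>\<tau>. (exp (- (p * (t - \<tau>))) * f (t - \<tau>)) * (exp (- (p * \<tau>)) * g \<tau>))" by blast
  then show ?thesis
    unfolding convolve_def integral_mult_right_zero[symmetric] by (rule arg_cong)
qed

lemma integrable_convolution:
  fixes F G :: "real \<Rightarrow> real"
  assumes F: "integrable lborel F" and G: "integrable lborel G"
  shows "integrable (lborel \<Otimes>\<^sub>M lborel) (\<lambda>(\<tau>, t). F (t - \<tau>) * G \<tau>)"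
proof (rule lborel_pair.Fubini_integrable)
  have [measurable]: "F \<in> borel_measurable borel" "G \<in> borel_measurable borel"
    using borel_measurable_integrable[OF F] borel_measurable_integrable[OF G] by auto
  show "(\<lambda>(\<tau>, t). F (t - \<tau>) * G \<tau>) \<in> borel_measurable (lborel \<Otimes>\<^sub>M lborel)"
    by measurable
  have sh: "integrable lborel (\<lambda>t. F (t - \<tau>))" for \<tau>
    using lborel_integrable_real_affine[OF F, of 1 "-\<tau>"] by (simp add: algebra_simps)
  have eq: "(LINT t|lborel. \<bar>F (t - \<tau>)\<bar>) = (LINT t|lborel. \<bar>F t\<bar>)" for \<tau>
    using lborel_integral_real_affine[of 1 "\<lambda>t. \<bar>F t\<bar>" "-\<tau>"] by (simp add: algebra_simps)
  have "integrable lborel (\<lambda>\<tau>. (LINT t|lborel. \<bar>F t\<bar>) * \<bar>G \<tau>\<bar>)"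
    using G by (intro integrable_mult_right) auto
  then show "integrable lborel (\<lambda>\<tau>. LINT t|lborel. norm (case (\<tau>, t) of (\<tau>, t) \<Rightarrow> F (t - \<tau>) * G \<tau>))"
    by (simp add: abs_mult eq)
  show "AE \<tau> in lborel. integrable lborel (\<lambda>t. case (\<tau>, t) of (\<tau>, t) \<Rightarrow> F (t - \<tau>) * G \<tau>)"
    using sh by simp
qed

lemma causal_convolve:
  assumes f: "causal q f" and g: "causal q g"
  shows "causal q (convolve f g)"
  unfolding causal_def
proof (intro conjI)
  show "\<forall>t<0. convolve f g t = 0" using convolve_negative[OF f g] by auto
  note [measurable] = causalD(2)[OF f] causalD(2)[OF g]
  show "convolve f g \<in> borel_measurable borel"
    unfolding convolve_def[abs_def] by measurable
  show "integrable lborel (\<lambda>t. exp (- (q * t)) * convolve f g t)"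
    unfolding exp_convolve
    using lborel_pair.integrable_snd[OF integrable_convolution[OF causalD(3)[OF f] causalD(3)[OF g]]]
    by simp
qed

lemma lap_convolve:
  assumes f: "causal q f" and g: "causal q g" and "q \<le> p"
  shows "lap (convolve f g) p = lap f p * lap g p"
proof -
  define F where "F = (\<lambda>t. exp (- (p * t)) * f t)"
  define G where "G = (\<lambda>t. exp (- (p * t)) * g t)"
  have F: "integrable lborel F" and G: "integrable lborel G"
    unfolding F_def G_def using causal_integrable f g \<open>q \<le> p\<close> by auto
  have eq: "(LINT t|lborel. F (t - \<tau>)) = (LINT t|lborel. F t)" for \<tau>
    using lborel_integral_real_affine[of 1 F "-\<tau>"] by (simp add: algebra_simps)
  have "lap (convolve f g) p = (LINT t|lborel. LINT \<tau>|lborel. F (t - \<tau>) * G \<tau>)"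
    unfolding lap_def exp_convolve F_def G_def ..
  also have "\<dots> = (LINT \<tau>|lborel. LINT t|lborel. F (t - \<tau>) * G \<tau>)"
    using lborel_pair.Fubini_integral[OF integrable_convolution[OF F G]] by simp
  also have "\<dots> = (LINT t|lborel. F t) * (LINT \<tau>|lborel. G \<tau>)"
    by (simp add: eq)
  finally show ?thesis unfolding lap_def F_def G_def .
qed


section \<open>Integration as convolution with the unit step\<close>

abbreviation one_fn :: "real \<Rightarrow> real" where "one_fn \<equiv> indicator {0..}"

lemma lap_integral_exp:
  assumes "0 < (c::real)"
  shows "integrable lborel (\<lambda>t. exp (- (c * t)) * one_fn t)"
    "(LINT t|lborel. exp (- (c * t)) * one_fn t) = 1 / c"
proof -
  have 1: "((\<lambda>t. exp (- (c * t))) has_integral exp (- (c * 0)) / c) {0..}"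
    using has_integral_exp_minus_to_infinity[of c 0] assms by (simp add: mult.commute)
  have "set_integrable lebesgue {0..} (\<lambda>t. exp (- (c * t)))"
    using 1 by (intro nonnegative_absolutely_integrable_1) (auto simp: integrable_on_def)
  then have 2: "set_integrable lborel {0..} (\<lambda>t. exp (- (c * t)))"
    unfolding set_integrable_def by (subst (asm) integrable_completion) auto
  then show "integrable lborel (\<lambda>t. exp (- (c * t)) * one_fn t)"
    unfolding set_integrable_def by (simp add: mult.commute)
  have "(LINT t:{0..}|lborel. exp (- (c * t))) = 1 / c"
    using set_borel_integral_eq_integral(2)[OF 2] 1 by (simp add: integral_unique)
  then show "(LINT t|lborel. exp (- (c * t)) * one_fn t) = 1 / c"
    unfolding set_lebesgue_integral_def by (simp add: mult.commute)
qed

lemma causal_one: "0 < q \<Longrightarrow> causal q one_fn"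
  unfolding causal_def using lap_integral_exp(1) by auto

lemma lap_one: "0 < p \<Longrightarrow> lap one_fn p = 1 / p"
  unfolding lap_def using lap_integral_exp(2) by auto

lemma causal_set_integrable:
  assumes f: "causal q f"
  shows "set_integrable lborel {a..b} f"
proof -
  note [measurable] = causalD(2)[OF f]
  obtain C where C: "\<And>t. t \<in> {a..b} \<Longrightarrow> exp (q * t) \<le> C"
  proof -
    have "exp (q * t) \<le> exp (\<bar>q\<bar> * (\<bar>a\<bar> + \<bar>b\<bar>))" if "t \<in> {a..b}" for t
    proof -
      have "q * t \<le> \<bar>q\<bar> * \<bar>t\<bar>" by (metis abs_ge_self abs_mult)
      also have "\<dots> \<le> \<bar>q\<bar> * (\<bar>a\<bar> + \<bar>b\<bar>)" using that by (intro mult_left_mono) auto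
      finally show ?thesis by simp
    qed
    then show thesis by (rule that)
  qed
  have "integrable lborel (\<lambda>t. C * (exp (- (q * t)) * f t))"
    using causalD(3)[OF f] by simp
  then show ?thesis
    unfolding set_integrable_def
  proof (rule Bochner_Integration.integrable_bound)
    show "AE t in lborel. norm (indicator {a..b} t *\<^sub>R f t) \<le> norm (C * (exp (- (q * t)) * f t))"
    proof (rule AE_I2)
      fix t
      show "norm (indicator {a..b} t *\<^sub>R f t) \<le> norm (C * (exp (- (q * t)) * f t))"
      proof (cases "t \<in> {a..b}")
        case True
        have "1 \<le> C * exp (- (q * t))"
          using C[OF True] by (simp add: exp_minus divide_simps)
        then have "1 * \<bar>f t\<bar> \<le> \<bar>C * exp (- (q * t))\<bar> * \<bar>f t\<bar>"
          by (intro mult_right_mono) auto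
        then show ?thesis using True by (simp add: abs_mult mult.assoc)
      qed simp
    qed
  qed measurable
qed

lemma convolve_one:
  assumes f: "causal q f"
  shows "f integrable_on {a..b}" "0 \<le> t \<Longrightarrow> convolve one_fn f t = integral {0..t} f"
proof -
  show "f integrable_on {a..b}"
    using set_borel_integral_eq_integral(1)[OF causal_set_integrable[OF f]] .
  assume t: "0 \<le> t"
  have "convolve one_fn f t = (LINT \<tau>:{0..t}|lborel. f \<tau>)"
    unfolding convolve_def set_lebesgue_integral_def
    using causalD(1)[OF f] by (intro Bochner_Integration.integral_cong) (auto simp: indicator_def not_le)
  then show "convolve one_fn f t = integral {0..t} f"
    using set_borel_integral_eq_integral(2)[OF causal_set_integrable[OF f]] by simp
qed

lemma causal_bounded_interval:
  assumes g: "set_integrable lborel {0..T} g"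
  shows "causal q (\<lambda>t. indicator {0..T} t * g t)"
  unfolding causal_def
proof (intro conjI)
  show [measurable]: "(\<lambda>t. indicator {0..T} t * g t) \<in> borel_measurable borel"
    using borel_measurable_integrable[OF g[unfolded set_integrable_def]] by simp
  have "integrable lborel (\<lambda>t. exp (\<bar>q\<bar> * T) * (indicator {0..T} t * g t))"
    using g unfolding set_integrable_def by simp
  then show "integrable lborel (\<lambda>t. exp (- (q * t)) * (indicator {0..T} t * g t))"
  proof (rule Bochner_Integration.integrable_bound)
    have "exp (- (q * t)) \<le> exp (\<bar>q\<bar> * T)" if "t \<in> {0..T}" for t
    proof -
      have "- (q * t) \<le> \<bar>q\<bar> * \<bar>t\<bar>" by (metis abs_ge_minus_self abs_mult)
      also have "\<dots> \<le> \<bar>q\<bar> * T" using that by (intro mult_left_mono) auto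
      finally show ?thesis by simp
    qed
    then show "AE t in lborel. norm (exp (- (q * t)) * (indicator {0..T} t * g t))
        \<le> norm (exp (\<bar>q\<bar> * T) * (indicator {0..T} t * g t))"
      by (intro AE_I2) (auto simp: indicator_def abs_mult mult_right_mono)
  qed measurable
qed auto

lemma continuous_convolve_one:
  assumes f: "causal q f"
  shows "continuous_on {0..} (convolve one_fn f)"
  unfolding continuous_on_eq_continuous_within
proof
  fix t :: real assume t: "t \<in> {0..}"
  have "continuous_on {0..t+1} (\<lambda>u. integral {0..u} f)"
    by (rule indefinite_integral_continuous_1[OF convolve_one(1)[OF f]])
  then have "continuous_on {0..t+1} (convolve one_fn f)"
    by (rule continuous_on_eq) (use convolve_one(2)[OF f] in auto)
  then have "continuous (at t within {0..t+1}) (convolve one_fn f)"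
    using t by (auto simp: continuous_on_eq_continuous_within)
  moreover have "at t within {0..} = at t within {0..t+1}"
    by (rule at_within_nhd[of _ "{..<t+1}"]) auto
  ultimately show "continuous (at t within {0..}) (convolve one_fn f)" by (simp add: continuous_within)
qed

lemma convolve_one_has_derivative:
  assumes f: "causal q f" and t: "0 < t" and cont: "isCont f t"
  shows "(convolve one_fn f has_vector_derivative f t) (at t within {0..})"
proof -
  have "((\<lambda>u. integral {0..u} f) has_vector_derivative f t) (at t within {0..t+1})"
    using integral_has_vector_derivative_continuous_at[OF convolve_one(1)[OF f], of t 0 "t + 1" "{}"] t cont
    by (auto intro: continuous_at_imp_continuous_at_within)
  then have "(convolve one_fn f has_vector_derivative f t) (at t within {0..t+1})"
    by (rule has_vector_derivative_transform[rotated 2]) (use t convolve_one(2)[OF f] in auto)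
  moreover have "at t within {0..} = at t within {0..t+1}"
    by (rule at_within_nhd[of _ "{..<t+1}"]) auto
  ultimately show ?thesis by simp
qed

text \<open>Covers the one-sided derivative at t = 0 as well, at the price of continuity up to the
  endpoint; functions that are singular at the origin are left to the preceding version.\<close>

lemma convolve_one_has_derivative_cont:
  assumes f: "causal q f" and t: "0 \<le> t" "t < T" and cont: "continuous_on {0..T} f"
  shows "(convolve one_fn f has_vector_derivative f t) (at t within {0..})"
proof -
  have "((\<lambda>u. integral {0..u} f) has_vector_derivative f t) (at t within {0..T})"
    using t cont by (intro integral_has_vector_derivative) auto
  then have "(convolve one_fn f has_vector_derivative f t) (at t within {0..T})"
    by (rule has_vector_derivative_transform[rotated 2]) (use t convolve_one(2)[OF f] in auto)
  moreover have "at t within {0..} = at t within {0..T}"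
    by (rule at_within_nhd[of _ "{..<T}"]) (use t in auto)
  ultimately show ?thesis by simp
qed

lemma convolve_one_eq_0D:
  assumes f: "causal q f" and zero: "\<And>t. 0 < t \<Longrightarrow> t < T \<Longrightarrow> convolve one_fn f t = 0"
    and cont: "continuous_on {0<..<T} f" and t: "0 < t" "t < T"
  shows "f t = 0"
proof -
  have "isCont f t" using cont t by (simp add: continuous_on_eq_continuous_at)
  from convolve_one_has_derivative[OF f t(1) this]
  have "(convolve one_fn f has_vector_derivative f t) (at t)"
    using t(1) at_within_interior[of t "{0..}"] by simp
  moreover have "(convolve one_fn f has_vector_derivative 0) (at t)"
  proof (rule has_vector_derivative_transform_within_open[where f = "\<lambda>_. 0" and S = "{0<..<T}"])
    show "((\<lambda>_. 0) has_vector_derivative 0) (at t)" by simp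
  qed (use t zero in auto)
  ultimately show ?thesis by (rule vector_derivative_unique_at)
qed

lemma convolve_one_convolve_one_eq_0D:
  assumes f: "causal q f" "0 < q" and zero: "\<And>t. 0 < t \<Longrightarrow> t < T \<Longrightarrow> convolve one_fn (convolve one_fn f) t = 0"
    and cont: "continuous_on {0<..<T} f" and t: "0 < t" "t < T"
  shows "f t = 0"
proof (rule convolve_one_eq_0D[OF f(1) _ cont t])
  fix s assume s: "0 < s" "s < T"
  show "convolve one_fn f s = 0"
  proof (rule convolve_one_eq_0D[OF causal_convolve[OF causal_one[OF f(2)] f(1)] zero _ s])
    show "continuous_on {0<..<T} (convolve one_fn f)"
      by (rule continuous_on_subset[OF continuous_convolve_one[OF f(1)]]) auto
  qed
qed

text \<open>For s <= t the factor exp(q (t - s)) is at least 1 and may be inserted into the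
  integral. The resulting growth rate is what makes the transplanted function in Lerch's theorem
  continuous at u = 0.\<close>

lemma convolve_one_bound:
  assumes f: "causal q f" and "0 \<le> q" "0 \<le> t"
  shows "\<bar>convolve one_fn f t\<bar> \<le> exp (q * t) * (LINT s|lborel. \<bar>exp (- (q * s)) * f s\<bar>)"
proof -
  have "\<bar>convolve one_fn f t\<bar> \<le> (LINT s|lborel. \<bar>one_fn (t - s) * f s\<bar>)"
    unfolding convolve_def by (rule integral_abs_bound)
  also have "\<dots> \<le> (LINT s|lborel. exp (q * t) * \<bar>exp (- (q * s)) * f s\<bar>)"
  proof (rule integral_mono')
    show "integrable lborel (\<lambda>s. exp (q * t) * \<bar>exp (- (q * s)) * f s\<bar>)"
      using causalD(3)[OF f] by simp
    fix s
    show "\<bar>one_fn (t - s) * f s\<bar> \<le> exp (q * t) * \<bar>exp (- (q * s)) * f s\<bar>"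
    proof (cases "s \<le> t")
      case True
      have "1 \<le> exp (q * t) * exp (- (q * s))"
        using True \<open>0 \<le> q\<close> by (simp add: exp_add[symmetric] mult_left_mono)
      then have "1 * \<bar>f s\<bar> \<le> (exp (q * t) * exp (- (q * s))) * \<bar>f s\<bar>"
        by (intro mult_right_mono) auto
      then show ?thesis using True by (simp add: abs_mult mult.assoc)
    qed auto
  qed auto
  finally show ?thesis by simp
qed

section \<open>Uniqueness of Laplace transforms\<close>

lemma poly_exp_integral_0:
  assumes P: "real_polynomial_function P"
    and w: "\<And>n. integrable lborel (\<lambda>t. w t * exp (- t) ^ n)"
    and 0: "\<And>n::nat. (LINT t|lborel. w t * exp (- t) ^ n) = 0"
  shows "(LINT t|lborel. w t * P (exp (- t))) = (0::real)" "integrable lborel (\<lambda>t. w t * P (exp (- t)))"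
proof -
  obtain a n where P: "P = (\<lambda>x. \<Sum>i\<le>n. a i * x ^ i)"
    using P real_polynomial_function_iff_sum by auto
  have eq: "w t * P (exp (- t)) = (\<Sum>i\<le>n. a i * (w t * exp (- t) ^ i))" for t
    unfolding P by (simp add: sum_distrib_left mult.left_commute)
  show "integrable lborel (\<lambda>t. w t * P (exp (- t)))" unfolding eq using w by simp
  show "(LINT t|lborel. w t * P (exp (- t))) = 0"
    unfolding eq using w 0 by simp
qed

text \<open>Lerch's theorem, by the substitution \<open>u = exp (- t)\<close> and Weierstrass approximation on
  \<open>[0, 1]\<close>; passing to the antiderivative makes the function continuous.\<close>

lemma lap_eq_0_imp_convolve_one_eq_0:
  assumes f: "causal q f" and q: "0 < q" and zero: "\<And>p. q \<le> p \<Longrightarrow> lap f p = 0" and t0: "0 \<le> t0"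
  shows "convolve one_fn f t0 = 0"
proof -
  define F where "F = convolve one_fn f"
  define M where "M = (LINT s|lborel. \<bar>exp (- (q * s)) * f s\<bar>)"
  have F: "causal q F" unfolding F_def by (rule causal_convolve[OF causal_one[OF q] f])
  note [measurable] = causalD(2)[OF F]
  have lapF: "lap F p = 0" if "q \<le> p" for p
    unfolding F_def using lap_convolve[OF causal_one[OF q] f that] zero[OF that] by simp
  have M: "\<bar>F t\<bar> \<le> exp (q * t) * M" if "0 \<le> t" for t
    unfolding F_def M_def using convolve_one_bound[OF f _ that] q by simp
  have M0: "0 \<le> M" unfolding M_def by simp
  \<comment> \<open>The surplus 1 over the growth rate q leaves the bound
    \<open>\<bar>\<phi> u\<bar> \<le> M * u\<close>, hence continuity at 0. The moments of
    \<open>w\<close> against powers of exp(-t) are the values \<open>lap F (r + n)\<close>, which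
    all vanish.\<close>
  define r where "r = q + 1"
  define w where "w = (\<lambda>t. exp (- (r * t)) * F t)"
  have wexp: "w t * exp (- t) ^ n = exp (- ((r + n) * t)) * F t" for t and n :: nat
  proof -
    have "exp (- (r * t)) * exp (- t) ^ n = exp (- ((r + n) * t))"
      by (simp add: exp_of_nat_mult[symmetric] exp_add[symmetric] algebra_simps)
    then show ?thesis unfolding w_def by (simp add: algebra_simps)
  qed
  have wint: "integrable lborel (\<lambda>t. w t * exp (- t) ^ n)" for n
    unfolding wexp by (rule causal_integrable[OF F]) (simp add: r_def)
  have w0: "(LINT t|lborel. w t * exp (- t) ^ n) = 0" for n :: nat
    unfolding wexp using lapF[of "r + n"] by (simp add: lap_def r_def)
  \<comment> \<open>The transplant of \<open>w\<close> to [0, 1]; the value 0 at u = 0 is its limit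
    there, that is for t tending to infinity.\<close>
  define \<phi> where "\<phi> = (\<lambda>u::real. if u \<le> 0 then 0 else u powr r * F (- ln u))"
  have \<phi>exp: "\<phi> (exp (- t)) = w t" for t
    unfolding \<phi>_def w_def by (simp add: powr_def)
  have Fcont: "continuous_on {0..} F" unfolding F_def by (rule continuous_convolve_one[OF f])
  have "continuous_on {0..1} \<phi>"
    unfolding continuous_on_eq_continuous_within
  proof
    fix u :: real assume u: "u \<in> {0..1}"
    show "continuous (at u within {0..1}) \<phi>"
    proof (cases "u = 0")
      case False
      have "continuous_on {0<..1} (\<lambda>u. u powr r * F (- ln u))"
        by (intro continuous_intros continuous_on_compose2[OF Fcont]) auto
      then have "continuous_on {0<..1} \<phi>"
        by (rule continuous_on_eq) (auto simp: \<phi>_def)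
      then have "continuous (at u within {0<..1}) \<phi>"
        using u False by (auto simp: continuous_on_eq_continuous_within)
      moreover have "at u within {0<..1} = at u within {0..1}"
        by (rule at_within_nhd[of _ "{0<..}"]) (use u False in auto)
      ultimately show ?thesis by (simp add: continuous_within)
    next
      case True
      have "(\<phi> \<longlongrightarrow> 0) (at 0 within {0..1})"
      proof (rule Lim_null_comparison)
        show "\<forall>\<^sub>F u in at 0 within {0..1}. norm (\<phi> u) \<le> M * u"
          unfolding eventually_at_filter
        proof (intro always_eventually allI impI)
          fix u :: real assume u: "u \<noteq> 0" "u \<in> {0..1}"
          then have "\<bar>F (- ln u)\<bar> \<le> exp (q * (- ln u)) * M" by (intro M) auto
          also have "exp (q * (- ln u)) = u powr (- q)" using u by (simp add: powr_def)
          finally have "\<bar>\<phi> u\<bar> \<le> u powr r * (u powr (- q) * M)"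
            using u unfolding \<phi>_def by (auto simp: abs_mult intro!: mult_left_mono)
          also have "\<dots> = (u powr r * u powr (- q)) * M" by simp
          also have "u powr r * u powr (- q) = u"
            using u by (simp add: powr_add[symmetric] r_def)
          finally show "norm (\<phi> u) \<le> M * u" by (simp add: mult.commute)
        qed
        show "((\<lambda>u. M * u) \<longlongrightarrow> 0) (at 0 within {0..1})"
          by (rule tendsto_eq_intros refl)+ simp
      qed
      then show ?thesis using True by (simp add: continuous_within \<phi>_def)
    qed
  qed
  note \<phi>cont = this
  have w2: "integrable lborel (\<lambda>t. w t * w t)"
  proof (rule Bochner_Integration.integrable_bound)
    show "integrable lborel (\<lambda>t. M * w t)" using wint[of 0] by simp
    show "AE t in lborel. norm (w t * w t) \<le> norm (M * w t)"
    proof (rule AE_I2)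
      fix t
      have "\<bar>w t\<bar> \<le> M"
      proof (cases "0 \<le> t")
        case True
        have "\<bar>w t\<bar> \<le> exp (- (r * t)) * (exp (q * t) * M)"
          unfolding w_def using M[OF True] by (simp add: abs_mult)
        also have "\<dots> = exp (- t) * M" by (simp add: r_def exp_add[symmetric] algebra_simps)
        also have "\<dots> \<le> 1 * M" using True M0 by (intro mult_right_mono) auto
        finally show ?thesis by simp
      qed (use causalD(1)[OF F] M0 in \<open>auto simp: w_def not_le\<close>)
      then have "\<bar>w t\<bar> * \<bar>w t\<bar> \<le> M * \<bar>w t\<bar>" by (intro mult_right_mono) auto
      then show "norm (w t * w t) \<le> norm (M * w t)"
        using M0 by (simp add: abs_mult)
    qed
  qed (simp add: w_def)
  \<comment> \<open>\<open>w\<close> is orthogonal to every polynomial in exp(-t), so a polynomial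
    approximation of it may be subtracted from one factor of the square without changing the
    integral.\<close>
  have small: "(LINT t|lborel. w t * w t) \<le> e * (LINT t|lborel. \<bar>w t\<bar>)" if e: "0 < e" for e
  proof -
    obtain P where P: "real_polynomial_function P" "\<And>u. u \<in> {0..1} \<Longrightarrow> \<bar>\<phi> u - P u\<bar> < e"
      using Stone_Weierstrass_real_polynomial_function[OF _ \<phi>cont e] by auto
    note P0 = poly_exp_integral_0[OF P(1) wint w0]
    have "(LINT t|lborel. w t * w t) = (LINT t|lborel. w t * w t - w t * P (exp (- t)))"
      using w2 P0 by simp
    also have "\<dots> \<le> (LINT t|lborel. e * \<bar>w t\<bar>)"
    proof (rule integral_mono)
      show "integrable lborel (\<lambda>t. w t * w t - w t * P (exp (- t)))" using w2 P0 by simp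
      show "integrable lborel (\<lambda>t. e * \<bar>w t\<bar>)" using wint[of 0] by simp
      fix t
      show "w t * w t - w t * P (exp (- t)) \<le> e * \<bar>w t\<bar>"
      proof (cases "0 \<le> t")
        case True
        have "w t * w t - w t * P (exp (- t)) = w t * (w t - P (exp (- t)))" by (simp add: algebra_simps)
        also have "\<dots> \<le> \<bar>w t\<bar> * \<bar>w t - P (exp (- t))\<bar>" by (metis abs_ge_self abs_mult)
        also have "\<dots> \<le> \<bar>w t\<bar> * e"
          using P(2)[of "exp (- t)"] True \<phi>exp[of t] by (intro mult_left_mono) auto
        finally show ?thesis by (simp add: mult.commute)
      qed (use causalD(1)[OF F] in \<open>auto simp: w_def not_le\<close>)
    qed
    finally show ?thesis by simp
  qed
  have "(LINT t|lborel. w t * w t) \<le> 0"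
  proof (rule field_le_epsilon)
    fix e :: real assume e: "0 < e"
    define I where "I = (LINT t|lborel. \<bar>w t\<bar>)"
    have I: "0 \<le> I" unfolding I_def by simp
    have "(LINT t|lborel. w t * w t) \<le> e / (I + 1) * I"
      using small[of "e / (I + 1)"] e I unfolding I_def by simp
    also have "\<dots> \<le> e" using e I by (simp add: divide_simps)
    finally show "(LINT t|lborel. w t * w t) \<le> 0 + e" by simp
  qed
  then have "(LINT t|lborel. w t * w t) = 0"
    by (intro antisym) auto
  then have "AE t in lborel. w t * w t = 0"
    using integral_nonneg_eq_0_iff_AE[OF w2] by auto
  then have AE0: "AE t in lborel. F t = 0" by (rule AE_mp) (auto simp: w_def)
  \<comment> \<open>So far \<open>F\<close> vanishes almost everywhere only; integrating once more
    and differentiating at points of continuity reaches every t > 0.\<close>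
  have "convolve one_fn F t = 0" for t
    unfolding convolve_def using AE0 by (intro integral_eq_zero_AE) auto
  then have *: "F t = 0" if "0 < t" for t
  proof (rule convolve_one_eq_0D[OF F, where T = "t + 1"])
    show "continuous_on {0<..<t + 1} F"
      by (rule continuous_on_subset[OF Fcont]) auto
  qed (use that \<open>\<And>t. convolve one_fn F t = 0\<close> in auto)
  show ?thesis
  proof (cases "t0 = 0")
    case False
    then show ?thesis using * t0 unfolding F_def by simp
  next
    case True
    then show ?thesis using convolve_one(2)[OF f, of 0] by simp
  qed
qed

text \<open>The conclusion is about antiderivatives because the transform determines the functions
  themselves only up to null sets.\<close>

lemma lap_inject:
  assumes f: "causal q f" and g: "causal q g" and q: "0 < q"
    and eq: "\<And>p. q \<le> p \<Longrightarrow> lap f p = lap g p" and t: "0 \<le> t"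
  shows "convolve one_fn f t = convolve one_fn g t"
proof -
  have "convolve one_fn (\<lambda>t. f t - g t) t = 0"
    by (rule lap_eq_0_imp_convolve_one_eq_0[OF causal_diff[OF f g] q _ t]) (simp add: lap_diff[OF f g] eq)
  moreover have "convolve one_fn (\<lambda>t. f t - g t) t = convolve one_fn f t - convolve one_fn g t"
    using convolve_one(2)[OF causal_diff[OF f g] t] convolve_one[OF f] convolve_one[OF g] t
    by (simp add: Henstock_Kurzweil_Integration.integral_diff)
  ultimately show ?thesis by simp
qed

section \<open>Continuity of convolutions\<close>

lemma isCont_convolve_piecewise:
  assumes f: "causal q f" and g: "causal q' g" and a: "0 \<le> a" and cont: "continuous_on {a..} g"
    and g0: "\<And>t. t < a \<Longrightarrow> g t = 0"
  shows "isCont (convolve f g) t"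
  unfolding continuous_at_sequentially
proof (intro allI impI)
  note [measurable] = causalD(2)[OF f] causalD(2)[OF g]
  fix s :: "nat \<Rightarrow> real" assume s: "s \<longlonglongrightarrow> t"
  have "Bseq s" using s by (intro convergent_imp_Bseq convergentI)
  then obtain T where T: "\<And>n. \<bar>s n\<bar> \<le> T" unfolding Bseq_def by auto
  have "compact (g ` {a..T})"
    by (intro compact_continuous_image continuous_on_subset[OF cont]) auto
  then obtain B where B: "\<And>u. a \<le> u \<Longrightarrow> u \<le> T \<Longrightarrow> \<bar>g u\<bar> \<le> B"
    using compact_imp_bounded by (fastforce simp: bounded_iff)
  define B' where "B' = max B 0"
  have g_cont: "isCont g u" if "u \<noteq> a" for u
  proof (cases "u < a")
    case True
    have "continuous_on {..<a} g"
      by (rule continuous_on_eq[of _ "\<lambda>_. 0"]) (use g0 in auto)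
    then show ?thesis using True by (simp add: continuous_on_eq_continuous_at)
  next
    case False
    have "continuous_on {a<..} g"
      by (rule continuous_on_subset[OF cont]) auto
    then show ?thesis using False that by (simp add: continuous_on_eq_continuous_at)
  qed
  have "(\<lambda>n. LINT \<tau>|lborel. g (s n - \<tau>) * f \<tau>) \<longlonglongrightarrow> (LINT \<tau>|lborel. g (t - \<tau>) * f \<tau>)"
  proof (rule integral_dominated_convergence)
    show "integrable lborel (\<lambda>\<tau>. B' * \<bar>indicator {0..T} \<tau> * f \<tau>\<bar>)"
      using causal_set_integrable[OF f, of 0 T] unfolding set_integrable_def by simp
    show "AE \<tau> in lborel. norm (g (s n - \<tau>) * f \<tau>) \<le> B' * \<bar>indicator {0..T} \<tau> * f \<tau>\<bar>" for n
    proof (rule AE_I2)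
      fix \<tau> show "norm (g (s n - \<tau>) * f \<tau>) \<le> B' * \<bar>indicator {0..T} \<tau> * f \<tau>\<bar>"
      proof (cases "0 \<le> \<tau> \<and> a \<le> s n - \<tau>")
        case True
        then have "s n - \<tau> \<le> T" "\<tau> \<le> T" using T[of n] a by auto
        then have "\<bar>g (s n - \<tau>)\<bar> \<le> B'" using B True unfolding B'_def by fastforce
        then show ?thesis using True \<open>\<tau> \<le> T\<close> by (simp add: abs_mult mult_right_mono)
      next
        case False
        then have z: "g (s n - \<tau>) * f \<tau> = 0" using causalD(1)[OF f] g0 by (auto simp: not_le)
        show ?thesis unfolding z B'_def by simp
      qed
    qed
    \<comment> \<open>The possible jump of \<open>g\<close> at a is met for a single
      \<open>\<tau>\<close>.\<close>
    have "AE \<tau> in lborel. \<tau> \<noteq> t - a" by (rule AE_lborel_singleton)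
    then show "AE \<tau> in lborel. (\<lambda>n. g (s n - \<tau>) * f \<tau>) \<longlonglongrightarrow> g (t - \<tau>) * f \<tau>"
    proof eventually_elim
      fix \<tau> assume "\<tau> \<noteq> t - a"
      then have "isCont g (t - \<tau>)" by (intro g_cont) auto
      then show "(\<lambda>n. g (s n - \<tau>) * f \<tau>) \<longlonglongrightarrow> g (t - \<tau>) * f \<tau>"
        by (intro tendsto_mult isCont_tendsto_compose[of _ g] tendsto_intros s)
    qed
  qed auto
  then show "(convolve f g \<circ> s) \<longlonglongrightarrow> convolve f g t"
    unfolding convolve_commute[of f g] by (simp add: convolve_def o_def)
qed

lemma causal_cut: "causal q f \<Longrightarrow> A \<in> sets borel \<Longrightarrow> causal q (\<lambda>t. indicator A t * f t)"
  unfolding causal_def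
  using integrable_mult_indicator[of A lborel "\<lambda>t. exp (- (q * t)) * f t"]
  by (auto simp: mult.left_commute[of "exp _"])

lemma causal_cut_integrable:
  assumes f: "causal q f" and g: "causal q' g" and a: "0 \<le> a" and cont: "continuous_on {a..} g"
    and g0: "\<And>t. t < a \<Longrightarrow> g t = 0"
  shows "integrable lborel (\<lambda>\<tau>. f (t - \<tau>) * g \<tau>)"
proof -
  note [measurable] = causalD(2)[OF f] causalD(2)[OF g]
  have "compact (g ` {a..t})"
    by (intro compact_continuous_image continuous_on_subset[OF cont]) auto
  then obtain B where B: "\<And>u. a \<le> u \<Longrightarrow> u \<le> t \<Longrightarrow> \<bar>g u\<bar> \<le> B"
    using compact_imp_bounded by (fastforce simp: bounded_iff)
  have "integrable lborel (\<lambda>\<tau>. indicator {0..t} \<tau> * f \<tau>)"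
    using causal_set_integrable[OF f, of 0 t] unfolding set_integrable_def by simp
  from lborel_integrable_real_affine[OF this, of "-1" t]
  have "integrable lborel (\<lambda>\<tau>. B * (indicator {0..t} (t - \<tau>) * f (t - \<tau>)))" by simp
  then show ?thesis
  proof (rule Bochner_Integration.integrable_bound)
    show "AE \<tau> in lborel. norm (f (t - \<tau>) * g \<tau>) \<le> norm (B * (indicator {0..t} (t - \<tau>) * f (t - \<tau>)))"
    proof (rule AE_I2)
      fix \<tau> show "norm (f (t - \<tau>) * g \<tau>) \<le> norm (B * (indicator {0..t} (t - \<tau>) * f (t - \<tau>)))"
      proof (cases "\<tau> \<le> t \<and> a \<le> \<tau>")
        case True
        then have "\<bar>g \<tau>\<bar> \<le> B" "\<tau> \<ge> 0" using B a by auto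
        then show ?thesis using True by (auto simp: abs_mult mult.commute intro!: mult_right_mono)
      next
        case False
        then have z: "f (t - \<tau>) * g \<tau> = 0" using causalD(1)[OF f, of "t - \<tau>"] g0 by (auto simp: not_le)
        show ?thesis unfolding z by simp
      qed
    qed
  qed measurable
qed

text \<open>Both factors may be singular at 0. Since tau and s - tau cannot both be less than a when
  s > 2 a, the integrand splits into two parts, in each of which one factor is cut off away from its
  singularity.\<close>

lemma isCont_convolve:
  assumes f: "causal q f" and g: "causal q' g"
    and cf: "continuous_on {0<..} f" and cg: "continuous_on {0<..} g" and t: "0 < t"
  shows "isCont (convolve f g) t"
proof -
  \<comment> \<open>A quarter of t, so that t lies in the open set s > 2 a on which the splitting is
    valid.\<close>
  define a where "a = t / 4"
  define fr where "fr = (\<lambda>t. indicator {a..} t * f t)"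
  define gr where "gr = (\<lambda>t. indicator {a..} t * g t)"
  define gs where "gs = (\<lambda>t. indicator {..<a} t * g t)"
  have a: "0 < a" using t by (simp add: a_def)
  have fr: "causal q fr" and gr: "causal q' gr" and gs: "causal q' gs"
    unfolding fr_def gr_def gs_def using f g by (auto intro!: causal_cut)
  have cfr: "continuous_on {a..} fr"
    by (rule continuous_on_eq[OF continuous_on_subset[OF cf]]) (use a in \<open>auto simp: fr_def\<close>)
  have cgr: "continuous_on {a..} gr"
    by (rule continuous_on_eq[OF continuous_on_subset[OF cg]]) (use a in \<open>auto simp: gr_def\<close>)
  note pf = fr _ cfr and pg = gr _ cgr
  have 1: "isCont (\<lambda>s. convolve f gr s + convolve gs fr s) t"
    using a by (intro continuous_intros isCont_convolve_piecewise[OF f pg] isCont_convolve_piecewise[OF gs pf])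
      (auto simp: fr_def gr_def)
  have eq: "convolve f gr s + convolve gs fr s = convolve f g s" if "2 * a < s" for s
  proof -
    have "integrable lborel (\<lambda>\<tau>. gs (s - (s + (-1) * \<tau>)) * fr (s + (-1) * \<tau>))"
      using a by (intro lborel_integrable_real_affine causal_cut_integrable[OF gs pf]) (auto simp: fr_def)
    then have i: "integrable lborel (\<lambda>\<tau>. fr (s - \<tau>) * gs \<tau>)" by (simp add: mult.commute)
    have j: "integrable lborel (\<lambda>\<tau>. f (s - \<tau>) * gr \<tau>)"
      using a by (intro causal_cut_integrable[OF f pg]) (auto simp: gr_def)
    have "convolve f gr s + convolve gs fr s = convolve f gr s + convolve fr gs s" by (simp add: convolve_commute)
    also have "\<dots> = (LINT \<tau>|lborel. f (s - \<tau>) * gr \<tau> + fr (s - \<tau>) * gs \<tau>)"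
      unfolding convolve_def using i j by simp
    also have "\<dots> = convolve f g s"
      unfolding convolve_def by (rule Bochner_Integration.integral_cong)
        (use that in \<open>auto simp: fr_def gr_def gs_def indicator_def\<close>)
    finally show ?thesis .
  qed
  have "\<forall>\<^sub>F s in nhds t. s \<in> {2 * a<..}"
    using t by (intro eventually_nhds_in_open) (auto simp: a_def)
  then have "\<forall>\<^sub>F s in nhds t. convolve f gr s + convolve gs fr s = convolve f g s"
    by eventually_elim (use eq in auto)
  from isCont_cong[OF this] 1 show ?thesis by simp
qed

section \<open>Measures\<close>

lemma borel_measurable_sets_borel:
  "sets M = sets borel \<Longrightarrow> borel_measurable M = borel_measurable borel"
  by (rule measurable_cong_sets) auto

text \<open>Each point outside the support has a null neighbourhood, and by Lindelof countably many
  of them cover U.\<close>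

lemma emeasure_disjoint_msupp:
  assumes M: "sets M = sets borel" and U: "open U" "U \<inter> msupp M = {}"
  shows "emeasure M U = 0"
proof -
  have "\<exists>V. open V \<and> s \<in> V \<and> emeasure M V = 0" if "s \<in> U" for s
    using that U(2) unfolding msupp_def by (auto simp: zero_less_iff_neq_zero)
  then obtain V where V: "\<And>s. s \<in> U \<Longrightarrow> open (V s) \<and> s \<in> V s \<and> emeasure M (V s) = 0"
    by metis
  obtain F where F: "F \<subseteq> V ` U" "countable F" "\<Union>F = \<Union>(V ` U)"
    using Lindelof[of "V ` U"] V by auto
  have "(\<Union>X\<in>F. X) \<in> null_sets M"
  proof (rule null_sets_UN')
    show "X \<in> null_sets M" if "X \<in> F" for X
      using that F(1) V by (auto simp: null_sets_def M)
  qed fact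
  moreover have "U \<subseteq> \<Union>F" using F(3) V by auto
  ultimately have "U \<in> null_sets M"
    using null_sets_subset[of "\<Union>F" M U] U(1) M by simp
  then show ?thesis by auto
qed

lemma AE_ge_if_msupp_subset:
  assumes M: "sets M = sets borel" and m: "msupp M \<subseteq> {m..}"
  shows "AE s in M. m \<le> s"
proof (rule AE_I')
  show "{..<m} \<in> null_sets M"
    using emeasure_disjoint_msupp[OF M, of "{..<m}"] m by (force simp: null_sets_def M)
qed (auto simp: sets_eq_imp_space_eq[OF M])

lemma msupp_subset_if_AE_ge:
  assumes M: "sets M = sets borel" and m: "AE s in M. m \<le> s"
  shows "msupp M \<subseteq> {m..}"
proof
  fix s assume s: "s \<in> msupp M"
  have "emeasure M {..<m} = emeasure M {}"
  proof (rule emeasure_eq_AE)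
    show "AE s in M. s \<in> {..<m} \<longleftrightarrow> s \<in> {}" using m by eventually_elim auto
  qed (simp_all add: M)
  then have "\<not> s < m"
    using s open_lessThan[of m] unfolding msupp_def by (metis (mono_tags, lifting) lessThan_iff mem_Collect_eq emeasure_empty less_irrefl)
  then show "s \<in> {m..}" by simp
qed

context
  fixes M N :: "real measure"
  assumes M: "sets M = sets borel" and N: "sets N = sets borel"
begin

lemma space_add_measure: "space (add_measure M N) = UNIV"
  using sets_eq_imp_space_eq[OF sets_add_measure] by simp

lemma nn_integral_add_measure:
  assumes f: "f \<in> borel_measurable borel"
  shows "(\<integral>\<^sup>+s. f s \<partial>add_measure M N) = (\<integral>\<^sup>+s. f s \<partial>M) + (\<integral>\<^sup>+s. f s \<partial>N)"
  using f
proof (induction rule: borel_measurable_induct)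
  case (cong f g)
  have "f = g" using cong(3) by auto
  then show ?case using cong(4) by simp
next
  case (set A)
  then show ?case using emeasure_add_measure[OF M N] M N by simp
next
  case (mult u c)
  then show ?case by (simp add: nn_integral_cmult distrib_left borel_measurable_sets_borel[OF M] borel_measurable_sets_borel[OF N] borel_measurable_sets_borel[OF sets_add_measure])
next
  case (add u v)
  then show ?case by (simp add: nn_integral_add borel_measurable_sets_borel[OF M] borel_measurable_sets_borel[OF N] borel_measurable_sets_borel[OF sets_add_measure] algebra_simps)
next
  case (seq U)
  have m: "\<And>i. U i \<in> borel_measurable M" "\<And>i. U i \<in> borel_measurable N" "\<And>i. U i \<in> borel_measurable (add_measure M N)"
    using seq(1) by (simp_all add: borel_measurable_sets_borel[OF M] borel_measurable_sets_borel[OF N] borel_measurable_sets_borel[OF sets_add_measure])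
  have inc: "incseq (\<lambda>i. \<integral>\<^sup>+s. U i s \<partial>M)" "incseq (\<lambda>i. \<integral>\<^sup>+s. U i s \<partial>N)"
    using seq(3) by (auto simp: incseq_def le_fun_def intro!: nn_integral_mono)
  have "(\<integral>\<^sup>+s. (SUP i. U i s) \<partial>add_measure M N) = (SUP i. (\<integral>\<^sup>+s. U i s \<partial>M) + (\<integral>\<^sup>+s. U i s \<partial>N))"
    by (subst nn_integral_monotone_convergence_SUP[OF seq(3) m(3)]) (simp add: seq)
  also have "\<dots> = (SUP i. \<integral>\<^sup>+s. U i s \<partial>M) + (SUP i. \<integral>\<^sup>+s. U i s \<partial>N)"
    by (rule ennreal_SUP_add[OF inc])
  also have "\<dots> = (\<integral>\<^sup>+s. (SUP i. U i s) \<partial>M) + (\<integral>\<^sup>+s. (SUP i. U i s) \<partial>N)"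
    by (simp add: nn_integral_monotone_convergence_SUP[OF seq(3)] m)
  finally show ?case using seq(4) by (simp add: SUP_apply[abs_def])
qed

lemma integrable_add_measure:
  fixes f :: "real \<Rightarrow> real"
  shows "integrable (add_measure M N) f \<longleftrightarrow> integrable M f \<and> integrable N f"
proof (cases "f \<in> borel_measurable borel")
  case True
  have [simp]: "borel_measurable M = borel_measurable borel" "borel_measurable N = borel_measurable borel"
    "borel_measurable (add_measure M N) = borel_measurable borel"
    by (simp_all add: borel_measurable_sets_borel[OF M] borel_measurable_sets_borel[OF N] borel_measurable_sets_borel[OF sets_add_measure])
  show ?thesis using True
    by (simp add: integrable_iff_bounded nn_integral_add_measure)
next
  case False
  then have "\<not> integrable M f" "\<not> integrable (add_measure M N) f"
    by (auto dest!: borel_measurable_integrable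
      simp: borel_measurable_sets_borel[OF M] borel_measurable_sets_borel[OF sets_add_measure])
  then show ?thesis by blast
qed

lemma integral_add_measure:
  fixes f :: "real \<Rightarrow> real"
  assumes "integrable M f" "integrable N f"
  shows "(LINT s|add_measure M N. f s) = (LINT s|M. f s) + (LINT s|N. f s)"
proof -
  have [measurable]: "f \<in> borel_measurable borel"
    using borel_measurable_integrable[OF assms(1)] by (simp add: borel_measurable_sets_borel[OF M])
  have fin: "(\<integral>\<^sup>+s. ennreal (f s) \<partial>M) < \<infinity>" "(\<integral>\<^sup>+s. ennreal (f s) \<partial>N) < \<infinity>"
    "(\<integral>\<^sup>+s. ennreal (- f s) \<partial>M) < \<infinity>" "(\<integral>\<^sup>+s. ennreal (- f s) \<partial>N) < \<infinity>"
    using assms by (auto simp: real_integrable_def less_top)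
  show ?thesis
    using assms integrable_add_measure[of f] fin
    by (simp add: real_lebesgue_integral_def nn_integral_add_measure enn2real_plus)
qed

lemma AE_add_measure:
  assumes [measurable]: "Measurable.pred borel P"
  shows "(AE s in add_measure M N. P s) \<longleftrightarrow> (AE s in M. P s) \<and> (AE s in N. P s)"
proof -
  have *: "{s. \<not> P s} \<in> sets borel" by measurable
  have "emeasure (add_measure M N) {s. \<not> P s} = emeasure M {s. \<not> P s} + emeasure N {s. \<not> P s}"
    by (rule emeasure_add_measure[OF M N *])
  then show ?thesis
    using * M N sets_eq_imp_space_eq[OF M] sets_eq_imp_space_eq[OF N] space_add_measure
    by (simp add: AE_iff_measurable[OF _ refl])
qed

end

text \<open>A common class for \<open>lam1\<close> and for \<open>inv_weighted lam2\<close>. The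
  almost-everywhere lower bound is easier to use under integrals than the support, and the weight
  makes exp(-t s) for t > 0 and 1/(p + s) for large p integrable.\<close>

definition admissible :: "real \<Rightarrow> real measure \<Rightarrow> bool" where
  "admissible m N \<longleftrightarrow> sets N = sets borel \<and> (AE s in N. m \<le> s) \<and>
     integrable N (\<lambda>s. 1 / (1 + \<bar>s\<bar>))"

text \<open>A continuous positive w has a positive minimum on [a, b], so its integral controls the
  mass there.\<close>

lemma finite_emeasure_of_integrable:
  fixes N :: "real measure"
  assumes N: "sets N = sets borel" and w: "integrable N w" "continuous_on UNIV w" "\<And>s. 0 < (w s :: real)"
  shows "emeasure N {a..b} < \<infinity>"
proof (cases "a \<le> b")
  case True
  obtain c where c: "c \<in> {a..b}" "\<And>s. s \<in> {a..b} \<Longrightarrow> w c \<le> w s"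
    using continuous_attains_inf[OF compact_Icc _ continuous_on_subset[OF w(2) subset_UNIV], of a b] True by auto
  have "integrable N (indicator {a..b} :: real \<Rightarrow> real)"
  proof (rule Bochner_Integration.integrable_bound)
    show "integrable N (\<lambda>s. w s / w c)" using w by simp
    show "AE s in N. norm (indicator {a..b} s :: real) \<le> norm (w s / w c)"
      using c(2) w(3) less_imp_le[OF w(3)] by (intro AE_I2) (auto simp: indicator_def)
  qed (simp add: borel_measurable_sets_borel[OF N])
  then show ?thesis by (simp add: integrable_indicator_iff sets_eq_imp_space_eq[OF N])
qed simp

lemma sigma_finite_of_finite_intervals:
  assumes N: "sets N = sets borel" and fin: "\<And>a b::real. emeasure N {a..b} < \<infinity>"
  shows "sigma_finite_measure N"
proof
  have "(\<Union>n::nat. {- real n..real n}) = UNIV"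
  proof (intro set_eqI iffI UNIV_I)
    fix s :: real
    obtain n :: nat where "\<bar>s\<bar> \<le> n" using real_arch_simple by blast
    then have "- real n \<le> s" "s \<le> real n" by linarith+
    then show "s \<in> (\<Union>n::nat. {- real n..real n})" by auto
  qed
  then show "\<exists>A. countable A \<and> A \<subseteq> sets N \<and> \<Union> A = space N \<and> (\<forall>a\<in>A. emeasure N a \<noteq> \<infinity>)"
    using fin by (intro exI[of _ "range (\<lambda>n::nat. {- real n..real n})"])
      (auto simp: N sets_eq_imp_space_eq[OF N] less_top)
qed

lemma admissible_finite_interval:
  assumes "admissible m N"
  shows "emeasure N {a..b} < \<infinity>"
proof (rule finite_emeasure_of_integrable[where w = "\<lambda>s. 1 / (1 + \<bar>s\<bar>)"])
  have "1 + \<bar>s\<bar> \<noteq> 0" for s :: real by linarith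
  then show "continuous_on UNIV (\<lambda>s::real. 1 / (1 + \<bar>s\<bar>))" by (intro continuous_intros) auto
  show "0 < 1 / (1 + \<bar>s\<bar>)" for s :: real by simp
qed (use assms in \<open>auto simp: admissible_def\<close>)

lemma admissible_sigma_finite: "admissible m N \<Longrightarrow> sigma_finite_measure N"
  using sigma_finite_of_finite_intervals admissible_finite_interval unfolding admissible_def by blast

lemma admissible_mono:
  assumes "admissible m N" "m' \<le> m"
  shows "admissible m' N"
proof -
  have "AE s in N. m \<le> s" using assms(1) by (simp add: admissible_def)
  then have "AE s in N. m' \<le> s" by eventually_elim (use assms(2) in auto)
  then show ?thesis using assms(1) by (simp add: admissible_def)
qed

lemma M_exp_integrable:
  assumes "M \<in> M_exp n"
  shows "integrable M (\<lambda>s. (1 + s\<^sup>2) powr (- real n / 2))"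
proof -
  have M: "sets M = sets borel" "(\<integral>\<^sup>+ s. ennreal ((1 + s\<^sup>2) powr (- real n / 2)) \<partial>M) < \<infinity>"
    using assms by (auto simp: M_exp_def)
  show ?thesis
    by (rule integrableI_nonneg) (use M in \<open>auto simp: borel_measurable_sets_borel[OF M(1)]\<close>)
qed

lemma M_exp_bounded_below:
  assumes "M \<in> M_exp n"
  obtains m where "AE s in M. m \<le> s"
proof -
  obtain m where "\<And>s. s \<in> msupp M \<Longrightarrow> m \<le> s" using assms unfolding M_exp_def bdd_below_def by auto
  then show thesis
    using that AE_ge_if_msupp_subset[of M m] assms unfolding M_exp_def by auto
qed

lemma M_exp_2_integrable: "M \<in> M_exp 2 \<Longrightarrow> integrable M (\<lambda>s. 1 / (1 + s\<^sup>2))"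
  using M_exp_integrable[of M 2]
  by (simp add: powr_minus_divide add_nonneg_nonneg)

lemma admissible_M_exp_1:
  assumes M: "M \<in> M_exp 1"
  obtains m where "admissible m M"
proof -
  obtain m where m: "AE s in M. m \<le> s" using M_exp_bounded_below[OF M] .
  have s: "sets M = sets borel" using M unfolding M_exp_def by auto
  have "integrable M (\<lambda>s. 1 / (1 + \<bar>s\<bar>))"
  proof (rule Bochner_Integration.integrable_bound[OF M_exp_integrable[OF M]])
    show "AE s in M. norm (1 / (1 + \<bar>s\<bar>)) \<le> norm ((1 + s\<^sup>2) powr (- real 1 / 2))"
    proof (rule AE_I2)
      fix s :: real
      have "sqrt (1 + s\<^sup>2) \<le> 1 + \<bar>s\<bar>"
        by (rule real_le_lsqrt) (auto simp: power2_eq_square algebra_simps)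
      moreover have "0 < sqrt (1 + s\<^sup>2)" by (simp add: add_pos_nonneg)
      ultimately have "1 / (1 + \<bar>s\<bar>) \<le> 1 / sqrt (1 + s\<^sup>2)"
        by (intro divide_left_mono) auto
      also have "\<dots> = (1 + s\<^sup>2) powr (- real 1 / 2)"
        by (simp add: powr_minus_divide powr_half_sqrt add_nonneg_nonneg)
      finally show "norm (1 / (1 + \<bar>s\<bar>)) \<le> norm ((1 + s\<^sup>2) powr (- real 1 / 2))" by simp
    qed
  qed (simp add: borel_measurable_sets_borel[OF s])
  then show thesis using that m s unfolding admissible_def by auto
qed

text \<open>The weight is infinite at 0 while the weighted measure is finite near 0, so M has no
  atom there. Afterwards quotients by s may be simplified almost everywhere.\<close>

lemma M_frac_AE_pos:
  assumes M: "M \<in> M_frac"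
  shows "AE s in M. 0 < s"
proof -
  have s: "sets M = sets borel" using M unfolding M_frac_def M_exp_def by auto
  have 0: "AE s in M. 0 \<le> s"
    using M by (intro AE_ge_if_msupp_subset[OF s]) (auto simp: M_frac_def)
  obtain U where U: "open U" "0 \<in> U" "emeasure (inv_weighted M) U < \<infinity>"
    using M unfolding M_frac_def locally_finite_def by auto
  have *: "(\<integral>\<^sup>+ s. inverse (ennreal s) * indicator U s \<partial>M) < \<infinity>"
    using U unfolding inv_weighted_def
    by (subst (asm) emeasure_density) (auto simp: s borel_measurable_sets_borel[OF s])
  have "AE s in M. inverse (ennreal s) * indicator U s \<noteq> \<infinity>"
    using * U(1) by (intro nn_integral_PInf_AE) (auto simp: borel_measurable_sets_borel[OF s])
  with 0 show ?thesis
  proof eventually_elim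
    fix s :: real assume "0 \<le> s" "inverse (ennreal s) * indicator U s \<noteq> \<infinity>"
    then show "0 < s" using U(2) by (cases "s = 0") auto
  qed
qed

lemma inv_weighted_eq:
  assumes M: "M \<in> M_frac"
  shows "inv_weighted M = density M (\<lambda>s. ennreal (inverse s))"
proof -
  have s: "sets M = sets borel" using M unfolding M_frac_def M_exp_def by auto
  show ?thesis unfolding inv_weighted_def
  proof (rule density_cong)
    show "AE s in M. inverse (ennreal s) = ennreal (inverse s)"
      using M_frac_AE_pos[OF M] by eventually_elim (simp add: inverse_ennreal)
  qed (auto simp: borel_measurable_sets_borel[OF s])
qed

lemma integral_inv_weighted:
  fixes f :: "real \<Rightarrow> real"
  assumes M: "M \<in> M_frac" and f: "f \<in> borel_measurable borel"
  shows "integrable (inv_weighted M) f \<longleftrightarrow> integrable M (\<lambda>s. f s / s)"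
    "(LINT s|inv_weighted M. f s) = (LINT s|M. f s / s)"
proof -
  have s: "sets M = sets borel" using M unfolding M_frac_def M_exp_def by auto
  have m: "f \<in> borel_measurable M" "inverse \<in> borel_measurable M"
    using f by (auto simp: borel_measurable_sets_borel[OF s])
  have 0: "AE s in M. 0 \<le> inverse s" using M_frac_AE_pos[OF M] by eventually_elim simp
  show "integrable (inv_weighted M) f \<longleftrightarrow> integrable M (\<lambda>s. f s / s)"
    unfolding inv_weighted_eq[OF M] integrable_density[OF m 0] by (simp add: divide_inverse mult.commute)
  show "(LINT s|inv_weighted M. f s) = (LINT s|M. f s / s)"
    unfolding inv_weighted_eq[OF M] integral_density[OF m 0] by (simp add: divide_inverse mult.commute)
qed

text \<open>Near 0 the weighted measure is finite; away from 0 the weight 1/s turns the order two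
  condition on M into integrability of s/(1 + s^2).\<close>

lemma admissible_inv_weighted:
  assumes M: "M \<in> M_frac"
  shows "admissible 0 (inv_weighted M)"
proof -
  have s: "sets M = sets borel" using M unfolding M_frac_def M_exp_def by auto
  let ?N = "inv_weighted M"
  have sN: "sets ?N = sets borel" by (simp add: inv_weighted_def s)
  have pos: "AE s in ?N. 0 < s"
    unfolding inv_weighted_def
    by (subst AE_density) (use M_frac_AE_pos[OF M] in \<open>auto simp: borel_measurable_sets_borel[OF s]\<close>)
  obtain U where U: "open U" "0 \<in> U" "emeasure ?N U < \<infinity>"
    using M unfolding M_frac_def locally_finite_def by auto
  obtain d where d: "0 < d" "ball 0 d \<subseteq> U" using openE[OF U(1,2)] by auto
  have "emeasure ?N (ball 0 d) \<le> emeasure ?N U" using d U sN by (intro emeasure_mono) auto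
  then have "emeasure ?N (ball 0 d) < \<infinity>" using U(3) by order
  then have 1: "integrable ?N (indicator (ball 0 d) :: real \<Rightarrow> real)"
    by (simp add: integrable_indicator_iff sN sets_eq_imp_space_eq[OF sN])
  have 2: "integrable ?N (\<lambda>s. s / (1 + s\<^sup>2))"
  proof (subst integral_inv_weighted(1)[OF M])
    show "integrable M (\<lambda>s. s / (1 + s\<^sup>2) / s)"
      using M_exp_2_integrable[of M] M
    proof (subst integrable_cong_AE[where g = "\<lambda>s. 1 / (1 + s\<^sup>2)"])
      show "AE s in M. s / (1 + s\<^sup>2) / s = 1 / (1 + s\<^sup>2)"
        using M_frac_AE_pos[OF M] by eventually_elim simp
    qed (auto simp: M_frac_def borel_measurable_sets_borel[OF s])
  qed auto
  have "integrable ?N (\<lambda>s. 1 / (1 + \<bar>s\<bar>))"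
  proof (rule Bochner_Integration.integrable_bound)
    \<comment> \<open>The indicator handles s < d. For s >= d the bound comes from (1 + s)/(1 + s^2)
      = (1 + 1/s) s/(1 + s^2) and 1/s <= 1/d.\<close>
    show "integrable ?N (\<lambda>s. indicator (ball 0 d) s + (1 + 1 / d) * (s / (1 + s\<^sup>2)))"
      by (intro Bochner_Integration.integrable_add integrable_mult_right 1 2)
    show "AE s in ?N. norm (1 / (1 + \<bar>s\<bar>)) \<le> norm (indicator (ball 0 d) s + (1 + 1 / d) * (s / (1 + s\<^sup>2)))"
      using pos
    proof eventually_elim
      fix s :: real assume s: "0 < s"
      have "1 / (1 + s) \<le> indicator (ball 0 d) s + (1 + 1 / d) * (s / (1 + s\<^sup>2))"
      proof (cases "s < d")
        case True
        have "1 / (1 + s) \<le> 1" using s by simp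
        moreover have "0 \<le> (1 + 1 / d) * (s / (1 + s\<^sup>2))" using s d by simp
        ultimately have "1 / (1 + s) \<le> 1 + (1 + 1 / d) * (s / (1 + s\<^sup>2))" by linarith
        moreover have "indicator (ball 0 d) s = (1::real)" using True s by simp
        ultimately show ?thesis by simp
      next
        case False
        have "1 + s\<^sup>2 \<le> (1 + s) * (1 + s)" using s by (simp add: power2_eq_square algebra_simps)
        then have "1 / (1 + s) \<le> (1 + s) / (1 + s\<^sup>2)"
          using s by (simp add: divide_simps add_pos_nonneg)
        also have "\<dots> = (1 + 1 / s) * (s / (1 + s\<^sup>2))"
        proof -
          have "1 + s = (1 + 1 / s) * s" using s by (simp add: field_simps)
          then show ?thesis by (metis times_divide_eq_right)
        qed
        also have "\<dots> \<le> (1 + 1 / d) * (s / (1 + s\<^sup>2))"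
          using False d s by (intro mult_right_mono add_left_mono divide_left_mono) auto
        also have "\<dots> \<le> indicator (ball 0 d) s + (1 + 1 / d) * (s / (1 + s\<^sup>2))" by simp
        finally show ?thesis .
      qed
      then show "norm (1 / (1 + \<bar>s\<bar>)) \<le> norm (indicator (ball 0 d) s + (1 + 1 / d) * (s / (1 + s\<^sup>2)))"
        using s by simp
    qed
  qed (simp add: borel_measurable_sets_borel[OF sN])
  moreover have "AE s in ?N. 0 \<le> s" using pos by eventually_elim simp
  ultimately show ?thesis unfolding admissible_def using sN by simp
qed

section \<open>Laplace transforms of measures\<close>

lemma continuous_on_laplace:
  assumes N: "sets N = sets borel" and m: "AE s in N. m \<le> s"
    and int: "integrable N (\<lambda>s. exp (- (a * s)))"
  shows "continuous_on {a..} (laplace N)"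
proof (rule continuous_on_sequentiallyI)
  have [simp]: "borel_measurable N = borel_measurable borel" by (rule borel_measurable_sets_borel[OF N])
  fix u t assume u: "\<forall>n. u n \<in> {a..}" "t \<in> {a..}" "u \<longlonglongrightarrow> t"
  have "Bseq u" using u by (intro convergent_imp_Bseq convergentI)
  then obtain T where T: "\<And>n. \<bar>u n\<bar> \<le> T" unfolding Bseq_def by auto
  show "(\<lambda>n. laplace N (u n)) \<longlonglongrightarrow> laplace N t"
    unfolding laplace_def
  proof (rule integral_dominated_convergence)
    \<comment> \<open>Where s is negative, the exponent -(u n - a) s is at most (T + |a|) |m|;
      elsewhere it is at most 0.\<close>
    show "integrable N (\<lambda>s. exp ((T + \<bar>a\<bar>) * \<bar>m\<bar>) * exp (- (a * s)))" using int by simp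
    show "AE s in N. norm (exp (- (u n * s))) \<le> exp ((T + \<bar>a\<bar>) * \<bar>m\<bar>) * exp (- (a * s))" for n
      using m
    proof eventually_elim
      fix s assume s: "m \<le> s"
      have "- (u n * s) = - ((u n - a) * s) - a * s" by (simp add: algebra_simps)
      also have "- ((u n - a) * s) \<le> (u n - a) * (- m)"
        using s u(1) by (simp add: mult_left_mono)
      also have "(u n - a) * (- m) \<le> (u n - a) * \<bar>m\<bar>"
        using u(1) by (intro mult_left_mono) auto
      also have "(u n - a) * \<bar>m\<bar> \<le> (T + \<bar>a\<bar>) * \<bar>m\<bar>"
        using T[of n] by (intro mult_right_mono) auto
      finally have "- (u n * s) \<le> (T + \<bar>a\<bar>) * \<bar>m\<bar> - a * s" by simp
      then have "exp (- (u n * s)) \<le> exp ((T + \<bar>a\<bar>) * \<bar>m\<bar> - a * s)" by simp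
      then show "norm (exp (- (u n * s))) \<le> exp ((T + \<bar>a\<bar>) * \<bar>m\<bar>) * exp (- (a * s))"
        by (simp add: exp_diff exp_minus divide_inverse)
    qed
    show "AE s in N. (\<lambda>n. exp (- (u n * s))) \<longlonglongrightarrow> exp (- (t * s))"
      by (intro AE_I2 tendsto_intros u)
  qed auto
qed

lemma admissible_integrable_exp:
  assumes N: "admissible m N" and t: "0 < t"
  shows "integrable N (\<lambda>s. exp (- (t * s)))"
proof -
  have sN: "sets N = sets borel" and m: "AE s in N. m \<le> s" and i: "integrable N (\<lambda>s. 1 / (1 + \<bar>s\<bar>))"
    using N unfolding admissible_def by auto
  \<comment> \<open>The first summand serves s >= 0, through exp(t s) >= 1 + t s >=
    \<open>min 1 t * (1 + s)\<close>; the second serves m <= s < 0.\<close>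
  define C where "C = 1 / min 1 t + exp (t * \<bar>m\<bar>) * (1 + \<bar>m\<bar>)"
  show ?thesis
  proof (rule Bochner_Integration.integrable_bound)
    show "integrable N (\<lambda>s. C * (1 / (1 + \<bar>s\<bar>)))" using i by (rule integrable_mult_right)
    show "AE s in N. norm (exp (- (t * s))) \<le> norm (C * (1 / (1 + \<bar>s\<bar>)))"
      using m
    proof eventually_elim
      fix s assume s: "m \<le> s"
      have "exp (- (t * s)) * (1 + \<bar>s\<bar>) \<le> C"
      proof (cases "0 \<le> s")
        case True
        have "min 1 t * (1 + s) = min 1 t + min 1 t * s" by (simp add: algebra_simps)
        also have "\<dots> \<le> 1 + t * s" using True t by (intro add_mono mult_right_mono) auto
        also have "\<dots> \<le> exp (t * s)" by (rule exp_ge_add_one_self)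
        finally have "exp (- (t * s)) * (1 + \<bar>s\<bar>) \<le> 1 / min 1 t"
          using True t by (simp add: exp_minus field_simps)
        also have "\<dots> \<le> C" unfolding C_def by simp
        finally show ?thesis .
      next
        case False
        then have "t * (- s) \<le> t * \<bar>m\<bar>" using s t by (intro mult_left_mono) auto
        then have "- (t * s) \<le> t * \<bar>m\<bar>" by simp
        then have "exp (- (t * s)) * (1 + \<bar>s\<bar>) \<le> exp (t * \<bar>m\<bar>) * (1 + \<bar>m\<bar>)"
          using False s by (intro mult_mono) auto
        also have "\<dots> \<le> C" using t unfolding C_def by simp
        finally show ?thesis .
      qed
      then have "exp (- (t * s)) \<le> C / (1 + \<bar>s\<bar>)" by (subst pos_le_divide_eq) auto
      then have "exp (- (t * s)) \<le> C * (1 / (1 + \<bar>s\<bar>))" by simp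
      then show "norm (exp (- (t * s))) \<le> norm (C * (1 / (1 + \<bar>s\<bar>)))"
        by (metis abs_exp_cancel abs_ge_self order_trans real_norm_def)
    qed
  qed (simp add: borel_measurable_sets_borel[OF sN])
qed

lemma continuous_on_laplace_admissible:
  assumes N: "admissible m N"
  shows "continuous_on {0<..} (laplace N)"
proof -
  have "isCont (laplace N) t" if "0 < t" for t
  proof -
    have "continuous_on {t/2..} (laplace N)"
      using N that by (intro continuous_on_laplace[where m = m] admissible_integrable_exp[OF N])
        (auto simp: admissible_def)
    then show ?thesis
      using that by (intro continuous_on_interior[of "{t/2..}"]) auto
  qed
  then show ?thesis by (auto intro: continuous_at_imp_continuous_on)
qed

text \<open>The bound on p keeps p + s at least 1 for almost every s; the same threshold recurs
  wherever an admissible measure meets a Laplace variable.\<close>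

lemma admissible_integrable_resolvent:
  assumes N: "admissible m N" and p: "\<bar>m\<bar> + 1 \<le> p"
  shows "integrable N (\<lambda>s. 1 / (p + s))"
proof -
  have sN: "sets N = sets borel" and m: "AE s in N. m \<le> s" and i: "integrable N (\<lambda>s. 1 / (1 + \<bar>s\<bar>))"
    using N unfolding admissible_def by auto
  show ?thesis
  proof (rule Bochner_Integration.integrable_bound)
    show "integrable N (\<lambda>s. (1 + \<bar>m\<bar>) * (1 / (1 + \<bar>s\<bar>)))" using i by (rule integrable_mult_right)
    show "AE s in N. norm (1 / (p + s)) \<le> norm ((1 + \<bar>m\<bar>) * (1 / (1 + \<bar>s\<bar>)))"
      using m
    proof eventually_elim
      fix s assume s: "m \<le> s"
      have ps: "1 \<le> p + s" using p s by linarith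
      have "1 + \<bar>s\<bar> \<le> (1 + \<bar>m\<bar>) * (p + s)"
      proof (cases "0 \<le> s")
        case True
        then have "1 + \<bar>s\<bar> \<le> 1 * (p + s)" using p by simp
        also have "\<dots> \<le> (1 + \<bar>m\<bar>) * (p + s)" using ps by (intro mult_right_mono) auto
        finally show ?thesis .
      next
        case False
        then have "1 + \<bar>s\<bar> \<le> (1 + \<bar>m\<bar>) * 1" using s by simp
        also have "\<dots> \<le> (1 + \<bar>m\<bar>) * (p + s)" using ps by (intro mult_left_mono) auto
        finally show ?thesis .
      qed
      then have "1 / (p + s) \<le> (1 + \<bar>m\<bar>) / (1 + \<bar>s\<bar>)"
        using ps by (subst frac_le_eq) (auto simp: divide_nonpos_pos mult.commute)
      then show "norm (1 / (p + s)) \<le> norm ((1 + \<bar>m\<bar>) * (1 / (1 + \<bar>s\<bar>)))"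
        using ps by simp
    qed
  qed (simp add: borel_measurable_sets_borel[OF sN])
qed

text \<open>Fubini for exp(-(p + s) t) on N times the half-line. Integrating over t first gives 1/(p
  + s), whose integrability over N supplies absolute convergence.\<close>

lemma
  assumes N: "admissible m N" and p: "\<bar>m\<bar> + 1 \<le> p"
  shows causal_laplace: "causal p (\<lambda>t. one_fn t * laplace N t)"
    and lap_laplace: "lap (\<lambda>t. one_fn t * laplace N t) p = (LINT s|N. 1 / (p + s))"
proof -
  interpret N: sigma_finite_measure N by (rule admissible_sigma_finite[OF N])
  interpret pair_sigma_finite N lborel ..
  have sN [measurable_cong]: "sets N = sets borel" and m: "AE s in N. m \<le> s"
    using N unfolding admissible_def by auto
  define f where "f = (\<lambda>s t::real. exp (- ((p + s) * t)) * one_fn t)"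
  have f_split: "f s t = (exp (- (p * t)) * one_fn t) * exp (- (t * s))" for s t
    unfolding f_def by (simp add: exp_add[symmetric] algebra_simps)
  have ae: "AE s in N. integrable lborel (f s) \<and> (LINT t|lborel. f s t) = 1 / (p + s)"
    using m
  proof eventually_elim
    fix s assume "m \<le> s"
    then have "0 < p + s" using p by linarith
    then show "integrable lborel (f s) \<and> (LINT t|lborel. f s t) = 1 / (p + s)"
      unfolding f_def using lap_integral_exp by simp
  qed
  have int: "integrable (N \<Otimes>\<^sub>M lborel) (case_prod f)"
  proof (rule Fubini_integrable)
    show "case_prod f \<in> borel_measurable (N \<Otimes>\<^sub>M lborel)" unfolding f_def by measurable
    have "integrable N (\<lambda>s. LINT t|lborel. f s t)"
    proof (subst integrable_cong_AE[where g = "\<lambda>s. 1 / (p + s)"])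
      show "(\<lambda>s. LINT t|lborel. f s t) \<in> borel_measurable N" unfolding f_def by measurable
      show "AE s in N. (LINT t|lborel. f s t) = 1 / (p + s)" using ae by eventually_elim simp
      show "integrable N (\<lambda>s. 1 / (p + s))" by (rule admissible_integrable_resolvent[OF N p])
    qed measurable
    then show "integrable N (\<lambda>s. LINT t|lborel. norm (case (s, t) of (s, t) \<Rightarrow> f s t))"
      by (simp add: f_def abs_mult)
    show "AE s in N. integrable lborel (\<lambda>t. case (s, t) of (s, t) \<Rightarrow> f s t)"
      using ae by eventually_elim simp
  qed
  have eq: "exp (- (p * t)) * (one_fn t * laplace N t) = (LINT s|N. f s t)" for t
    unfolding f_split laplace_def by simp
  have "laplace N \<in> borel_measurable borel"
    unfolding laplace_def[abs_def] by measurable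
  then show "causal p (\<lambda>t. one_fn t * laplace N t)"
    unfolding causal_def eq using integrable_snd[OF int] by (auto simp: eq)
  have "lap (\<lambda>t. one_fn t * laplace N t) p = (LINT t|lborel. LINT s|N. f s t)"
    unfolding lap_def eq ..
  also have "\<dots> = (LINT s|N. LINT t|lborel. f s t)" by (rule Fubini_integral[OF int])
  also have "\<dots> = (LINT s|N. 1 / (p + s))"
    using ae by (intro integral_cong_AE) (auto simp: f_def)
  finally show "lap (\<lambda>t. one_fn t * laplace N t) p = (LINT s|N. 1 / (p + s))" .
qed

section \<open>Nevanlinna functions\<close>

text \<open>A factor of the \<open>B_reg\<close> identity with i/pi divided out. For c >= 0 and in
  this sign convention it maps the upper half-plane into the closed lower one, so it is minus a
  Nevanlinna function in the usual sense.\<close>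

definition nevanlinna :: "real measure \<Rightarrow> real \<Rightarrow> real \<Rightarrow> complex \<Rightarrow> complex" where
  "nevanlinna M a c z =
     (LINT s|M. 1 / (z - of_real s) + of_real s / (1 + (of_real s)\<^sup>2)) - of_real a - of_real c * z"

lemma Q_reg_nevanlinna:
  "Q_reg M z - \<i> / of_real pi * (of_real a + of_real c * z) = \<i> / of_real pi * nevanlinna M a c z"
  unfolding Q_reg_def nevanlinna_def integral_mult_right_zero by (simp add: right_diff_distrib distrib_left)

lemma is_B_reg_nevanlinna:
  assumes "is_B_reg M a0 c1 N b0 z1" "0 < Im z"
  shows "nevanlinna M a0 c1 z * nevanlinna N b0 z1 z = - of_real (pi\<^sup>2)"
proof -
  have "\<i> / of_real pi * nevanlinna M a0 c1 z * (\<i> / of_real pi * nevanlinna N b0 z1 z) = 1"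
    using assms unfolding is_B_reg_def Q_reg_nevanlinna by blast
  then have "nevanlinna M a0 c1 z * nevanlinna N b0 z1 z * (\<i> * \<i>) = of_real pi * of_real pi"
    by (simp add: field_simps)
  then have "- (nevanlinna M a0 c1 z * nevanlinna N b0 z1 z) = of_real (pi\<^sup>2)"
    by (simp add: power2_eq_square)
  then show ?thesis by (metis add.inverse_inverse)
qed

text \<open>Mass O(e^2) on intervals of radius e makes the distribution function differentiable with
  derivative 0, so it is constant below P. The bound is asked at every point, and not just almost
  everywhere, in order to exclude singular continuous parts; its constants may depend on the
  point.\<close>

lemma null_of_local_quadratic_bound:
  fixes N :: "real measure"
  assumes N: "sets N = sets borel" and fin: "\<And>a b::real. emeasure N {a..b} < \<infinity>"
    and bound: "\<And>x. x < P \<Longrightarrow> \<exists>C. \<exists>d>0. \<forall>e. 0 < e \<and> e < d \<longrightarrow> measure N {x - e..x + e} \<le> C * e\<^sup>2"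
  shows "AE s in N. P \<le> s"
proof -
  have null: "{x<..y} \<in> null_sets N" if xy: "x < y" "y < P" for x y
  proof -
    \<comment> \<open>The distribution function is counted from a point left of x, so that x and y
      both lie in the open interval on which it is constant.\<close>
    define a where "a = x - 1"
    define F where "F = (\<lambda>u. measure N {a..u})"
    have deriv: "(F has_field_derivative 0) (at u)" if u: "a < u" "u < P" for u
    proof -
      obtain C d where C: "0 < d" "\<And>e. 0 < e \<Longrightarrow> e < d \<Longrightarrow> measure N {u - e..u + e} \<le> C * e\<^sup>2"
        using bound[OF u(2)] by blast
      have diff: "\<bar>F (u + h) - F u\<bar> \<le> measure N {u - \<bar>h\<bar>..u + \<bar>h\<bar>}" if "u + h \<ge> a" for h
      proof -
        have 1: "F v - F w \<le> measure N {w..v}" if "a \<le> w" "w \<le> v" for v w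
        proof -
          have "measure N {a..v} = measure N ({a..w} \<union> {w..v})"
            using that by (simp add: ivl_disj_un)
          also have "\<dots> \<le> measure N {a..w} + measure N {w..v}"
            by (rule measure_Un_le) (auto simp: N)
          finally show ?thesis unfolding F_def by simp
        qed
        have 2: "F w \<le> F v" if "w \<le> v" for v w
          unfolding F_def using that fin[of a v]
          by (intro measure_mono_fmeasurable) (auto simp: N fmeasurable_def)
        have 3: "measure N A \<le> measure N {u - \<bar>h\<bar>..u + \<bar>h\<bar>}" if "A \<subseteq> {u - \<bar>h\<bar>..u + \<bar>h\<bar>}" "A \<in> sets borel" for A
          using that fin[of "u - \<bar>h\<bar>" "u + \<bar>h\<bar>"]
          by (intro measure_mono_fmeasurable) (auto simp: N fmeasurable_def)
        show ?thesis
        proof (cases "0 \<le> h")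
          case True
          then show ?thesis using 1[of u "u + h"] 2[of u "u + h"] 3[of "{u..u+h}"] u by auto
        next
          case False
          then show ?thesis using 1[of "u + h" u] 2[of "u + h" u] 3[of "{u+h..u}"] that by auto
        qed
      qed
      have "((\<lambda>h. (F (u + h) - F u) / h) \<longlongrightarrow> 0) (at 0)"
      proof (rule Lim_null_comparison)
        have "\<forall>\<^sub>F h in at 0. h \<in> {-d<..<d} \<inter> {a - u<..}"
          using C(1) u by (intro eventually_at_in_open') (auto intro: open_Int)
        moreover have "\<forall>\<^sub>F h in at 0. h \<noteq> (0::real)" by (simp add: eventually_at_filter)
        ultimately show "\<forall>\<^sub>F h in at 0. norm ((F (u + h) - F u) / h) \<le> C * \<bar>h\<bar>"
        proof eventually_elim
          fix h assume h: "h \<in> {-d<..<d} \<inter> {a - u<..}" "h \<noteq> 0"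
          have "\<bar>F (u + h) - F u\<bar> \<le> measure N {u - \<bar>h\<bar>..u + \<bar>h\<bar>}" using h by (intro diff) auto
          also have "\<dots> \<le> C * \<bar>h\<bar>\<^sup>2" using h by (intro C(2)) auto
          finally show "norm ((F (u + h) - F u) / h) \<le> C * \<bar>h\<bar>"
            using h by (simp add: field_simps power2_eq_square)
        qed
        show "((\<lambda>h. C * \<bar>h\<bar>) \<longlongrightarrow> 0) (at 0)"
          by (rule tendsto_eq_intros refl)+ simp
      qed
      then show ?thesis unfolding DERIV_def by simp
    qed
    have "\<exists>c. \<forall>u\<in>{a<..<P}. F u = c"
      by (rule has_field_derivative_zero_constant) (auto intro: has_field_derivative_at_within deriv)
    then obtain c where c: "\<And>u. u \<in> {a<..<P} \<Longrightarrow> F u = c" by blast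
    have "measure N {x<..y} = measure N ({a..y} - {a..x})"
      using xy by (intro arg_cong[where f = "measure N"]) (auto simp: a_def)
    also have "\<dots> = F y - F x"
      unfolding F_def using fin[of a y] xy
      by (intro measurable_measure_Diff) (auto simp: N fmeasurable_def)
    also have "\<dots> = 0" using c[of x] c[of y] xy by (simp add: a_def)
    finally have "measure N {x<..y} = 0" .
    moreover have "emeasure N {x<..y} \<le> emeasure N {x..y}" by (rule emeasure_mono) (auto simp: N)
    then have "emeasure N {x<..y} \<noteq> \<infinity>" using fin[of x y] by (auto simp: top_unique)
    ultimately have "emeasure N {x<..y} = 0" by (simp add: emeasure_eq_ennreal_measure)
    then show ?thesis by (simp add: null_sets_def N)
  qed
  \<comment> \<open>An exhaustion of the open half-line by half-open intervals whose right ends stay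
    below P.\<close>
  have "{..<P} \<subseteq> (\<Union>n::nat. {P - real (Suc n) - 1<..P - 1 / real (Suc n)})"
  proof
    fix s assume "s \<in> {..<P}"
    then have s: "0 < P - s" by simp
    obtain n1 :: nat where n1: "1 / (P - s) \<le> n1" using real_arch_simple by blast
    obtain n2 :: nat where n2: "P - s \<le> n2" using real_arch_simple by blast
    define n where "n = max n1 n2"
    have "1 / (P - s) \<le> real (Suc n)" using n1 unfolding n_def by (simp add: max_def)
    then have "1 / real (Suc n) \<le> P - s" using s by (simp add: field_simps)
    moreover have "P - s \<le> real (Suc n)" using n2 unfolding n_def by (simp add: max_def)
    ultimately have "P - real (Suc n) - 1 < s \<and> s \<le> P - 1 / real (Suc n)" by linarith
    then show "s \<in> (\<Union>n::nat. {P - real (Suc n) - 1<..P - 1 / real (Suc n)})"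
      unfolding UN_iff greaterThanAtMost_iff by blast
  qed
  moreover have "(\<Union>n::nat. {P - real (Suc n) - 1<..P - 1 / real (Suc n)}) \<in> null_sets N"
  proof (rule null_sets_UN)
    fix n :: nat
    have "0 < 1 / real (Suc n)" "1 / real (Suc n) \<le> 1" "0 < real (Suc n)" by simp_all
    then show "{P - real (Suc n) - 1<..P - 1 / real (Suc n)} \<in> null_sets N"
      by (intro null) linarith+
  qed
  ultimately have "{..<P} \<in> null_sets N"
    by (rule null_sets_subset[rotated 2]) (simp add: N)
  then show ?thesis
    by (rule AE_I') auto
qed

context
  fixes M :: "real measure"
  assumes M: "sets M = sets borel" and int: "integrable M (\<lambda>s. 1 / (1 + s\<^sup>2))"
begin

lemma integrable_nevanlinna_kernel:
  assumes d: "0 < d" "AE s in M. d \<le> cmod (z - of_real s)"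
  shows "integrable M (\<lambda>s. 1 / (z - of_real s) + of_real s / (1 + (of_real s)\<^sup>2))"
proof (rule Bochner_Integration.integrable_bound)
  show "integrable M (\<lambda>s. (cmod (1 + z\<^sup>2) / d + cmod z) * (1 / (1 + s\<^sup>2)))"
    using int by (rule integrable_mult_right)
  show "AE s in M. norm (1 / (z - of_real s) + of_real s / (1 + (of_real s)\<^sup>2))
      \<le> norm ((cmod (1 + z\<^sup>2) / d + cmod z) * (1 / (1 + s\<^sup>2)))"
    using d(2)
  proof eventually_elim
    fix s :: real assume s: "d \<le> cmod (z - of_real s)"
    have nz: "z - of_real s \<noteq> 0" using s d by auto
    have "1 + (complex_of_real s)\<^sup>2 = of_real (1 + s\<^sup>2)" by simp
    moreover have "1 + s\<^sup>2 \<noteq> 0" by (metis power_one sum_power2_eq_zero_iff zero_neq_one)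
    ultimately have nz2: "1 + (complex_of_real s)\<^sup>2 \<noteq> 0" by (metis of_real_eq_0_iff)
    have n2: "cmod (1 + (complex_of_real s)\<^sup>2) = 1 + s\<^sup>2"
      unfolding \<open>1 + (complex_of_real s)\<^sup>2 = of_real (1 + s\<^sup>2)\<close> norm_of_real by simp
    \<comment> \<open>With 1/(1 + s^2) extracted, the remaining factor is bounded uniformly because
      z keeps distance d from almost every s.\<close>
    have "1 / (z - of_real s) + of_real s / (1 + (of_real s)\<^sup>2)
      = ((1 + z\<^sup>2) / (z - of_real s) - z) / (1 + (of_real s)\<^sup>2)"
      using nz nz2 by (simp add: divide_simps) (simp add: algebra_simps power2_eq_square)
    then have "norm (1 / (z - of_real s) + of_real s / (1 + (of_real s)\<^sup>2))
      = cmod ((1 + z\<^sup>2) / (z - of_real s) - z) / (1 + s\<^sup>2)"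
      by (simp add: norm_divide n2)
    also have "\<dots> \<le> (cmod (1 + z\<^sup>2) / d + cmod z) / (1 + s\<^sup>2)"
    proof (rule divide_right_mono)
      have "cmod ((1 + z\<^sup>2) / (z - of_real s) - z) \<le> cmod ((1 + z\<^sup>2) / (z - of_real s)) + cmod z"
        by (rule norm_triangle_ineq4)
      also have "\<dots> \<le> cmod (1 + z\<^sup>2) / d + cmod z"
        using s d unfolding norm_divide by (intro add_right_mono divide_left_mono mult_pos_pos) auto
      finally show "cmod ((1 + z\<^sup>2) / (z - of_real s) - z) \<le> cmod (1 + z\<^sup>2) / d + cmod z" .
    qed simp
    finally show "norm (1 / (z - of_real s) + of_real s / (1 + (of_real s)\<^sup>2))
      \<le> norm ((cmod (1 + z\<^sup>2) / d + cmod z) * (1 / (1 + s\<^sup>2)))"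
      using d by simp
  qed
qed (simp add: borel_measurable_sets_borel[OF M])

lemma finite_interval: "emeasure M {a..b} < \<infinity>"
proof (rule finite_emeasure_of_integrable[OF M int])
  have pos: "0 < 1 + s\<^sup>2" for s :: real by (simp add: add_pos_nonneg)
  show "continuous_on UNIV (\<lambda>s::real. 1 / (1 + s\<^sup>2))"
    by (intro continuous_intros ballI) (metis pos less_irrefl)
  show "0 < 1 / (1 + s\<^sup>2)" for s :: real using pos by simp
qed

text \<open>Apart from the affine term, which has the helpful sign, the imaginary part is minus a
  Poisson integral, and the kernel e/((x - s)^2 + e^2) is at least 1/(2 e) on
  [x - e, x + e].\<close>

lemma measure_le_Im_nevanlinna:
  assumes e: "0 < e" and c: "0 \<le> c"
  shows "measure M {x - e..x + e} \<le> 2 * e * (- Im (nevanlinna M a c (Complex x e)))"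
proof -
  let ?z = "Complex x e"
  let ?f = "\<lambda>s. 1 / (?z - of_real s) + of_real s / (1 + (of_real s)\<^sup>2)"
  have "AE s in M. e \<le> cmod (?z - of_real s)"
  proof (rule AE_I2)
    fix s show "e \<le> cmod (?z - of_real s)"
      using abs_Im_le_cmod[of "?z - of_real s"] e by simp
  qed
  then have i: "integrable M ?f" by (intro integrable_nevanlinna_kernel[OF e])
  have im: "Im (?f s) = - (e / ((x - s)\<^sup>2 + e\<^sup>2))" for s
  proof -
    have "(complex_of_real s) / (1 + (of_real s)\<^sup>2) = of_real (s / (1 + s\<^sup>2))" by simp
    then have "Im (complex_of_real s / (1 + (of_real s)\<^sup>2)) = 0" by (metis Im_complex_of_real)
    then show ?thesis by (simp add: Im_divide)
  qed
  have i2: "integrable M (\<lambda>s. e / ((x - s)\<^sup>2 + e\<^sup>2))"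
    using integrable_Im[OF i] unfolding im by simp
  have "Im (nevanlinna M a c ?z) = - (LINT s|M. e / ((x - s)\<^sup>2 + e\<^sup>2)) - c * e"
    unfolding nevanlinna_def using integral_Im[OF i] unfolding im by simp
  moreover have "measure M {x - e..x + e} / (2 * e) \<le> (LINT s|M. e / ((x - s)\<^sup>2 + e\<^sup>2))"
  proof -
    have "measure M {x - e..x + e} / (2 * e) = (LINT s|M. indicator {x - e..x + e} s / (2 * e))"
      by (simp add: M sets_eq_imp_space_eq[OF M])
    also have "\<dots> \<le> (LINT s|M. e / ((x - s)\<^sup>2 + e\<^sup>2))"
    proof (rule integral_mono')
      fix s show "indicator {x - e..x + e} s / (2 * e) \<le> e / ((x - s)\<^sup>2 + e\<^sup>2)"
      proof (cases "s \<in> {x - e..x + e}")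
        case True
        then have "(x - s)\<^sup>2 \<le> e\<^sup>2" using e by (intro power2_le_iff_abs_le[THEN iffD2]) auto
        then have "(x - s)\<^sup>2 + e\<^sup>2 \<le> 2 * e * e" by (simp add: power2_eq_square)
        moreover have "0 < (x - s)\<^sup>2 + e\<^sup>2" using e by (simp add: add_nonneg_pos)
        ultimately have "1 / (2 * e) \<le> e / ((x - s)\<^sup>2 + e\<^sup>2)"
          using e by (simp add: divide_simps mult.commute)
        then show ?thesis using True by simp
      qed (use e in simp)
    qed (use i2 e in auto)
    finally show ?thesis .
  qed
  moreover have "0 \<le> c * e" using c e by simp
  ultimately have "measure M {x - e..x + e} / (2 * e) \<le> - Im (nevanlinna M a c ?z)" by linarith
  then show ?thesis using e by (simp add: field_simps)
qed

section \<open>Nevanlinna functions on the real axis below the support\<close>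

context
  fixes m :: real
  assumes m: "AE s in M. m \<le> s"
begin

lemma integrable_inverse_square:
  assumes x: "x < m"
  shows "integrable M (\<lambda>s. 1 / (x - s)\<^sup>2)"
proof (rule Bochner_Integration.integrable_bound)
  \<comment> \<open>From 1 + s^2 <= (1 + 2 x^2) + 2 (x - s)^2, where the first bracket is absorbed
    by means of (m - x)^2 <= (x - s)^2.\<close>
  define C where "C = (1 + 2 * x\<^sup>2) / (m - x)\<^sup>2 + 2"
  show "integrable M (\<lambda>s. C * (1 / (1 + s\<^sup>2)))" using int by (rule integrable_mult_right)
  show "AE s in M. norm (1 / (x - s)\<^sup>2) \<le> norm (C * (1 / (1 + s\<^sup>2)))"
    using m
  proof eventually_elim
    fix s assume s: "m \<le> s"
    have pos: "0 < (m - x)\<^sup>2" "0 < (x - s)\<^sup>2" using x s by auto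
    have "(m - x)\<^sup>2 \<le> (s - x)\<^sup>2" using x s by (intro power_mono) auto
    then have le: "(m - x)\<^sup>2 \<le> (x - s)\<^sup>2" by (simp add: power2_commute)
    have "2 * s\<^sup>2 \<le> 4 * x\<^sup>2 + 4 * (x - s)\<^sup>2"
      using zero_le_power2[of "2 * x - s"] by (simp add: power2_eq_square algebra_simps)
    then have "1 + s\<^sup>2 \<le> (1 + 2 * x\<^sup>2) + 2 * (x - s)\<^sup>2" by simp
    also have "1 + 2 * x\<^sup>2 \<le> (1 + 2 * x\<^sup>2) / (m - x)\<^sup>2 * (x - s)\<^sup>2"
    proof -
      have "(1 + 2 * x\<^sup>2) * (m - x)\<^sup>2 \<le> (1 + 2 * x\<^sup>2) * (x - s)\<^sup>2"
        using le by (intro mult_left_mono) auto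
      then show ?thesis using pos by (simp add: pos_le_divide_eq)
    qed
    finally have "1 + s\<^sup>2 \<le> C * (x - s)\<^sup>2" unfolding C_def by (simp add: algebra_simps)
    moreover have p: "0 < 1 + s\<^sup>2" by (simp add: add_pos_nonneg)
    ultimately have "1 / (x - s)\<^sup>2 \<le> C * (1 / (1 + s\<^sup>2))"
      using pos(2) by (simp add: divide_simps mult.commute)
    also have "\<dots> \<le> norm (C * (1 / (1 + s\<^sup>2)))" unfolding real_norm_def by (rule abs_ge_self)
    finally show "norm (1 / (x - s)\<^sup>2) \<le> norm (C * (1 / (1 + s\<^sup>2)))" by simp
  qed
qed (simp add: borel_measurable_sets_borel[OF M])

lemma integrable_nevanlinna_below:
  assumes x: "x < m"
  shows "integrable M (\<lambda>s. 1 / (Complex x e - of_real s) + of_real s / (1 + (of_real s)\<^sup>2))"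
proof (rule integrable_nevanlinna_kernel[where d = "m - x"])
  show "AE s in M. m - x \<le> cmod (Complex x e - of_real s)"
    using m
  proof eventually_elim
    fix s assume "m \<le> s"
    then show "m - x \<le> cmod (Complex x e - of_real s)"
      using abs_Re_le_cmod[of "Complex x e - of_real s"] by simp
  qed
qed (use x in simp)

lemma nevanlinna_real:
  assumes x: "x < m"
  shows "integrable M (\<lambda>s. 1 / (x - s) + s / (1 + s\<^sup>2))"
    "nevanlinna M a c (of_real x) = of_real ((LINT s|M. 1 / (x - s) + s / (1 + s\<^sup>2)) - a - c * x)"
proof -
  have eq: "1 / (complex_of_real x - of_real s) + of_real s / (1 + (of_real s)\<^sup>2)
      = of_real (1 / (x - s) + s / (1 + s\<^sup>2))" for s by simp
  have "integrable M (\<lambda>s. complex_of_real (1 / (x - s) + s / (1 + s\<^sup>2)))"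
    using integrable_nevanlinna_below[OF x, of 0] unfolding complex_of_real_def[symmetric] eq .
  then show "integrable M (\<lambda>s. 1 / (x - s) + s / (1 + s\<^sup>2))"
    by (simp only: complex_of_real_integrable_eq)
  show "nevanlinna M a c (of_real x) = of_real ((LINT s|M. 1 / (x - s) + s / (1 + s\<^sup>2)) - a - c * x)"
    unfolding nevanlinna_def eq integral_complex_of_real by simp
qed

text \<open>The two resolvents differ by -i e/((z - s) (x - s)), and |z - s| >= |x - s|. The linear
  rate in e, and not just continuity, is what later controls imaginary parts.\<close>

lemma nevanlinna_near_real:
  assumes x: "x < m" and c: "0 \<le> c" and e: "0 < e"
  shows "cmod (nevanlinna M a c (Complex x e) - nevanlinna M a c (of_real x))
    \<le> e * ((LINT s|M. 1 / (x - s)\<^sup>2) + c)"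
proof -
  let ?z = "Complex x e"
  let ?f = "\<lambda>e s. 1 / (Complex x e - of_real s) + of_real s / (1 + (of_real s)\<^sup>2)"
  have i: "integrable M (?f e)" "integrable M (?f 0)"
    by (rule integrable_nevanlinna_below[OF x])+
  have z: "?z - of_real x = \<i> * of_real e" by (simp add: complex_eq_iff)
  have rearr: "(p - k - q) - (r - k - t) = (p - r) - (q - t)" for p k q r t :: complex by simp
  have eq: "nevanlinna M a c ?z - nevanlinna M a c (of_real x)
    = (LINT s|M. ?f e s - ?f 0 s) - of_real c * (?z - of_real x)"
    unfolding nevanlinna_def complex_of_real_def[of x] Bochner_Integration.integral_diff[OF i]
    unfolding right_diff_distrib by (rule rearr)
  have 1: "cmod (nevanlinna M a c ?z - nevanlinna M a c (of_real x))
      \<le> cmod (LINT s|M. ?f e s - ?f 0 s) + cmod (of_real c * (?z - of_real x))"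
    unfolding eq by (rule norm_triangle_ineq4)
  have 2: "cmod (of_real c * (?z - of_real x)) = e * c"
    unfolding z using c e by (simp add: norm_mult)
  have 3: "cmod (LINT s|M. ?f e s - ?f 0 s) \<le> (LINT s|M. e * (1 / (x - s)\<^sup>2))"
  proof (rule order_trans[OF integral_norm_bound integral_mono_AE'])
    show "integrable M (\<lambda>s. e * (1 / (x - s)\<^sup>2))"
      using integrable_inverse_square[OF x] by (rule integrable_mult_right)
    show "AE s in M. 0 \<le> e * (1 / (x - s)\<^sup>2)" using e by simp
    show "AE s in M. cmod (?f e s - ?f 0 s) \<le> e * (1 / (x - s)\<^sup>2)"
      using m
    proof eventually_elim
      fix s assume "m \<le> s"
      then have xs: "x - s \<noteq> 0" using x by auto
      have n1: "\<bar>x - s\<bar> \<le> cmod (?z - of_real s)" using abs_Re_le_cmod[of "?z - of_real s"] by simp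
      have nz: "?z - of_real s \<noteq> 0" "complex_of_real x - of_real s \<noteq> 0"
        using n1 xs by (auto simp flip: of_real_diff)
      have "?f e s - ?f 0 s = (of_real x - ?z) / ((?z - of_real s) * (of_real x - of_real s))"
        unfolding complex_of_real_def[of x, symmetric] using nz by (simp add: field_simps)
      also have "of_real x - ?z = - (\<i> * of_real e)" using z by (metis minus_diff_eq)
      finally have "cmod (?f e s - ?f 0 s) = e / (cmod (?z - of_real s) * \<bar>x - s\<bar>)"
        using e by (simp add: norm_divide norm_mult flip: of_real_diff)
      also have "\<dots> \<le> e / (\<bar>x - s\<bar> * \<bar>x - s\<bar>)"
        using n1 xs e nz by (intro divide_left_mono mult_right_mono mult_pos_pos) auto
      finally show "cmod (?f e s - ?f 0 s) \<le> e * (1 / (x - s)\<^sup>2)" by (simp add: power2_eq_square)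
    qed
  qed
  have "(LINT s|M. e * (1 / (x - s)\<^sup>2)) = e * (LINT s|M. 1 / (x - s)\<^sup>2)"
    by (rule integral_mult_right_zero)
  then show ?thesis using 1 2 3 unfolding distrib_left by linarith
qed

lemma tendsto_nevanlinna:
  assumes x: "x < m" and c: "0 \<le> c"
  shows "((\<lambda>e. nevanlinna M a c (Complex x e)) \<longlongrightarrow> nevanlinna M a c (of_real x)) (at_right 0)"
proof (rule Lim_transform[of "\<lambda>_. nevanlinna M a c (of_real x)"])
  let ?K = "(LINT s|M. 1 / (x - s)\<^sup>2) + c"
  show "((\<lambda>e. nevanlinna M a c (Complex x e) - nevanlinna M a c (of_real x)) \<longlongrightarrow> 0) (at_right 0)"
  proof (rule Lim_null_comparison)
    show "\<forall>\<^sub>F e in at_right 0. norm (nevanlinna M a c (Complex x e) - nevanlinna M a c (of_real x)) \<le> e * ?K"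
      using eventually_at_right_less[of 0]
      by eventually_elim (rule nevanlinna_near_real[OF x c])
    show "((\<lambda>e. e * ?K) \<longlongrightarrow> 0) (at_right 0)"
      by (rule tendsto_eq_intros refl)+ simp
  qed
qed (rule tendsto_const)

lemma nevanlinna_eventually_nonzero:
  assumes c: "0 \<le> c" and nz: "emeasure M UNIV \<noteq> 0"
  obtains P where "P \<le> m" "\<And>x. x < P \<Longrightarrow> nevanlinna M a c (of_real x) \<noteq> 0"
proof -
  define g where "g = (\<lambda>x. (LINT s|M. 1 / (x - s) + s / (1 + s\<^sup>2)) - a - c * x)"
  have dec: "g y < g x" if xy: "x < y" "y < m" for x y
  proof -
    have ix: "integrable M (\<lambda>s. 1 / (x - s) + s / (1 + s\<^sup>2))" and iy: "integrable M (\<lambda>s. 1 / (y - s) + s / (1 + s\<^sup>2))"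
      using nevanlinna_real(1) xy by auto
    have sp: "emeasure M (space M) \<noteq> 0" using nz sets_eq_imp_space_eq[OF M] by simp
    let ?d = "\<lambda>s. (1 / (x - s) + s / (1 + s\<^sup>2)) - (1 / (y - s) + s / (1 + s\<^sup>2))"
    have pos: "AE s in M. 0 < ?d s"
      using m
    proof eventually_elim
      fix s assume "m \<le> s"
      then have "y - s < 0" "x - s < y - s" using xy by auto
      then have "1 / (y - s) < 1 / (x - s)"
        by (intro divide_strict_left_mono) (auto intro: mult_neg_neg)
      then show "0 < ?d s" by simp
    qed
    have id: "integrable M ?d" using ix iy by (rule Bochner_Integration.integrable_diff)
    have "0 \<le> integral\<^sup>L M ?d"
    proof (rule integral_nonneg_AE)
      show "AE s in M. 0 \<le> ?d s" using pos by eventually_elim simp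
    qed
    \<comment> \<open>Strictness comes from M being nonzero: an integrand that is positive almost
      everywhere and has integral 0 would make the whole space null.\<close>
    moreover have "integral\<^sup>L M ?d \<noteq> 0"
    proof
      assume "integral\<^sup>L M ?d = 0"
      moreover have "AE s in M. 0 \<le> ?d s" using pos by eventually_elim simp
      ultimately have "AE s in M. ?d s = 0" using integral_nonneg_eq_0_iff_AE[OF id] by blast
      with pos have "AE s in M. False" by eventually_elim simp
      then show False using sp AE_iff_measurable[of "space M" M "\<lambda>_. False"] by simp
    qed
    ultimately have "0 < integral\<^sup>L M ?d" by simp
    then have "(LINT s|M. 1 / (y - s) + s / (1 + s\<^sup>2)) < (LINT s|M. 1 / (x - s) + s / (1 + s\<^sup>2))"
      unfolding Bochner_Integration.integral_diff[OF ix iy] by simp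
    moreover have "c * x \<le> c * y" using xy c by (intro mult_left_mono) auto
    ultimately show ?thesis unfolding g_def by linarith
  qed
  \<comment> \<open>A zero below m serves as P, since the function is positive to the left of it; if
    there is none, m itself does.\<close>
  have "\<exists>P\<le>m. \<forall>x<P. g x \<noteq> 0"
  proof (cases "\<exists>x<m. g x = 0")
    case True
    then obtain P where "P < m" "g P = 0" by auto
    then show ?thesis using dec[of _ P] by (intro exI[of _ P]) force
  qed auto
  then obtain P where P: "P \<le> m" "\<And>x. x < P \<Longrightarrow> g x \<noteq> 0" by auto
  show thesis
  proof (rule that[OF P(1)])
    fix x assume "x < P"
    then show "nevanlinna M a c (of_real x) \<noteq> 0"
      using nevanlinna_real(2)[of x a c] P unfolding g_def by (simp del: of_real_diff of_real_mult)
  qed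
qed

end

end

text \<open>Near a real point below the support of \<open>M\<close> where the Nevanlinna function of \<open>M\<close> does not
  vanish, the imaginary part of its reciprocal is \<open>O(e)\<close> at height \<open>e\<close>.\<close>

lemma is_B_reg_bounded_below:
  assumes M: "sets M = sets borel" "integrable M (\<lambda>s. 1 / (1 + s\<^sup>2))" "AE s in M. m \<le> s" "emeasure M UNIV \<noteq> 0"
    and N: "sets N = sets borel" "integrable N (\<lambda>s. 1 / (1 + s\<^sup>2))"
    and c1: "0 \<le> c1" and z1: "0 \<le> z1" and B: "is_B_reg M a0 c1 N b0 z1"
  obtains P where "AE s in N. P \<le> s"
    "\<And>x. x < P \<Longrightarrow> nevanlinna M a0 c1 (of_real x) * nevanlinna N b0 z1 (of_real x) = - of_real (pi\<^sup>2)"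
proof -
  obtain P where P: "P \<le> m" "\<And>x. x < P \<Longrightarrow> nevanlinna M a0 c1 (of_real x) \<noteq> 0"
    using nevanlinna_eventually_nonzero[OF M(1-3) c1 M(4)] by metis
  have AEP: "AE s in N. P \<le> s"
  proof (rule null_of_local_quadratic_bound[OF N(1) finite_interval[OF N]])
    fix x assume x: "x < P"
    define K where "K = (LINT s|M. 1 / (x - s)\<^sup>2) + c1"
    define G where "G = nevanlinna M a0 c1"
    define g where "g = cmod (G (of_real x))"
    have K0: "0 \<le> K" unfolding K_def using c1 by (intro add_nonneg_nonneg integral_nonneg_AE) auto
    have g0: "0 < g" using P(2)[OF x] by (simp add: g_def G_def)
    have xm: "x < m" using x P(1) by simp
    have Gx: "Im (G (of_real x)) = 0"
      unfolding G_def nevanlinna_real(2)[OF M(1-3) xm] by (rule Im_complex_of_real)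
    \<comment> \<open>For e < d the function stays above g/2 in modulus at height e; the 1 keeps the
      quotient meaningful if K = 0.\<close>
    define d where "d = g / (2 * (K + 1))"
    have "measure N {x - e..x + e} \<le> (2 * (pi\<^sup>2 * K * (4 / g\<^sup>2))) * e\<^sup>2" if e: "0 < e" "e < d" for e
    proof -
      let ?z = "Complex x e"
      have near: "cmod (G ?z - G (of_real x)) \<le> e * K"
        unfolding G_def K_def by (rule nevanlinna_near_real[OF M(1-3) xm c1 e(1)])
      have "e * K \<le> e * (K + 1)" using e by simp
      also have "\<dots> \<le> d * (K + 1)" using e K0 by (intro mult_right_mono) auto
      also have "\<dots> = g / 2" using K0 by (simp add: d_def field_simps)
      finally have eK: "e * K \<le> g / 2" .
      have Gz: "g / 2 \<le> cmod (G ?z)"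
        using norm_triangle_ineq2[of "G (of_real x)" "G (of_real x) - G ?z"] near eK
        by (simp add: g_def norm_minus_commute)
      have ImG: "\<bar>Im (G ?z)\<bar> \<le> e * K"
        using abs_Im_le_cmod[of "G ?z - G (of_real x)"] near Gx by simp
      define H where "H = nevanlinna N b0 z1 ?z"
      have GH: "G ?z * H = - of_real (pi\<^sup>2)"
        unfolding G_def H_def by (rule is_B_reg_nevanlinna[OF B]) (use e in simp)
      have Gnz: "G ?z \<noteq> 0" using Gz g0 by auto
      then have "H = - of_real (pi\<^sup>2) / G ?z" using GH by (simp add: field_simps)
      then have "- Im H = - (pi\<^sup>2 * Im (G ?z) / (cmod (G ?z))\<^sup>2)"
        by (simp add: Im_divide cmod_power2)
      also have "\<dots> \<le> \<bar>pi\<^sup>2 * Im (G ?z) / (cmod (G ?z))\<^sup>2\<bar>" by (rule abs_ge_minus_self)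
      also have "\<dots> = pi\<^sup>2 * \<bar>Im (G ?z)\<bar> / (cmod (G ?z))\<^sup>2" by (simp add: abs_mult)
      also have "\<dots> \<le> pi\<^sup>2 * (e * K) / (g / 2)\<^sup>2"
        using ImG Gz g0 e K0 by (intro frac_le mult_left_mono power_mono mult_nonneg_nonneg) auto
      also have "\<dots> = pi\<^sup>2 * K * (4 / g\<^sup>2) * e" using g0 by (simp add: field_simps power2_eq_square)
      finally have ImH: "- Im H \<le> pi\<^sup>2 * K * (4 / g\<^sup>2) * e" .
      have "measure N {x - e..x + e} \<le> 2 * e * (- Im H)"
        unfolding H_def by (rule measure_le_Im_nevanlinna[OF N e(1) z1])
      also have "\<dots> \<le> 2 * e * (pi\<^sup>2 * K * (4 / g\<^sup>2) * e)"
        using ImH e by (intro mult_left_mono) auto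
      finally show ?thesis by (simp add: power2_eq_square mult_ac)
    qed
    moreover have "0 < d" using g0 K0 by (simp add: d_def)
    ultimately show "\<exists>C. \<exists>d>0. \<forall>e. 0 < e \<and> e < d \<longrightarrow> measure N {x - e..x + e} \<le> C * e\<^sup>2" by blast
  qed
  show thesis
  proof (rule that[OF AEP])
    fix x assume x: "x < P"
    \<comment> \<open>The product identity holds above the axis. Both factors have boundary values
      at x, the second one because N does not charge the half-line below P.\<close>
    have "((\<lambda>e. nevanlinna M a0 c1 (Complex x e) * nevanlinna N b0 z1 (Complex x e)) \<longlongrightarrow>
        nevanlinna M a0 c1 (of_real x) * nevanlinna N b0 z1 (of_real x)) (at_right 0)"
      using x P(1) by (intro tendsto_mult tendsto_nevanlinna[OF M(1-3)] tendsto_nevanlinna[OF N AEP] c1 z1) auto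
    moreover have "((\<lambda>e. nevanlinna M a0 c1 (Complex x e) * nevanlinna N b0 z1 (Complex x e)) \<longlongrightarrow>
        - of_real (pi\<^sup>2)) (at_right 0)"
    proof (rule Lim_transform_eventually[OF tendsto_const])
      show "\<forall>\<^sub>F e in at_right 0. - of_real (pi\<^sup>2) = nevanlinna M a0 c1 (Complex x e) * nevanlinna N b0 z1 (Complex x e)"
        using eventually_at_right_less[of 0] by eventually_elim (use is_B_reg_nevanlinna[OF B] in auto)
    qed
    ultimately show "nevanlinna M a0 c1 (of_real x) * nevanlinna N b0 z1 (of_real x) = - of_real (pi\<^sup>2)"
      by (rule tendsto_unique[rotated]) simp
  qed
qed

section \<open>Behaviour of the symbol at infinity\<close>

text \<open>\<open>N2\<close> stands for a measure already divided by s, as in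
  \<open>inv_weighted\<close>; the factor p in the last term is the time derivative of the
  convolution.\<close>

definition symbol :: "real \<Rightarrow> real \<Rightarrow> real measure \<Rightarrow> real measure \<Rightarrow> real \<Rightarrow> real" where
  "symbol c1 c0 N1 N2 p = c1 * p - c0 - (LINT s|N1. 1 / (p + s)) + p * (LINT s|N2. 1 / (p + s))"

lemma M_exp_sets: "M \<in> M_exp n \<Longrightarrow> sets M = sets borel"
  by (simp add: M_exp_def)

lemma M_frac_sets: "M \<in> M_frac \<Longrightarrow> sets M = sets borel"
  by (simp add: M_frac_def M_exp_def)

lemma admissible_integrable_bounded:
  fixes f :: "real \<Rightarrow> real"
  assumes N: "admissible m N" and f: "f \<in> borel_measurable borel"
    and bound: "\<And>s. m \<le> s \<Longrightarrow> \<bar>f s\<bar> * (1 + \<bar>s\<bar>) \<le> C"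
  shows "integrable N f"
proof -
  have sN: "sets N = sets borel" and m: "AE s in N. m \<le> s" and i: "integrable N (\<lambda>s. 1 / (1 + \<bar>s\<bar>))"
    using N unfolding admissible_def by auto
  show ?thesis
  proof (rule Bochner_Integration.integrable_bound)
    show "integrable N (\<lambda>s. C * (1 / (1 + \<bar>s\<bar>)))" using i by (rule integrable_mult_right)
    show "AE s in N. norm (f s) \<le> norm (C * (1 / (1 + \<bar>s\<bar>)))"
      using m
    proof eventually_elim
      fix s assume "m \<le> s"
      then have "\<bar>f s\<bar> \<le> C / (1 + \<bar>s\<bar>)" using bound by (subst pos_le_divide_eq) auto
      also have "\<dots> \<le> \<bar>C / (1 + \<bar>s\<bar>)\<bar>" by (rule abs_ge_self)
      finally show "norm (f s) \<le> norm (C * (1 / (1 + \<bar>s\<bar>)))" by simp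
    qed
  qed (use f in \<open>simp add: borel_measurable_sets_borel[OF sN]\<close>)
qed

lemma one_plus_square_pos: "0 < 1 + (s::real)\<^sup>2"
  by (simp add: add_pos_nonneg)

lemma admissible_integrable_one_plus_square:
  assumes N: "admissible m N"
  shows "integrable N (\<lambda>s. 1 / (1 + s\<^sup>2))" "integrable N (\<lambda>s. s / (1 + s\<^sup>2))"
proof -
  have 1: "1 + \<bar>s\<bar> \<le> 2 * (1 + s\<^sup>2)" "\<bar>s\<bar> * (1 + \<bar>s\<bar>) \<le> 2 * (1 + s\<^sup>2)" for s :: real
  proof -
    have "0 \<le> (\<bar>s\<bar> - 1)\<^sup>2" "\<bar>s\<bar>\<^sup>2 = s\<^sup>2" by simp_all
    then have "2 * \<bar>s\<bar> \<le> s\<^sup>2 + 1" by (simp add: power2_eq_square algebra_simps)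
    moreover have "\<bar>s\<bar> * \<bar>s\<bar> = s\<^sup>2" by (simp add: power2_eq_square)
    moreover have "0 \<le> s\<^sup>2" by simp
    ultimately show "1 + \<bar>s\<bar> \<le> 2 * (1 + s\<^sup>2)" "\<bar>s\<bar> * (1 + \<bar>s\<bar>) \<le> 2 * (1 + s\<^sup>2)"
      unfolding distrib_left by linarith+
  qed
  show "integrable N (\<lambda>s. 1 / (1 + s\<^sup>2))"
    by (rule admissible_integrable_bounded[OF N, where C = 2])
      (use 1(1) one_plus_square_pos in \<open>auto simp: pos_divide_le_eq\<close>)
  show "integrable N (\<lambda>s. s / (1 + s\<^sup>2))"
    by (rule admissible_integrable_bounded[OF N, where C = 2])
      (use 1(2) one_plus_square_pos in \<open>auto simp: pos_divide_le_eq abs_of_pos\<close>)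
qed

text \<open>The integral of s/(1 + s^2) over \<open>lam1\<close> is cancelled by
  \<open>sigma_R\<close>. Over \<open>lam2\<close> it is completed by \<open>xi_frac\<close>: s/(1 +
  s^2) + 1/(s (1 + s^2)) = 1/s, and 1/s - 1/(p + s) = p/(s (p + s)) is p times the resolvent with
  weight 1/s.\<close>

lemma nevanlinna_symbol:
  assumes l1: "lam1 \<in> M_exp 1" "admissible m lam1" and l2: "lam2 \<in> M_frac"
    and p: "\<bar>m\<bar> + 1 \<le> p"
  shows "nevanlinna (add_measure lam1 lam2) (c0 - pi * sigma_R lam1 - pi * xi_frac lam2) c1 (of_real (- p))
    = of_real (symbol c1 c0 lam1 (inv_weighted lam2) p)"
proof -
  let ?M = "add_measure lam1 lam2" and ?N = "inv_weighted lam2"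
  note s1 = M_exp_sets[OF l1(1)] and s2 = M_frac_sets[OF l2]
  note N = admissible_inv_weighted[OF l2]
  have int: "integrable ?M (\<lambda>s. 1 / (1 + s\<^sup>2))"
    using admissible_integrable_one_plus_square(1)[OF l1(2)] M_exp_2_integrable[of lam2] l2
    by (simp add: integrable_add_measure[OF s1 s2] M_frac_def)
  define m' where "m' = min m 0"
  have ae: "AE s in ?M. m' \<le> s"
  proof (subst AE_add_measure[OF s1 s2])
    have "AE s in lam1. m \<le> s" using l1(2) by (simp add: admissible_def)
    then have "AE s in lam1. m' \<le> s" by eventually_elim (simp add: m'_def)
    moreover have "AE s in lam2. m' \<le> s" using M_frac_AE_pos[OF l2] by eventually_elim (simp add: m'_def)
    ultimately show "(AE s in lam1. m' \<le> s) \<and> (AE s in lam2. m' \<le> s)" ..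
  qed measurable
  have x: "- p < m'" using p unfolding m'_def by linarith
  let ?k = "\<lambda>s. 1 / (- p - s) + s / (1 + s\<^sup>2)"
  have ik: "integrable lam1 ?k" "integrable lam2 ?k"
    using nevanlinna_real(1)[OF sets_add_measure int ae x] by (simp_all add: integrable_add_measure[OF s1 s2])
  have k_eq: "?k = (\<lambda>s. s / (1 + s\<^sup>2) - 1 / (p + s))"
  proof
    fix s
    have "1 / (- p - s) = - (1 / (p + s))" using minus_divide_right[of 1 "p + s"] by simp
    then show "?k s = s / (1 + s\<^sup>2) - 1 / (p + s)" by simp
  qed
  have 1: "(LINT s|lam1. ?k s) = - pi * sigma_R lam1 - (LINT s|lam1. 1 / (p + s))"
  proof -
    have "(\<lambda>s. s / (pi * (1 + s\<^sup>2))) = (\<lambda>s. 1 / pi * (s / (1 + s\<^sup>2)))" by simp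
    then have "- pi * sigma_R lam1 = (LINT s|lam1. s / (1 + s\<^sup>2))"
      unfolding sigma_R_def by (simp only: integral_mult_right_zero) simp
    then show ?thesis unfolding k_eq
      using admissible_integrable_one_plus_square(2)[OF l1(2)] admissible_integrable_resolvent[OF l1(2) p] by simp
  qed
  have 2: "(LINT s|lam2. ?k s) + pi * xi_frac lam2 = p * (LINT s|?N. 1 / (p + s))"
  proof -
    have i2: "integrable lam2 (\<lambda>s. 1 / (1 + s\<^sup>2) / s)"
      using admissible_integrable_one_plus_square(1)[OF N] by (simp add: integral_inv_weighted(1)[OF l2])
    have "pi * xi_frac lam2 = (LINT s|lam2. 1 / (1 + s\<^sup>2) / s)"
      unfolding xi_frac_def by (simp add: mult.commute)
    then have "(LINT s|lam2. ?k s) + pi * xi_frac lam2 = (LINT s|lam2. ?k s + 1 / (1 + s\<^sup>2) / s)"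
      unfolding Bochner_Integration.integral_add[OF ik(2) i2] by simp
    also have "\<dots> = (LINT s|lam2. p * (1 / (p + s) / s))"
    proof (rule integral_cong_AE)
      show "AE s in lam2. ?k s + 1 / (1 + s\<^sup>2) / s = p * (1 / (p + s) / s)"
        using M_frac_AE_pos[OF l2]
      proof eventually_elim
        fix s :: real assume s: "0 < s"
        have ps: "0 < p + s" using s p by linarith
        have "s / (1 + s\<^sup>2) + 1 / (1 + s\<^sup>2) / s = 1 / s"
          using s one_plus_square_pos[of s] by (simp add: divide_simps) (simp add: power2_eq_square algebra_simps)
        moreover have "1 / s - 1 / (p + s) = p * (1 / (p + s) / s)"
          using s ps by (simp add: divide_simps)
        ultimately show "?k s + 1 / (1 + s\<^sup>2) / s = p * (1 / (p + s) / s)"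
          unfolding fun_cong[OF k_eq, of s] by linarith
      qed
    qed (simp_all add: borel_measurable_sets_borel[OF s2])
    also have "\<dots> = p * (LINT s|?N. 1 / (p + s))"
      unfolding integral_mult_right_zero by (simp add: integral_inv_weighted(2)[OF l2])
    finally show ?thesis .
  qed
  show ?thesis
    unfolding nevanlinna_real(2)[OF sets_add_measure int ae x] of_real_eq_iff symbol_def
      integral_add_measure[OF s1 s2 ik] 1 using 2 by (simp add: algebra_simps)
qed

lemma tendsto_resolvent:
  assumes N: "admissible m N"
  shows "((\<lambda>p. LINT s|N. 1 / (p + s)) \<longlongrightarrow> 0) at_top"
proof -
  have sN: "sets N = sets borel" and m: "AE s in N. m \<le> s" using N by (auto simp: admissible_def)
  define q where "q = \<bar>m\<bar> + 1"
  have "((\<lambda>p. LINT s|N. 1 / (p + s)) \<longlongrightarrow> (LINT s|N. 0)) at_top"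
  proof (rule integral_dominated_convergence_at_top)
    show "integrable N (\<lambda>s. 1 / (q + s))"
      by (rule admissible_integrable_resolvent[OF N]) (simp add: q_def)
    show "\<forall>\<^sub>F p in at_top. AE s in N. norm (1 / (p + s)) \<le> 1 / (q + s)"
      using eventually_ge_at_top[of q]
    proof eventually_elim
      fix p assume p: "q \<le> p"
      show "AE s in N. norm (1 / (p + s)) \<le> 1 / (q + s)"
        using m
      proof eventually_elim
        fix s assume "m \<le> s"
        then have "0 < q + s" unfolding q_def by linarith
        then show "norm (1 / (p + s)) \<le> 1 / (q + s)" using p by (simp add: frac_le)
      qed
    qed
    show "AE s in N. ((\<lambda>p. 1 / (p + s)) \<longlongrightarrow> 0) at_top"
    proof (rule AE_I2)
      fix s :: real
      show "((\<lambda>p. 1 / (p + s)) \<longlongrightarrow> 0) at_top"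
        using tendsto_inverse_0_at_top[OF filterlim_tendsto_add_at_top[OF tendsto_const[of s] filterlim_ident]]
        by (simp add: inverse_eq_divide add.commute)
    qed
  qed (simp_all add: borel_measurable_sets_borel[OF sN])
  then show ?thesis by simp
qed

lemma tendsto_symbol_div:
  assumes "admissible m1 N1" "admissible m2 N2"
  shows "((\<lambda>p. symbol c1 c0 N1 N2 p / p) \<longlongrightarrow> c1) at_top"
proof -
  let ?R = "\<lambda>N p. LINT s|N. 1 / (p + s)"
  have "((\<lambda>p. c1 - (c0 + ?R N1 p) * inverse p + ?R N2 p) \<longlongrightarrow> c1 - (c0 + 0) * 0 + 0) at_top"
    by (intro tendsto_intros tendsto_resolvent[OF assms(1)] tendsto_resolvent[OF assms(2)]
        tendsto_inverse_0_at_top filterlim_ident)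
  moreover have "\<forall>\<^sub>F p in at_top. c1 - (c0 + ?R N1 p) * inverse p + ?R N2 p = symbol c1 c0 N1 N2 p / p"
    using eventually_gt_at_top[of 0]
    by eventually_elim (simp add: symbol_def field_simps)
  ultimately show ?thesis by (simp add: tendsto_cong)
qed

text \<open>Dividing f g = k by p^2 shows that the leading coefficients are not both nonzero. If a
  is nonzero, then p g(p) = k/(f(p)/p) converges to k/a.\<close>

lemma reciprocal_symbols:
  assumes f: "((\<lambda>p. f p / p) \<longlongrightarrow> a) at_top" and g: "((\<lambda>p. g p / p) \<longlongrightarrow> b) at_top"
    and fg: "\<forall>\<^sub>F p in at_top. f p * g p = (k::real)"
  shows "a * b = 0" "a \<noteq> 0 \<Longrightarrow> \<exists>C. \<forall>\<^sub>F p in at_top. \<bar>p * g p\<bar> \<le> C"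
proof -
  have inv: "((\<lambda>p. inverse p) \<longlongrightarrow> (0::real)) at_top"
    by (rule tendsto_inverse_0_at_top[OF filterlim_ident])
  have "((\<lambda>p. (f p / p) * (g p / p)) \<longlongrightarrow> a * b) at_top" by (intro tendsto_mult f g)
  moreover have "((\<lambda>p. (f p / p) * (g p / p)) \<longlongrightarrow> k * (0 * 0)) at_top"
  proof (rule Lim_transform_eventually)
    show "((\<lambda>p. k * (inverse p * inverse p)) \<longlongrightarrow> k * (0 * 0)) at_top" by (intro tendsto_intros inv)
    show "\<forall>\<^sub>F p in at_top. k * (inverse p * inverse p) = (f p / p) * (g p / p)"
      using fg by eventually_elim (simp add: divide_inverse mult_ac)
  qed
  ultimately have "a * b = k * (0 * 0)"
    by (rule tendsto_unique[OF trivial_limit_at_top_linorder])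
  then show "a * b = 0" by simp
  assume a: "a \<noteq> 0"
  have "((\<lambda>p. k / (f p / p)) \<longlongrightarrow> k / a) at_top" by (intro tendsto_intros f a)
  then have "\<forall>\<^sub>F p in at_top. dist (k / (f p / p)) (k / a) < 1" by (rule tendstoD) simp
  moreover have "\<forall>\<^sub>F p in at_top. f p / p \<noteq> 0" using tendsto_imp_eventually_ne[OF f a] .
  ultimately have "\<forall>\<^sub>F p in at_top. \<bar>p * g p\<bar> \<le> \<bar>k / a\<bar> + 1"
    using fg
  proof eventually_elim
    fix p assume p: "dist (k / (f p / p)) (k / a) < 1" "f p / p \<noteq> 0" "f p * g p = k"
    then have "p * g p = k / (f p / p)" by (auto simp: field_simps)
    then show "\<bar>p * g p\<bar> \<le> \<bar>k / a\<bar> + 1" using p(1) unfolding dist_real_def by linarith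
  qed
  then show "\<exists>C. \<forall>\<^sub>F p in at_top. \<bar>p * g p\<bar> \<le> C" by blast
qed

text \<open>For s <= p the denominator is at most 2 p times 3 p, so the kernel is at least 1/6.
  Taking p beyond n bounds the mass of [-n, n] independently of n.\<close>

lemma finite_measure_of_resolvent_bound:
  fixes M :: "real measure"
  assumes M: "sets M = sets borel" and m: "AE s in M. m \<le> s"
    and int: "\<And>p. p0 \<le> p \<Longrightarrow> integrable M (\<lambda>s. p\<^sup>2 / ((p + s) * (2 * p + s)))"
    and bound: "\<And>p. p0 \<le> p \<Longrightarrow> (LINT s|M. p\<^sup>2 / ((p + s) * (2 * p + s))) \<le> K"
  shows "finite_measure M"
proof -
  have n: "emeasure M {- real n..real n} \<le> ennreal (6 * K)" for n
  proof -
    define p where "p = max p0 (max (real n) (\<bar>m\<bar> + 1))"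
    have p: "p0 \<le> p" "real n \<le> p" "\<bar>m\<bar> + 1 \<le> p" unfolding p_def by auto
    let ?f = "\<lambda>s. p\<^sup>2 / ((p + s) * (2 * p + s))"
    have pos: "AE s in M. 0 \<le> ?f s \<and> indicator {- real n..real n} s \<le> 6 * ?f s"
      using m
    proof eventually_elim
      fix s assume s: "m \<le> s"
      have 1: "0 < p + s" "0 < 2 * p + s" "0 < p" using s p by linarith+
      have 2: "6 * ?f s \<ge> 1" if "s \<le> real n"
      proof -
        have "(p + s) * (2 * p + s) \<le> (2 * p) * (3 * p)"
          using 1 that p by (intro mult_mono) auto
        then have "1 * ((p + s) * (2 * p + s)) \<le> 6 * p\<^sup>2" by (simp add: power2_eq_square)
        then have "1 \<le> 6 * p\<^sup>2 / ((p + s) * (2 * p + s))"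
          using 1 by (subst pos_le_divide_eq) auto
        then show ?thesis by simp
      qed
      show "0 \<le> ?f s \<and> indicator {- real n..real n} s \<le> 6 * ?f s"
        using 1 2 by (auto simp: indicator_def)
    qed
    have "emeasure M {- real n..real n} = (\<integral>\<^sup>+s. ennreal (indicator {- real n..real n} s) \<partial>M)"
      by (simp add: M ennreal_indicator)
    also have "\<dots> \<le> (\<integral>\<^sup>+s. ennreal (6 * ?f s) \<partial>M)"
    proof (rule nn_integral_mono_AE)
      show "AE s in M. ennreal (indicator {- real n..real n} s) \<le> ennreal (6 * ?f s)"
        using pos by eventually_elim (intro ennreal_leI, simp)
    qed
    also have "\<dots> = ennreal (LINT s|M. 6 * ?f s)"
    proof (rule nn_integral_eq_integral)
      show "AE s in M. 0 \<le> 6 * ?f s" using pos by eventually_elim simp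
    qed (intro integrable_mult_right int p)
    also have "\<dots> \<le> ennreal (6 * K)"
      unfolding integral_mult_right_zero using bound[OF p(1)] by (intro ennreal_leI) linarith
    finally show ?thesis .
  qed
  have "(\<Union>n::nat. {- real n..real n}) = UNIV"
  proof (intro set_eqI iffI UNIV_I)
    fix s :: real
    obtain n :: nat where "\<bar>s\<bar> \<le> n" using real_arch_simple by blast
    then have "- real n \<le> s" "s \<le> real n" by linarith+
    then show "s \<in> (\<Union>n::nat. {- real n..real n})" by auto
  qed
  moreover have "(SUP n. emeasure M {- real n..real n}) = emeasure M (\<Union>n::nat. {- real n..real n})"
    by (rule SUP_emeasure_incseq) (auto simp: M incseq_def)
  ultimately have "emeasure M UNIV \<le> ennreal (6 * K)"
    using SUP_least[of UNIV "\<lambda>n. emeasure M {- real n..real n}", OF n] by simp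
  then have "emeasure M (space M) \<noteq> \<infinity>"
    using sets_eq_imp_space_eq[OF M] by (auto simp: top_unique)
  then show ?thesis by (rule finite_measureI)
qed

lemma admissible_finite_measure:
  fixes M :: "real measure"
  assumes "finite_measure M" "sets M = sets borel" "AE s in M. m \<le> s"
  shows "admissible m M"
proof -
  interpret finite_measure M by fact
  have "integrable M (\<lambda>s. 1 / (1 + \<bar>s\<bar>))"
    by (rule integrable_const_bound[where B = 1]) (auto simp: borel_measurable_sets_borel[OF assms(2)] intro!: AE_I2)
  then show ?thesis using assms by (simp add: admissible_def)
qed

text \<open>Comparing the symbol at p and at 2 p removes the constant c0, and both kinds of terms
  then produce the same positive kernel; the extra factor s in the second one is cancelled by the
  weight 1/s.\<close>

lemma resolvent_difference:
  fixes p s :: real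
  assumes "0 < p + s" "0 < 2 * p + s"
  shows "p * (1 / (p + s) - 1 / (2 * p + s)) = p\<^sup>2 / ((p + s) * (2 * p + s))"
    "p * (2 * p * (1 / (2 * p + s)) - p * (1 / (p + s))) = p\<^sup>2 / ((p + s) * (2 * p + s)) * s"
  using assms by (simp_all add: divide_simps) (simp_all add: algebra_simps power2_eq_square)

text \<open>Rests on p/(p + s) = 1 - s/(p + s): the numerator s cancels the weight, so that the last
  term is a resolvent of \<open>lam2\<close> itself. The case p = 1 exhibits the constant 1 as a sum
  of two integrable functions.\<close>

lemma finite_inv_weighted:
  assumes l2: "lam2 \<in> M_frac" and f2: "finite_measure lam2"
  shows "admissible 0 lam2" "finite_measure (inv_weighted lam2)"
    "1 \<le> p \<Longrightarrow> p * (LINT s|inv_weighted lam2. 1 / (p + s))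
       = measure (inv_weighted lam2) UNIV - (LINT s|lam2. 1 / (p + s))"
proof -
  let ?N = "inv_weighted lam2"
  note s2 = M_frac_sets[OF l2]
  note N = admissible_inv_weighted[OF l2]
  have m2: "AE s in lam2. 0 \<le> s" using M_frac_AE_pos[OF l2] by eventually_elim simp
  show a2: "admissible 0 lam2" by (rule admissible_finite_measure[OF f2 s2 m2])
  have sN: "sets ?N = sets borel" using N by (simp add: admissible_def)
  have mN: "AE s in ?N. 0 \<le> s" using N by (simp add: admissible_def)
  have conv: "integrable ?N (\<lambda>s. s / (p + s)) \<and> (LINT s|?N. s / (p + s)) = (LINT s|lam2. 1 / (p + s))" if "1 \<le> p" for p
  proof -
    have i: "integrable lam2 (\<lambda>s. 1 / (p + s))"
      by (rule admissible_integrable_resolvent[OF a2]) (use that in simp)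
    have ae: "AE s in lam2. 1 / (p + s) = s / (p + s) / s"
      using M_frac_AE_pos[OF l2] by eventually_elim simp
    have "integrable lam2 (\<lambda>s. s / (p + s) / s)"
      by (rule integrable_cong_AE_imp[OF i _ ae]) (simp add: borel_measurable_sets_borel[OF s2])
    moreover have "(LINT s|lam2. 1 / (p + s)) = (LINT s|lam2. s / (p + s) / s)"
      by (rule integral_cong_AE[OF _ _ ae]) (simp_all add: borel_measurable_sets_borel[OF s2])
    ultimately show ?thesis
      using integral_inv_weighted[OF l2, of "\<lambda>s. s / (p + s)"] by simp
  qed
  have i1: "integrable ?N (\<lambda>s. 1 :: real)"
  proof (rule integrable_cong_AE_imp)
    show "integrable ?N (\<lambda>s. 1 / (1 + s) + s / (1 + s))"
      using conv[of 1] admissible_integrable_resolvent[OF N, of 1] by simp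
    show "AE s in ?N. 1 / (1 + s) + s / (1 + s) = 1"
      using mN by eventually_elim (simp add: divide_simps)
  qed simp
  show fN: "finite_measure ?N"
    by (rule finite_measureI) (use i1 in \<open>simp add: integrable_iff_bounded\<close>)
  assume p: "1 \<le> p"
  have "p * (LINT s|?N. 1 / (p + s)) = (LINT s|?N. p * (1 / (p + s)))" by (simp only: integral_mult_right_zero)
  also have "\<dots> = (LINT s|?N. 1 - s / (p + s))"
  proof (rule integral_cong_AE)
    show "AE s in ?N. p * (1 / (p + s)) = 1 - s / (p + s)"
      using mN by eventually_elim (use p in \<open>simp add: field_simps\<close>)
  qed (simp_all add: borel_measurable_sets_borel[OF sN])
  also have "\<dots> = measure ?N UNIV - (LINT s|lam2. 1 / (p + s))"
    using conv[OF p] i1 sets_eq_imp_space_eq[OF sN] by simp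
  finally show "p * (LINT s|?N. 1 / (p + s)) = measure ?N UNIV - (LINT s|lam2. 1 / (p + s))" .
qed

text \<open>Decay of the symbol S like 1/p bounds p (S(2 p) - S(p)), a sum of two nonnegative
  integrals. Once the measures are finite, the constants left in the symbol must cancel because S
  tends to 0, and only resolvents remain.\<close>

lemma symbol_bounded_imp_finite:
  assumes l1: "lam1 \<in> M_exp 1" and l2: "lam2 \<in> M_frac"
    and bound: "\<forall>\<^sub>F p in at_top. \<bar>p * symbol 0 c0 lam1 (inv_weighted lam2) p\<bar> \<le> C"
  shows "finite_measure lam1" "finite_measure lam2" "finite_measure (inv_weighted lam2)"
    "\<forall>\<^sub>F p in at_top. symbol 0 c0 lam1 (inv_weighted lam2) p
       = - (LINT s|lam1. 1 / (p + s)) - (LINT s|lam2. 1 / (p + s))"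
proof -
  let ?N = "inv_weighted lam2"
  let ?S = "symbol 0 c0 lam1 ?N"
  obtain m where a1: "admissible m lam1" using admissible_M_exp_1[OF l1] .
  note s1 = M_exp_sets[OF l1] and s2 = M_frac_sets[OF l2]
  note N = admissible_inv_weighted[OF l2]
  have m1: "AE s in lam1. m \<le> s" using a1 by (simp add: admissible_def)
  obtain p1 where p1: "\<And>p. p1 \<le> p \<Longrightarrow> \<bar>p * ?S p\<bar> \<le> C"
    using bound unfolding eventually_at_top_linorder by blast
  define p0 where "p0 = max p1 (\<bar>m\<bar> + 1)"
  let ?f = "\<lambda>p s. p\<^sup>2 / ((p + s) * (2 * p + s))"
  have main: "integrable lam1 (?f p) \<and> integrable lam2 (?f p) \<and>
      0 \<le> (LINT s|lam1. ?f p s) \<and> 0 \<le> (LINT s|lam2. ?f p s) \<and>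
      (LINT s|lam1. ?f p s) + (LINT s|lam2. ?f p s) \<le> 2 * C" if "p0 \<le> p" for p
  proof -
    have p: "p1 \<le> p" "\<bar>m\<bar> + 1 \<le> p" "p1 \<le> 2 * p" "\<bar>m\<bar> + 1 \<le> 2 * p" "0 < p"
      using that unfolding p0_def by auto
    have q: "\<bar>0\<bar> + 1 \<le> p" "\<bar>0\<bar> + 1 \<le> 2 * p" using p by auto
    note r1 = admissible_integrable_resolvent[OF a1 p(2)] admissible_integrable_resolvent[OF a1 p(4)]
    note rN = admissible_integrable_resolvent[OF N q(1)] admissible_integrable_resolvent[OF N q(2)]
    have ae1: "AE s in lam1. p * (1 / (p + s) - 1 / (2 * p + s)) = ?f p s \<and> 0 \<le> ?f p s"
      using m1
    proof eventually_elim
      fix s assume "m \<le> s"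
      then have ps: "0 < p + s" "0 < 2 * p + s" using p by linarith+
      then show "p * (1 / (p + s) - 1 / (2 * p + s)) = ?f p s \<and> 0 \<le> ?f p s"
        using resolvent_difference(1)[OF ps] by simp
    qed
    have ae2: "AE s in lam2. p * (2 * p * (1 / (2 * p + s)) - p * (1 / (p + s))) / s = ?f p s \<and> 0 \<le> ?f p s"
      using M_frac_AE_pos[OF l2]
    proof eventually_elim
      fix s :: real assume s: "0 < s"
      then have ps: "0 < p + s" "0 < 2 * p + s" using p by linarith+
      then show "p * (2 * p * (1 / (2 * p + s)) - p * (1 / (p + s))) / s = ?f p s \<and> 0 \<le> ?f p s"
        unfolding resolvent_difference(2)[OF ps] using s by simp
    qed
    have e1: "integrable lam1 (?f p)" "(LINT s|lam1. ?f p s) = p * ((LINT s|lam1. 1 / (p + s)) - (LINT s|lam1. 1 / (2 * p + s)))"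
    proof -
      have i: "integrable lam1 (\<lambda>s. p * (1 / (p + s) - 1 / (2 * p + s)))"
        by (intro integrable_mult_right Bochner_Integration.integrable_diff r1)
      have ae: "AE s in lam1. p * (1 / (p + s) - 1 / (2 * p + s)) = ?f p s" using ae1 by eventually_elim simp
      show "integrable lam1 (?f p)"
        by (rule integrable_cong_AE_imp[OF i _ ae]) (simp add: borel_measurable_sets_borel[OF s1])
      have "(LINT s|lam1. ?f p s) = (LINT s|lam1. p * (1 / (p + s) - 1 / (2 * p + s)))"
        by (rule integral_cong_AE[symmetric, OF _ _ ae]) (simp_all add: borel_measurable_sets_borel[OF s1])
      then show "(LINT s|lam1. ?f p s) = p * ((LINT s|lam1. 1 / (p + s)) - (LINT s|lam1. 1 / (2 * p + s)))"
        by (simp only: integral_mult_right_zero Bochner_Integration.integral_diff[OF r1])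
    qed
    have e2: "integrable lam2 (?f p)" "(LINT s|lam2. ?f p s) = p * (2 * p * (LINT s|?N. 1 / (2 * p + s)) - p * (LINT s|?N. 1 / (p + s)))"
    proof -
      let ?g = "\<lambda>s. p * (2 * p * (1 / (2 * p + s)) - p * (1 / (p + s)))"
      have j: "integrable ?N (\<lambda>s. 2 * p * (1 / (2 * p + s)))" "integrable ?N (\<lambda>s. p * (1 / (p + s)))"
        by (intro integrable_mult_right rN)+
      have iN: "integrable ?N ?g"
        by (intro integrable_mult_right Bochner_Integration.integrable_diff j)
      have gb: "?g \<in> borel_measurable borel" by simp
      have i: "integrable lam2 (\<lambda>s. ?g s / s)" using iN integral_inv_weighted(1)[OF l2 gb] by blast
      have ae: "AE s in lam2. ?g s / s = ?f p s" using ae2 by eventually_elim simp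
      show "integrable lam2 (?f p)"
        by (rule integrable_cong_AE_imp[OF i _ ae]) (simp add: borel_measurable_sets_borel[OF s2])
      have "(LINT s|lam2. ?f p s) = (LINT s|lam2. ?g s / s)"
        by (rule integral_cong_AE[symmetric, OF _ _ ae]) (simp_all add: borel_measurable_sets_borel[OF s2])
      also have "\<dots> = (LINT s|?N. ?g s)" using integral_inv_weighted(2)[OF l2 gb] by simp
      also have "\<dots> = p * (2 * p * (LINT s|?N. 1 / (2 * p + s)) - p * (LINT s|?N. 1 / (p + s)))"
        by (simp only: integral_mult_right_zero Bochner_Integration.integral_diff[OF j])
      finally show "(LINT s|lam2. ?f p s) = p * (2 * p * (LINT s|?N. 1 / (2 * p + s)) - p * (LINT s|?N. 1 / (p + s)))" .
    qed
    have "(LINT s|lam1. ?f p s) + (LINT s|lam2. ?f p s) = p * (?S (2 * p) - ?S p)"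
      unfolding e1(2) e2(2) symbol_def by (simp add: algebra_simps)
    also have "\<dots> = (2 * p * ?S (2 * p)) / 2 - p * ?S p" by (simp add: algebra_simps)
    \<comment> \<open>The bound at 2 p enters with a factor 1/2, and C/2 + C is at most 2 C since C
      bounds an absolute value.\<close>
    also have "\<dots> \<le> 2 * C" using p1[OF p(1)] p1[OF p(3)] by linarith
    finally have le: "(LINT s|lam1. ?f p s) + (LINT s|lam2. ?f p s) \<le> 2 * C" .
    have "AE s in lam1. 0 \<le> ?f p s" using ae1 by eventually_elim simp
    moreover have "AE s in lam2. 0 \<le> ?f p s" using ae2 by eventually_elim simp
    ultimately have "0 \<le> (LINT s|lam1. ?f p s)" "0 \<le> (LINT s|lam2. ?f p s)"
      by (auto intro!: integral_nonneg_AE)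
    with le e1(1) e2(1) show ?thesis by blast
  qed
  show f1: "finite_measure lam1"
    using finite_measure_of_resolvent_bound[OF s1 m1, of p0 "2 * C"] main by force
  have m2: "AE s in lam2. 0 \<le> s" using M_frac_AE_pos[OF l2] by eventually_elim simp
  show f2: "finite_measure lam2"
    using finite_measure_of_resolvent_bound[OF s2 m2, of p0 "2 * C"] main by force
  note a2 = finite_inv_weighted(1)[OF l2 f2]
  show "finite_measure ?N" by (rule finite_inv_weighted(2)[OF l2 f2])
  define k where "k = measure ?N UNIV"
  have eq: "?S p = (k - c0) - (LINT s|lam1. 1 / (p + s)) - (LINT s|lam2. 1 / (p + s))" if p: "1 \<le> p" for p
  proof -
    show ?thesis unfolding symbol_def finite_inv_weighted(3)[OF l2 f2 p] k_def by simp
  qed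
  have "k - c0 = 0"
  proof -
    have "(?S \<longlongrightarrow> 0) at_top"
    proof (rule Lim_null_comparison)
      show "\<forall>\<^sub>F p in at_top. norm (?S p) \<le> C * inverse p"
        using bound eventually_gt_at_top[of 0]
        by eventually_elim (simp add: abs_mult field_simps)
      show "((\<lambda>p. C * inverse p) \<longlongrightarrow> 0) at_top"
        using tendsto_mult[OF tendsto_const[of C] tendsto_inverse_0_at_top[OF filterlim_ident]] by simp
    qed
    then have "((\<lambda>p. ?S p + (LINT s|lam1. 1 / (p + s)) + (LINT s|lam2. 1 / (p + s))) \<longlongrightarrow> 0 + 0 + 0) at_top"
      by (intro tendsto_add tendsto_resolvent[OF a1] tendsto_resolvent[OF a2])
    moreover have "((\<lambda>p. ?S p + (LINT s|lam1. 1 / (p + s)) + (LINT s|lam2. 1 / (p + s))) \<longlongrightarrow> k - c0) at_top"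
    proof (rule Lim_transform_eventually[OF tendsto_const])
      show "\<forall>\<^sub>F p in at_top. k - c0 = ?S p + (LINT s|lam1. 1 / (p + s)) + (LINT s|lam2. 1 / (p + s))"
        using eventually_ge_at_top[of 1] by eventually_elim (simp add: eq)
    qed
    ultimately have "0 + 0 + 0 = k - c0"
      by (rule tendsto_unique[OF trivial_limit_at_top_linorder])
    then show ?thesis by simp
  qed
  show "\<forall>\<^sub>F p in at_top. ?S p = - (LINT s|lam1. 1 / (p + s)) - (LINT s|lam2. 1 / (p + s))"
    using eventually_ge_at_top[of 1] by eventually_elim (simp add: eq \<open>k - c0 = 0\<close>)
qed

section \<open>The integrated equation\<close>

definition kern :: "real measure \<Rightarrow> real \<Rightarrow> real" where
  "kern N = (\<lambda>t. one_fn t * laplace N t)"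

text \<open>Frozen at its value at T rather than set to 0 afterwards, so that continuity survives;
  being constant after T, the result has a Laplace transform however fast x grows.\<close>

definition stopped :: "real \<Rightarrow> (real \<Rightarrow> real) \<Rightarrow> real \<Rightarrow> real" where
  "stopped T x = (\<lambda>t. one_fn t * x (min t T))"

lemma stopped_eq: "0 \<le> t \<Longrightarrow> t \<le> T \<Longrightarrow> stopped T x t = x t"
  by (simp add: stopped_def)

lemma causal_kern: "admissible m N \<Longrightarrow> \<bar>m\<bar> + 1 \<le> q \<Longrightarrow> causal q (kern N)"
  unfolding kern_def by (rule causal_laplace)

lemma lap_kern: "admissible m N \<Longrightarrow> \<bar>m\<bar> + 1 \<le> p \<Longrightarrow> lap (kern N) p = (LINT s|N. 1 / (p + s))"
  unfolding kern_def by (rule lap_laplace)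

lemma causal_stopped:
  assumes x: "set_integrable lborel {0..T} x" and q: "0 < q" and T: "0 < T"
  shows "causal q (stopped T x)"
proof -
  have "causal q (\<lambda>t. indicator {0..T} t * x t + indicator {T<..} t * (x T * one_fn t))"
    by (intro causal_add causal_bounded_interval x causal_cut causal_cmult causal_one q) auto
  moreover have "(\<lambda>t. indicator {0..T} t * x t + indicator {T<..} t * (x T * one_fn t)) = stopped T x"
    using T by (auto simp: stopped_def indicator_def)
  ultimately show ?thesis by simp
qed

lemma continuous_on_stopped: "continuous_on {0<..} x \<Longrightarrow> 0 < T \<Longrightarrow> continuous_on {0<..} (stopped T x)"
proof -
  assume x: "continuous_on {0<..} x" and T: "0 < T"
  have "continuous_on {0<..} (\<lambda>t. x (min t T))"
    by (rule continuous_on_compose2[OF x]) (use T in \<open>auto intro!: continuous_intros\<close>)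
  then show ?thesis by (rule continuous_on_eq) (auto simp: stopped_def)
qed

lemma continuous_on_stopped_closed: "continuous_on {0..} x \<Longrightarrow> 0 < T \<Longrightarrow> continuous_on {0..} (stopped T x)"
proof -
  assume x: "continuous_on {0..} x" and T: "0 < T"
  have "continuous_on {0..} (\<lambda>t. x (min t T))"
    by (rule continuous_on_compose2[OF x]) (use T in \<open>auto intro!: continuous_intros\<close>)
  then show ?thesis by (rule continuous_on_eq) (auto simp: stopped_def)
qed

lemma continuous_on_kern: "admissible m N \<Longrightarrow> continuous_on {0<..} (kern N)"
  by (rule continuous_on_eq[OF continuous_on_laplace_admissible]) (auto simp: kern_def)

lemma conv_eq_convolve:
  assumes "0 \<le> t" "t \<le> T"
  shows "conv (laplace N) x t = convolve (kern N) (stopped T x) t"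
  unfolding conv_def convolve_def set_lebesgue_integral_def
  using assms by (intro Bochner_Integration.integral_cong) (auto simp: kern_def stopped_def indicator_def)

lemma convolve_one_add:
  assumes "causal q f" "causal q g" "0 \<le> t"
  shows "convolve one_fn (\<lambda>t. f t + g t) t = convolve one_fn f t + convolve one_fn g t"
  using convolve_one(2)[OF causal_add[OF assms(1,2)] assms(3)] convolve_one[OF assms(1)] convolve_one[OF assms(2)] assms(3)
  by (simp add: Henstock_Kurzweil_Integration.integral_add)

lemma convolve_cmult: "convolve f (\<lambda>t. c * g t) t = c * convolve f g t"
  unfolding convolve_def by (simp add: mult.left_commute[of _ c])

lemma at_within_Ici:
  assumes "0 \<le> t" "t < T"
  shows "at t within {0..} = at t within {0..<T}" "0 < t \<Longrightarrow> at t within {0..} = at t within {0<..<T}"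
    "0 < t \<Longrightarrow> at t within {0..} = at (t::real)"
proof -
  show "at t within {0..} = at t within {0..<T}"
    by (rule at_within_nhd[of _ "{..<T}"]) (use assms in auto)
  assume t: "0 < t"
  then show "at t within {0..} = at t" using at_within_interior[of t "{0..}"] by simp
  then show "at t within {0..} = at t within {0<..<T}"
    using at_within_open[of t "{0<..<T}"] t assms by simp
qed

lemma not_trivial_at_Ici:
  assumes "0 \<le> (t::real)"
  shows "at t within {0..} \<noteq> bot"
proof
  assume "at t within {0..} = bot"
  moreover have "at_right t \<le> at t within {0..}" by (rule at_le) (use assms in auto)
  ultimately show False using trivial_limit_at_right_real[of t] by (simp add: bot_unique)
qed

text \<open>The fundamental theorem is applied to the sum of c1 x and the convolution with K2. This
  sum is continuous up to 0 even if x is not, for then c1 = 0. Its value at 0 is how the initial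
  condition enters.\<close>

lemma integrated_volterra:
  assumes N1: "admissible m1 N1" and N2: "admissible m2 N2" and T: "0 < T" and t: "0 \<le> t" "t \<le> T"
    and sol: "classical_solution c1 c0 (laplace N1) (laplace N2) x0 y x"
    and y: "continuous_on {0..} y"
  shows "convolve one_fn (stopped T y) t + c1 * x0
    = c1 * x t - c0 * convolve one_fn (stopped T x) t - convolve one_fn (convolve (kern N1) (stopped T x)) t + convolve (kern N2) (stopped T x) t"
proof -
  define q where "q = \<bar>m1\<bar> + \<bar>m2\<bar> + 1"
  have q: "0 < q" unfolding q_def by linarith
  have xi: "set_integrable lborel {0..T} x" and xc: "c1 \<noteq> 0 \<Longrightarrow> continuous_on {0..} x \<and> x 0 = x0"
    and Kc: "continuous_on {0..} (conv (laplace N2) x)"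
    and eq: "\<And>t. 0 < t \<Longrightarrow> volterra_defined c1 (laplace N1) (laplace N2) x t \<and>
          y t = volterra c1 c0 (laplace N1) (laplace N2) x t"
    using sol T unfolding classical_solution_def by auto
  have yi: "set_integrable lborel {0..T} y"
    by (intro borel_integrable_atLeastAtMost' continuous_on_subset[OF y]) auto
  have cx: "causal q (stopped T x)" and cy: "causal q (stopped T y)"
    using causal_stopped[OF xi q T] causal_stopped[OF yi q T] .
  have k1: "causal q (kern N1)" and k2: "causal q (kern N2)"
    using causal_kern[OF N1] causal_kern[OF N2] by (auto simp: q_def)
  define F where "F = (\<lambda>u. c1 * x u + conv (laplace N2) x u)"
  define F' where "F' = (\<lambda>u. stopped T y u + (c0 * stopped T x u + convolve (kern N1) (stopped T x) u))"
  have F': "causal q F'"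
    unfolding F'_def by (intro causal_add causal_cmult causal_convolve cx cy k1)
  have "(F' has_integral F t - F 0) {0..t}"
  proof (rule fundamental_theorem_of_calculus_interior[OF t(1)])
    show "continuous_on {0..t} F"
    proof (cases "c1 = 0")
      case True
      then show ?thesis unfolding F_def by (simp add: continuous_on_subset[OF Kc])
    next
      case False
      then show ?thesis unfolding F_def
        using xc by (auto intro!: continuous_intros intro: continuous_on_subset[OF Kc] continuous_on_subset[of _ x])
    qed
    fix u assume u: "u \<in> {0<..<t}"
    then have u0: "0 < u" "0 \<le> u" "u \<le> T" using t by auto
    have at: "at u within {0..} = at u" by (rule at_within_Ici(3)[of u "u + 1"]) (use u0 in auto)
    have "(conv (laplace N2) x has_vector_derivative Dt (conv (laplace N2) x) u) (at u)"
      using eq[OF u0(1)] at unfolding volterra_defined_def by (simp add: vector_derivative_works)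
    moreover have "((\<lambda>u. c1 * x u) has_vector_derivative c1 * Dt x u) (at u)"
    proof (cases "c1 = 0")
      case False
      then have "(x has_vector_derivative Dt x u) (at u)"
        using eq[OF u0(1)] at unfolding volterra_defined_def by (simp add: vector_derivative_works)
      then show ?thesis by (rule has_vector_derivative_mult_right)
    qed simp
    ultimately have "(F has_vector_derivative c1 * Dt x u + Dt (conv (laplace N2) x) u) (at u)"
      unfolding F_def by (intro has_vector_derivative_add)
    moreover have "c1 * Dt x u + Dt (conv (laplace N2) x) u = F' u"
      using eq[OF u0(1)] unfolding volterra_def F'_def conv_eq_convolve[OF u0(2,3), of N1] by (simp add: stopped_eq u0)
    ultimately show "(F has_vector_derivative F' u) (at u)" by simp
  qed
  then have "convolve one_fn F' t = F t - F 0"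
    using convolve_one(2)[OF F' t(1)] by (simp add: integral_unique)
  moreover have "convolve one_fn F' t = convolve one_fn (stopped T y) t + (c0 * convolve one_fn (stopped T x) t + convolve one_fn (convolve (kern N1) (stopped T x)) t)"
    unfolding F'_def using t(1)
    by (simp add: convolve_one_add[of q] convolve_cmult causal_add causal_cmult causal_convolve cx cy k1)
  moreover have "F t = c1 * x t + convolve (kern N2) (stopped T x) t"
    unfolding F_def by (simp add: conv_eq_convolve t)
  moreover have "F 0 = c1 * x0"
  proof -
    have "conv (laplace N2) x 0 = 0"
      unfolding conv_def set_lebesgue_integral_def
    proof (rule integral_eq_zero_AE)
      show "AE u in lborel. indicator {0..0} u *\<^sub>R (laplace N2 (0 - u) * x u) = 0"
        using AE_lborel_singleton[of "0::real"] by eventually_elim simp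
    qed
    then show ?thesis unfolding F_def using xc by auto
  qed
  ultimately show ?thesis by linarith
qed

text \<open>The equation and its inverse on an equal footing, detached from where their data come
  from; \<open>N2\<close> and \<open>M2\<close> take the place of the weighted measures. One lower
  bound and one exponent serve all four kernels.\<close>

locale reciprocal =
  fixes c1 c0 z1 z0 m q :: real and N1 N2 M1 M2 :: "real measure"
  assumes N1: "admissible m N1" and N2: "admissible m N2" and M1: "admissible m M1" and M2: "admissible m M2"
    and q: "\<bar>m\<bar> + 1 \<le> q"
    and symbols: "\<And>p. q \<le> p \<Longrightarrow> symbol c1 c0 N1 N2 p * symbol z1 z0 M1 M2 p = - pi\<^sup>2"
    and cz: "c1 * z1 = 0"
begin

lemma q_pos: "0 < q" using q by linarith

lemma kern_facts:
  "causal q (kern N1)" "causal q (kern N2)" "causal q (kern M1)" "causal q (kern M2)"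
  "q \<le> p \<Longrightarrow> lap (kern N1) p = (LINT s|N1. 1 / (p + s))"
  "q \<le> p \<Longrightarrow> lap (kern N2) p = (LINT s|N2. 1 / (p + s))"
  "q \<le> p \<Longrightarrow> lap (kern M1) p = (LINT s|M1. 1 / (p + s))"
  "q \<le> p \<Longrightarrow> lap (kern M2) p = (LINT s|M2. 1 / (p + s))"
  using q by (auto intro: causal_kern[OF N1] causal_kern[OF N2] causal_kern[OF M1] causal_kern[OF M2]
    intro!: lap_kern[OF N1] lap_kern[OF N2] lap_kern[OF M1] lap_kern[OF M2])

text \<open>Its transform is the second symbol divided by p, less the constant z1, which would be
  the transform of a Dirac mass. Hence applying the second operator to f and integrating once
  amounts to \<open>z1 * f t + convolve B f t\<close>.\<close>

definition B :: "real \<Rightarrow> real" where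
  "B = (\<lambda>t. kern M2 t - (z0 * one_fn t + convolve one_fn (kern M1) t))"

lemma causal_B: "causal q B"
  unfolding B_def by (intro causal_diff causal_add causal_cmult causal_convolve causal_one q_pos kern_facts)

lemma lap_B: "q \<le> p \<Longrightarrow> lap B p = symbol z1 z0 M1 M2 p / p - z1"
  unfolding B_def using q_pos
  by (simp add: lap_diff[of q] lap_add[of q] lap_cmult lap_convolve[of q] lap_one causal_add causal_cmult causal_convolve
      causal_one kern_facts symbol_def field_simps)

section \<open>Inversion of the equation for a given solution\<close>

context
  fixes x y :: "real \<Rightarrow> real" and x0 :: real
  assumes y: "continuous_on {0..} y"
    and sol: "classical_solution c1 c0 (laplace N1) (laplace N2) x0 y x"
begin

lemma x_cont: "continuous_on {0<..} x"
  using sol by (simp add: classical_solution_def)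

lemma causal_x: "0 < T \<Longrightarrow> causal q (stopped T x)"
  using sol q_pos by (intro causal_stopped) (auto simp: classical_solution_def)

lemma causal_y: "0 < T \<Longrightarrow> causal q (stopped T y)"
  by (intro causal_stopped borel_integrable_atLeastAtMost' continuous_on_subset[OF y] q_pos) auto

text \<open>The solution formula integrated once. Stated without derivatives, it holds whatever
  singularities the admissible kernels have at the origin.\<close>

lemma resolved_volterra:
  assumes T: "0 < T" and t: "0 < t" "t < T"
  shows "z1 * y t + conv (laplace M2) y t = z0 * convolve one_fn (stopped T y) t + convolve one_fn (convolve (kern M1) (stopped T y)) t
     - c1 * x0 * B t - pi\<^sup>2 * convolve one_fn (stopped T x) t"
proof -
  let ?x = "stopped T x" and ?y = "stopped T y"
  note cx = causal_x[OF T] and cy = causal_y[OF T]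
  note C = causal_add causal_diff causal_cmult causal_convolve causal_one[OF q_pos] cx cy causal_B kern_facts(1-4)
  note L = lap_add[of q] lap_diff[of q] lap_cmult lap_convolve[of q] lap_one
  \<comment> \<open>\<open>H\<close> is the error of the integrated equation for the stopped
    functions, \<open>R\<close> that of the claim, and \<open>P\<close> arises from \<open>H\<close>
    by the second operator, integrated once. \<open>H\<close> vanishes up to T, hence so does
    \<open>P\<close>; comparison of transforms shows that \<open>P\<close> and the integral of
    \<open>R\<close> have the same antiderivative.\<close>
  define H where "H = (\<lambda>t. (convolve one_fn ?y t + c1 * x0 * one_fn t)
      - (c1 * ?x t + (convolve (kern N2) ?x t - (c0 * convolve one_fn ?x t + convolve one_fn (convolve (kern N1) ?x) t))))"
  define R where "R = (\<lambda>t. (z1 * ?y t + convolve (kern M2) ?y t + c1 * x0 * B t + pi\<^sup>2 * convolve one_fn ?x t)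
      - (z0 * convolve one_fn ?y t + convolve one_fn (convolve (kern M1) ?y) t))"
  define P where "P = (\<lambda>t. z1 * H t + convolve B H t)"
  have cH: "causal q H" unfolding H_def by (intro C)
  have cR: "causal q R" unfolding R_def by (intro C)
  have cP: "causal q P" unfolding P_def by (intro C cH)
  have H0: "H s = 0" if "s \<le> T" for s
  proof (cases "0 \<le> s")
    case True
    show ?thesis
      using integrated_volterra[OF N1 N2 T True that sol y] True that by (simp add: H_def stopped_eq)
  next
    case False
    then show ?thesis using causalD(1)[OF cH, of s] by simp
  qed
  have zero: "causal q (\<lambda>_. 0)" by (simp add: causal_def)
  have P0: "P s = 0" if "s \<le> T" for s
  proof -
    have "convolve B H s = convolve B (\<lambda>_. 0) s"
      by (rule convolve_cong_upto[OF causal_B cH zero]) (use H0 that in auto)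
    then show ?thesis unfolding P_def using H0[OF that] by (simp add: convolve_def)
  qed
  have "convolve one_fn P s = convolve one_fn (convolve one_fn R) s" if "0 \<le> s" for s
  proof (rule lap_inject[OF cP causal_convolve[OF causal_one[OF q_pos] cR] q_pos _ that])
    fix p assume p: "q \<le> p"
    then have p0: "0 < p" using q_pos by linarith
    define S where "S = symbol c1 c0 N1 N2 p"
    define Z where "Z = symbol z1 z0 M1 M2 p"
    have SZ: "S * Z = - pi\<^sup>2" unfolding S_def Z_def by (rule symbols[OF p])
    have lH: "lap H p = (lap ?y p + c1 * x0 - S * lap ?x p) / p"
      unfolding H_def S_def symbol_def using p p0
      by (simp add: L C kern_facts(5-8)) (simp add: field_simps)
    have lB: "lap B p = Z / p - z1" unfolding Z_def by (rule lap_B[OF p])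
    have M: "lap (kern M2) p = lap B p + z0 / p + lap (kern M1) p / p"
      unfolding B_def using p p0 by (simp add: L C)
    have lR: "lap R p = (Z * lap ?y p + c1 * x0 * Z + pi\<^sup>2 * lap ?x p) / p"
    proof -
      have "lap R p = z1 * lap ?y p + lap (kern M2) p * lap ?y p + c1 * x0 * lap B p + pi\<^sup>2 * (lap ?x p / p)
        - (z0 * (lap ?y p / p) + lap (kern M1) p * lap ?y p / p)"
        unfolding R_def using p p0 by (simp add: L C)
      also have "\<dots> = z1 * lap ?y p + lap B p * lap ?y p + c1 * x0 * lap B p + pi\<^sup>2 * lap ?x p / p"
        unfolding M using p0 by (simp add: field_simps)
      \<comment> \<open>The constant left over would be the transform of a Dirac mass at 0; it
        disappears because c1 z1 = 0.\<close>
      also have "\<dots> = (Z * lap ?y p + c1 * x0 * Z + pi\<^sup>2 * lap ?x p) / p - (c1 * z1) * x0"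
        unfolding lB using p0 by (simp add: field_simps)
      finally show ?thesis using cz by simp
    qed
    have "lap P p = (z1 + lap B p) * lap H p"
      unfolding P_def using p by (simp add: L C cH distrib_right)
    also have "\<dots> = Z / p * ((lap ?y p + c1 * x0 - S * lap ?x p) / p)" unfolding lB lH by simp
    also have "\<dots> = (Z * lap ?y p + c1 * x0 * Z - (S * Z) * lap ?x p) / p / p"
      using p0 by (simp add: field_simps)
    also have "\<dots> = lap (convolve one_fn R) p"
      unfolding SZ using p p0 by (simp add: L C cR lR)
    finally show "lap P p = lap (convolve one_fn R) p" .
  qed
  moreover have "convolve one_fn P s = 0" if "0 \<le> s" "s \<le> T" for s
  proof -
    have "convolve one_fn P s = convolve one_fn (\<lambda>_. 0) s"
      by (rule convolve_cong_upto[OF causal_one[OF q_pos] cP zero]) (use P0 that in auto)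
    then show ?thesis by (simp add: convolve_def)
  qed
  ultimately have zz: "convolve one_fn (convolve one_fn R) s = 0" if "0 < s" "s < T" for s
    using that by (metis less_imp_le)
  have cont1: "continuous_on {0<..<T} (convolve one_fn f)" if "causal q f" for f
    by (rule continuous_on_subset[OF continuous_convolve_one[OF that]]) auto
  have yc: "continuous_on {0<..<T} ?y"
    by (rule continuous_on_subset[OF continuous_on_stopped_closed[OF y T]]) auto
  have jyc: "continuous_on {0<..<T} (convolve (kern M2) ?y)"
    using isCont_convolve_piecewise[OF kern_facts(4) cy order_refl continuous_on_stopped_closed[OF y T]] causalD(1)[OF cy]
    by (auto intro: continuous_at_imp_continuous_on)
  have Bc: "continuous_on {0<..<T} B"
  proof -
    have "continuous_on {0<..<T} (\<lambda>t. kern M2 t - (z0 * 1 + convolve one_fn (kern M1) t))"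
      by (intro continuous_intros cont1 kern_facts continuous_on_subset[OF continuous_on_kern[OF M2]]) auto
    then show ?thesis by (rule continuous_on_eq) (auto simp: B_def)
  qed
  have "R t = 0"
  proof (rule convolve_one_convolve_one_eq_0D[OF cR q_pos zz _ t])
    show "continuous_on {0<..<T} R"
      unfolding R_def by (intro continuous_intros cont1 yc jyc Bc C)
  qed
  then show ?thesis using t unfolding R_def by (simp add: stopped_eq conv_eq_convolve[of t T])
qed

lemma conv_J_integrable:
  assumes M: "admissible m M" and t: "0 \<le> t"
  shows "set_integrable lborel {0..t} (\<lambda>\<tau>. laplace M (t - \<tau>) * y \<tau>)"
proof -
  have T: "0 < t + 1" using t by simp
  have k: "causal q (kern M)" by (rule causal_kern[OF M q])
  note cy = causal_y[OF T]
  have "integrable lborel (\<lambda>\<tau>. kern M (t - \<tau>) * stopped (t + 1) y \<tau>)"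
    by (rule causal_cut_integrable[OF k cy order_refl continuous_on_stopped_closed[OF y T]]) (simp add: causalD(1)[OF cy])
  moreover have "(\<lambda>\<tau>. kern M (t - \<tau>) * stopped (t + 1) y \<tau>) = (\<lambda>\<tau>. indicator {0..t} \<tau> *\<^sub>R (laplace M (t - \<tau>) * y \<tau>))"
    by (auto simp: kern_def stopped_def indicator_def)
  ultimately show ?thesis unfolding set_integrable_def by simp
qed

text \<open>Obtained by differentiating the integrated formula. The origin is included when c1 is
  nonzero, the case in which z1 = 0 and x and both kernels are continuous there.\<close>

lemma solution_formula:
  assumes t: "0 \<le> t" "0 < t \<or> c1 \<noteq> 0"
    and J1: "c1 \<noteq> 0 \<Longrightarrow> continuous_on {0..} (laplace M1)"
    and J2: "c1 \<noteq> 0 \<Longrightarrow> continuous_on {0..} (laplace M2)"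
    and J2': "c1 \<noteq> 0 \<Longrightarrow> laplace M2 differentiable (at t within {0..})"
    and yd: "z1 \<noteq> 0 \<Longrightarrow> y differentiable (at t within {0..})"
  shows "volterra_defined z1 (laplace M1) (laplace M2) y t"
    "- (pi\<^sup>2) * x t = volterra z1 z0 (laplace M1) (laplace M2) y t
       - c1 * x0 * (laplace M1 t - Dt (laplace M2) t)"
proof -
  define T where "T = t + 1"
  have T: "0 < T" "t < T" using t by (auto simp: T_def)
  let ?x = "stopped T x" and ?y = "stopped T y"
  note cx = causal_x[OF T(1)] and cy = causal_y[OF T(1)]
  define V where "V = (\<lambda>s. z0 * convolve one_fn ?y s + convolve one_fn (convolve (kern M1) ?y) s
     - c1 * x0 * B s - pi\<^sup>2 * convolve one_fn ?x s - z1 * y s)"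
  \<comment> \<open>The part of the half-line around t on which the integrated formula will be
    available; the point 0 belongs to it only if c1 is nonzero.\<close>
  define S where "S = (if c1 = 0 then {0<..<T} else {0..<T})"
  have tS: "t \<in> S" using t T by (auto simp: S_def)
  have atS: "at t within {0..} = at t within S"
    using at_within_Ici[of t T] t T by (auto simp: S_def)
  have ycont: "continuous_on {0..T} ?y" by (rule continuous_on_subset[OF continuous_on_stopped_closed[OF y T(1)]]) auto
  have jyc: "isCont (convolve (kern M1) ?y) s" for s
    using isCont_convolve_piecewise[OF kern_facts(3) cy order_refl continuous_on_stopped_closed[OF y T(1)]] causalD(1)[OF cy] by auto
  have jyc2: "isCont (convolve (kern M2) ?y) s" for s
    using isCont_convolve_piecewise[OF kern_facts(4) cy order_refl continuous_on_stopped_closed[OF y T(1)]] causalD(1)[OF cy] by auto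
  have z1c1: "z1 = 0" if "c1 \<noteq> 0" using cz that by simp
  have xc: "continuous_on {0..} x" if "c1 \<noteq> 0" using sol that by (simp add: classical_solution_def)
  have d1: "(convolve one_fn ?y has_vector_derivative y t) (at t within S)"
    using convolve_one_has_derivative_cont[OF cy t(1) T(2) ycont] t(1) T(2) by (simp add: stopped_eq atS)
  have d2: "(convolve one_fn (convolve (kern M1) ?y) has_vector_derivative conv (laplace M1) y t) (at t within S)"
  proof -
    have "continuous_on {0..T} (convolve (kern M1) ?y)" using jyc by (auto intro: continuous_at_imp_continuous_on)
    from convolve_one_has_derivative_cont[OF causal_convolve[OF kern_facts(3) cy] t(1) T(2) this]
    show ?thesis using t(1) T(2) by (simp add: atS conv_eq_convolve[of t T])
  qed
  have d3: "(convolve one_fn ?x has_vector_derivative x t) (at t within S)"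
  proof (cases "c1 = 0")
    case True
    then have t0: "0 < t" using t by auto
    have "isCont ?x t"
      using continuous_on_stopped[OF x_cont T(1)] t0 by (simp add: continuous_on_eq_continuous_at)
    from convolve_one_has_derivative[OF cx t0 this] show ?thesis using t(1) T(2) by (simp add: stopped_eq atS)
  next
    case False
    have "continuous_on {0..T} ?x"
      by (rule continuous_on_subset[OF continuous_on_stopped_closed[OF xc[OF False] T(1)]]) auto
    from convolve_one_has_derivative_cont[OF cx t(1) T(2) this] show ?thesis
      using t(1) T(2) by (simp add: stopped_eq atS)
  qed
  have B_eq: "B s = laplace M2 s - (z0 + convolve one_fn (kern M1) s)" if "0 \<le> s" for s
    using that by (simp add: B_def kern_def)
  \<comment> \<open>\<open>B\<close> contains the kernel J2 itself and not just its integral, so it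
    is differentiated only if c1 is nonzero, when the regularity of J2 is at hand.\<close>
  have d4: "((\<lambda>s. c1 * x0 * B s) has_vector_derivative c1 * x0 * (Dt (laplace M2) t - laplace M1 t)) (at t within S)"
  proof (cases "c1 = 0")
    case False
    have "continuous_on {0..T} (kern M1)"
      by (rule continuous_on_eq[OF continuous_on_subset[OF J1[OF False]]]) (auto simp: kern_def)
    from convolve_one_has_derivative_cont[OF kern_facts(3) t(1) T(2) this]
    have k: "(convolve one_fn (kern M1) has_vector_derivative laplace M1 t) (at t within S)"
      using t(1) by (simp add: atS kern_def)
    have "(laplace M2 has_vector_derivative Dt (laplace M2) t) (at t within S)"
      using J2'[OF False] unfolding atS by (simp add: vector_derivative_works)
    then have "((\<lambda>s. laplace M2 s - (z0 + convolve one_fn (kern M1) s)) has_vector_derivative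
        Dt (laplace M2) t - (0 + laplace M1 t)) (at t within S)"
      by (intro has_vector_derivative_diff has_vector_derivative_add k) auto
    then have "(B has_vector_derivative Dt (laplace M2) t - (0 + laplace M1 t)) (at t within S)"
      by (rule has_vector_derivative_transform[OF tS, rotated]) (auto simp: S_def B_eq split: if_splits)
    from has_vector_derivative_mult_right[OF this, of "c1 * x0"] show ?thesis by simp
  qed simp
  have d5: "((\<lambda>s. z1 * y s) has_vector_derivative z1 * Dt y t) (at t within S)"
  proof (cases "z1 = 0")
    case False
    then have "(y has_vector_derivative Dt y t) (at t within S)"
      using yd unfolding atS by (simp add: vector_derivative_works)
    then show ?thesis by (rule has_vector_derivative_mult_right)
  qed simp
  let ?D = "z0 * y t + conv (laplace M1) y t - c1 * x0 * (Dt (laplace M2) t - laplace M1 t) - pi\<^sup>2 * x t - z1 * Dt y t"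
  have dV: "(V has_vector_derivative ?D) (at t within S)"
    unfolding V_def
    by (intro has_vector_derivative_diff has_vector_derivative_add d1 d2 d3 d4 d5 has_vector_derivative_mult_right)
  have pos: "conv (laplace M2) y s = V s" if "0 < s" "s < T" for s
    using resolved_volterra[OF T(1) that] unfolding V_def by simp
  \<comment> \<open>The integrated formula speaks of s > 0. At s = 0 it follows in the limit, both
    sides being continuous from the right there.\<close>
  have "conv (laplace M2) y s = V s" if s: "s \<in> S" for s
  proof (cases "0 < s")
    case True
    then show ?thesis using s by (intro pos) (auto simp: S_def split: if_splits)
  next
    case False
    then have s0: "s = 0" and c1: "c1 \<noteq> 0" using s by (auto simp: S_def split: if_splits)
    have Vc: "continuous_on {0..<T} V"
    proof -
      have o: "continuous_on {0..<T} (convolve one_fn f)" if "causal q f" for f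
        by (rule continuous_on_subset[OF continuous_convolve_one[OF that]]) auto
      have "continuous_on {0..<T} (\<lambda>s. laplace M2 s - (z0 + convolve one_fn (kern M1) s))"
        by (intro continuous_intros o kern_facts continuous_on_subset[OF J2[OF c1]]) auto
      then have "continuous_on {0..<T} B" by (rule continuous_on_eq) (auto simp: B_eq)
      then show ?thesis unfolding V_def
        by (intro continuous_intros o causal_convolve kern_facts cx cy continuous_on_subset[OF y]) auto
    qed
    have "continuous_on {0..<T} (convolve (kern M2) ?y)"
      using jyc2 by (auto intro: continuous_at_imp_continuous_on)
    then have D: "continuous_on {0..<T} (\<lambda>s. convolve (kern M2) ?y s - V s)" by (intro continuous_intros Vc)
    have "((\<lambda>s. convolve (kern M2) ?y s - V s) \<longlongrightarrow> convolve (kern M2) ?y 0 - V 0) (at 0 within {0..<T})"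
      using D T(1) by (simp add: continuous_on_def)
    then have lim: "((\<lambda>s. convolve (kern M2) ?y s - V s) \<longlongrightarrow> convolve (kern M2) ?y 0 - V 0) (at_right 0)"
    proof (rule tendsto_mono[rotated])
      have "at_right 0 \<le> at (0::real) within {0..}" by (rule at_le) auto
      then show "at_right 0 \<le> at (0::real) within {0..<T}" using at_within_Ici(1)[of 0 T] T(1) by simp
    qed
    have "\<forall>\<^sub>F s in at_right 0. convolve (kern M2) ?y s - V s = 0"
      using eventually_at_right_real[OF T(1)] by eventually_elim (simp add: pos flip: conv_eq_convolve)
    then have "((\<lambda>s. convolve (kern M2) ?y s - V s) \<longlongrightarrow> 0) (at_right 0)"
      by (rule tendsto_eventually)
    then have "convolve (kern M2) ?y 0 - V 0 = 0"
      by (rule tendsto_unique[OF trivial_limit_at_right_real lim])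
    then show ?thesis using s0 T(1) by (simp add: conv_eq_convolve[of 0 T])
  qed
  then have "(conv (laplace M2) y has_vector_derivative ?D) (at t within S)"
    by (rule has_vector_derivative_transform[OF tS _ dV])
  then have dJ: "(conv (laplace M2) y has_vector_derivative ?D) (at t within {0..})"
    by (simp only: atS)
  then have diff: "conv (laplace M2) y differentiable (at t within {0..})"
    by (auto simp: has_vector_derivative_def differentiable_def)
  show "volterra_defined z1 (laplace M1) (laplace M2) y t"
    unfolding volterra_defined_def using yd diff conv_J_integrable[OF M1 t(1)] conv_J_integrable[OF M2 t(1)] by simp
  have "Dt (conv (laplace M2) y) t = ?D"
    by (rule vector_derivative_within[OF not_trivial_at_Ici[OF t(1)] dJ])
  then show "- (pi\<^sup>2) * x t = volterra z1 z0 (laplace M1) (laplace M2) y t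
       - c1 * x0 * (laplace M1 t - Dt (laplace M2) t)"
    unfolding volterra_def by (simp add: algebra_simps)
qed

end

end

section \<open>Regularity gained from finite measures\<close>

lemma laplace_inv_weighted_derivative:
  assumes M: "M \<in> M_frac" and fin: "finite_measure M" and t: "0 \<le> t"
  shows "continuous_on {0..} (laplace M)" "continuous_on {0..} (laplace (inv_weighted M))"
    "(laplace (inv_weighted M) has_vector_derivative - laplace M t) (at t within {0..})"
proof -
  let ?N = "inv_weighted M"
  note a = finite_inv_weighted(1)[OF M fin] and N = admissible_inv_weighted[OF M]
  interpret N: finite_measure ?N by (rule finite_inv_weighted(2)[OF M fin])
  interpret M: finite_measure M by (rule fin)
  show cM: "continuous_on {0..} (laplace M)"
    by (rule continuous_on_laplace) (use a in \<open>auto simp: admissible_def\<close>)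
  show cN: "continuous_on {0..} (laplace ?N)"
    by (rule continuous_on_laplace) (use N in \<open>auto simp: admissible_def\<close>)
  have sN: "space ?N = UNIV" using N sets_eq_imp_space_eq[of ?N borel] by (simp add: admissible_def)
  define k where "k = measure ?N UNIV"
  have kM: "causal 1 (kern M)" and kN: "causal 1 (kern ?N)"
    using causal_kern[OF a] causal_kern[OF N] by auto
  \<comment> \<open>Instead of differentiating under the integral, p/(p + s) = 1 - s/(p + s) is read
    as an identity of Laplace transforms: the kernel of the weighted measure is a constant minus the
    integral of the kernel of M.\<close>
  define D where "D = (\<lambda>t. kern ?N t - (k * one_fn t - convolve one_fn (kern M) t))"
  have cD: "causal 1 D"
    unfolding D_def by (intro causal_diff causal_cmult causal_one causal_convolve kM kN) auto
  have lD: "lap D p = 0" if p: "1 \<le> p" for p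
    unfolding D_def using p finite_inv_weighted(3)[OF M fin p] lap_kern[OF a, of p] lap_kern[OF N, of p]
    by (simp add: lap_diff[of 1] lap_cmult lap_convolve[of 1] lap_one causal_diff causal_cmult causal_convolve causal_one kM kN)
      (simp add: k_def field_simps)
  have zero: "convolve one_fn D s = 0" if "0 \<le> s" for s
    using lap_eq_0_imp_convolve_one_eq_0[OF cD _ lD that] by simp
  have eq: "laplace ?N s = k - convolve one_fn (kern M) s" if s: "0 \<le> s" for s
  proof (cases "s = 0")
    case True
    then show ?thesis
      using convolve_one(2)[OF kM, of 0] sN by (simp add: laplace_def k_def)
  next
    case False
    have "D s = 0"
    proof (rule convolve_one_eq_0D[OF cD, of "s + 1"])
      have "continuous_on {0<..<s+1} (\<lambda>t. kern ?N t - (k * 1 - convolve one_fn (kern M) t))"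
        by (intro continuous_intros continuous_on_subset[OF continuous_on_kern[OF N]]
            continuous_on_subset[OF continuous_convolve_one[OF kM]]) auto
      then show "continuous_on {0<..<s+1} D"
        by (rule continuous_on_eq) (auto simp: D_def)
    qed (use zero s False in auto)
    then show ?thesis using s by (simp add: D_def kern_def)
  qed
  have "continuous_on {0..t+1} (kern M)"
    by (rule continuous_on_eq[OF continuous_on_subset[OF cM]]) (auto simp: kern_def)
  from convolve_one_has_derivative_cont[OF kM t _ this]
  have "(convolve one_fn (kern M) has_vector_derivative laplace M t) (at t within {0..})"
    using t by (simp add: kern_def)
  then have "((\<lambda>s. k - convolve one_fn (kern M) s) has_vector_derivative 0 - laplace M t) (at t within {0..})"
    by (intro has_vector_derivative_diff) auto
  then show "(laplace ?N has_vector_derivative - laplace M t) (at t within {0..})"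
    using t eq by (intro has_vector_derivative_transform[of t "{0..}" "laplace ?N"]) auto
qed

text \<open>The measure s dM(s) is signed; its positive and negative parts are admissible because
  |s|/(1 + |s|) <= 1. The difference of their kernels is minus the derivative of the kernel of M,
  and p/(p + s) = 1 - s/(p + s) states this for transforms.\<close>

lemma resolvent_finite_measure:
  assumes fin: "finite_measure M" and M: "sets M = sets borel" "AE s in M. m \<le> s"
  obtains Mp Mm where "admissible m Mp" "admissible m Mm"
    "\<And>p. \<bar>m\<bar> + 1 \<le> p \<Longrightarrow> p * (LINT s|M. 1 / (p + s))
      = measure M UNIV - ((LINT s|Mp. 1 / (p + s)) - (LINT s|Mm. 1 / (p + s)))"
proof -
  interpret finite_measure M by fact
  have adm: "admissible m (density M (\<lambda>s. ennreal (f s)))"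
    if f: "f \<in> borel_measurable borel" "\<And>s. 0 \<le> f s" "\<And>s. f s \<le> \<bar>s\<bar>" for f
    unfolding admissible_def
  proof (intro conjI)
    have fM: "f \<in> borel_measurable M" using f(1) by (simp add: borel_measurable_sets_borel[OF M(1)])
    show "sets (density M (\<lambda>s. ennreal (f s))) = sets borel" using M by simp
    show "AE s in density M (\<lambda>s. ennreal (f s)). m \<le> s"
    proof (subst AE_density)
      show "AE s in M. 0 < ennreal (f s) \<longrightarrow> m \<le> s" using M(2) by eventually_elim simp
    qed (use fM in measurable)
    show "integrable (density M (\<lambda>s. ennreal (f s))) (\<lambda>s. 1 / (1 + \<bar>s\<bar>))"
    proof (subst integrable_density)
      show "integrable M (\<lambda>s. f s *\<^sub>R (1 / (1 + \<bar>s\<bar>)))"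
      proof (rule integrable_const_bound[where B = 1])
        show "AE s in M. norm (f s *\<^sub>R (1 / (1 + \<bar>s\<bar>))) \<le> 1"
        proof (rule AE_I2)
          fix s show "norm (f s *\<^sub>R (1 / (1 + \<bar>s\<bar>))) \<le> 1"
            using f(2)[of s] f(3)[of s] by (simp add: abs_mult)
        qed
      qed (use fM in \<open>simp add: borel_measurable_sets_borel[OF M(1)]\<close>)
    qed (use f fM in \<open>auto simp: borel_measurable_sets_borel[OF M(1)]\<close>)
  qed
  have int: "(LINT s|density M (\<lambda>s. ennreal (f s)). 1 / (p + s)) = (LINT s|M. f s * (1 / (p + s)))"
    if f: "f \<in> borel_measurable borel" "\<And>s. 0 \<le> f s" for f p
    by (subst integral_density) (use f in \<open>auto simp: borel_measurable_sets_borel[OF M(1)]\<close>)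
  have ii: "integrable M (\<lambda>s. f s * (1 / (p + s)))"
    if f: "f \<in> borel_measurable borel" "\<And>s. 0 \<le> f s" "\<And>s. f s \<le> \<bar>s\<bar>" and p: "\<bar>m\<bar> + 1 \<le> p" for f p
  proof -
    have fM: "f \<in> borel_measurable M" using f(1) by (simp add: borel_measurable_sets_borel[OF M(1)])
    have "integrable M (\<lambda>s. f s *\<^sub>R (1 / (p + s)))"
      using admissible_integrable_resolvent[OF adm[OF f] p]
      by (subst (asm) integrable_density) (use f fM in \<open>auto simp: borel_measurable_sets_borel[OF M(1)]\<close>)
    then show ?thesis by simp
  qed
  let ?p = "\<lambda>s::real. max 0 s" and ?m = "\<lambda>s::real. max 0 (- s)"
  show thesis
  proof (rule that[of "density M (\<lambda>s. ennreal (?p s))" "density M (\<lambda>s. ennreal (?m s))"])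
    show "admissible m (density M (\<lambda>s. ennreal (?p s)))" "admissible m (density M (\<lambda>s. ennreal (?m s)))"
      by (rule adm; auto)+
    fix p assume p: "\<bar>m\<bar> + 1 \<le> p"
    have i: "integrable M (\<lambda>s. ?p s * (1 / (p + s)))" "integrable M (\<lambda>s. ?m s * (1 / (p + s)))"
      by (rule ii[OF _ _ _ p]; auto)+
    have iR: "integrable M (\<lambda>s. p * (1 / (p + s)))"
      by (intro integrable_mult_right admissible_integrable_resolvent[OF admissible_finite_measure[OF fin M] p])
    have "(LINT s|density M (\<lambda>s. ennreal (?p s)). 1 / (p + s)) - (LINT s|density M (\<lambda>s. ennreal (?m s)). 1 / (p + s))
      = (LINT s|M. ?p s * (1 / (p + s)) - ?m s * (1 / (p + s)))"
      unfolding Bochner_Integration.integral_diff[OF i] by (subst (1 2) int) auto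
    also have "\<dots> = (LINT s|M. 1 - p * (1 / (p + s)))"
    proof (rule integral_cong_AE)
      show "AE s in M. ?p s * (1 / (p + s)) - ?m s * (1 / (p + s)) = 1 - p * (1 / (p + s))"
        using M(2)
      proof eventually_elim
        fix s assume "m \<le> s"
        then have ps: "p + s \<noteq> 0" using p by linarith
        have "?p s - ?m s = s" by simp
        then have "?p s * (1 / (p + s)) - ?m s * (1 / (p + s)) = s * (1 / (p + s))"
          by (metis left_diff_distrib)
        also have "\<dots> = 1 - p * (1 / (p + s))" using ps by (simp add: field_simps)
        finally show "?p s * (1 / (p + s)) - ?m s * (1 / (p + s)) = 1 - p * (1 / (p + s))" .
      qed
    qed (simp_all add: borel_measurable_sets_borel[OF M(1)])
    also have "\<dots> = measure M UNIV - p * (LINT s|M. 1 / (p + s))"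
    proof -
      have "(LINT s|M. 1 - p * (1 / (p + s))) = (LINT s|M. 1) - (LINT s|M. p * (1 / (p + s)))"
        by (rule Bochner_Integration.integral_diff) (use iR in auto)
      then show ?thesis unfolding integral_mult_right_zero using sets_eq_imp_space_eq[OF M(1)] by simp
    qed
    finally show "p * (LINT s|M. 1 / (p + s)) = measure M UNIV -
      ((LINT s|density M (\<lambda>s. ennreal (?p s)). 1 / (p + s)) - (LINT s|density M (\<lambda>s. ennreal (?m s)). 1 / (p + s)))"
      by simp
  qed
qed

text \<open>With K = \<open>laplace L\<close> the symbol says that y is minus the convolution of K
  and x. Here K(0) = \<open>measure L UNIV\<close> is finite, while K' may be singular at 0.
  Formally y' is -K(0) x minus the convolution of K' and x; \<open>W\<close> is the antiderivative
  of this expression.\<close>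

lemma output_differentiable:
  assumes N1: "admissible m N1" and N2: "admissible m N2" and L: "sets L = sets borel" "AE s in L. m \<le> s" "finite_measure L"
    and sym: "\<forall>\<^sub>F p in at_top. symbol 0 c0 N1 N2 p = - (LINT s|L. 1 / (p + s))"
    and sol: "classical_solution 0 c0 (laplace N1) (laplace N2) x0 y x" and y: "continuous_on {0..} y"
    and t: "0 < t"
  shows "y differentiable (at t within {0..})"
proof -
  obtain Lp Lm where Lpm: "admissible m Lp" "admissible m Lm"
    and R: "\<And>p. \<bar>m\<bar> + 1 \<le> p \<Longrightarrow> p * (LINT s|L. 1 / (p + s))
      = measure L UNIV - ((LINT s|Lp. 1 / (p + s)) - (LINT s|Lm. 1 / (p + s)))"
    by (rule resolvent_finite_measure[OF L(3,1,2)]) blast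
  obtain q1 where q1: "\<And>p. q1 \<le> p \<Longrightarrow> symbol 0 c0 N1 N2 p = - (LINT s|L. 1 / (p + s))"
    using sym unfolding eventually_at_top_linorder by blast
  define q where "q = max q1 (\<bar>m\<bar> + 1)"
  have q: "\<bar>m\<bar> + 1 \<le> q" "q1 \<le> q" "0 < q" unfolding q_def by linarith+
  define T where "T = t + 1"
  have T: "0 < T" "t < T" using t by (auto simp: T_def)
  let ?x = "stopped T x" and ?y = "stopped T y"
  have xc: "continuous_on {0<..} x" and xi: "set_integrable lborel {0..T} x"
    using sol T unfolding classical_solution_def by auto
  have cx: "causal q ?x" by (rule causal_stopped[OF xi q(3) T(1)])
  have cy: "causal q ?y"
    by (intro causal_stopped borel_integrable_atLeastAtMost' continuous_on_subset[OF y] q T) auto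
  note K = causal_kern[OF N1 q(1)] causal_kern[OF N2 q(1)] causal_kern[OF Lpm(1) q(1)] causal_kern[OF Lpm(2) q(1)]
  note C = causal_add causal_diff causal_cmult causal_convolve causal_one[OF q(3)] cx cy K
  note Lap = lap_add[of q] lap_diff[of q] lap_cmult lap_convolve[of q] lap_one
  define k where "k = measure L UNIV"
  define W where "W = (\<lambda>t. convolve one_fn (convolve (kern Lp) ?x) t - (convolve one_fn (convolve (kern Lm) ?x) t + k * convolve one_fn ?x t))"
  \<comment> \<open>\<open>D\<close> is the error of the claim y = W, and \<open>E\<close> that of
    the integrated equation. \<open>E\<close> vanishes before T and has the same transform as the
    integral of \<open>D\<close>.\<close>
  define D where "D = (\<lambda>t. ?y t - W t)"
  define E where "E = (\<lambda>t. convolve one_fn ?y t - (convolve (kern N2) ?x t - (c0 * convolve one_fn ?x t + convolve one_fn (convolve (kern N1) ?x) t)))"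
  have cW: "causal q W" unfolding W_def by (intro C)
  have cD: "causal q D" unfolding D_def by (intro C cW)
  have cE: "causal q E" unfolding E_def by (intro C)
  have zero: "causal q (\<lambda>_. 0)" by (simp add: causal_def)
  have E0: "convolve one_fn E s = 0" if s: "s < T" for s
  proof -
    have "convolve one_fn E s = convolve one_fn (\<lambda>_. 0) s"
    proof (rule convolve_cong_upto[OF C(5) cE zero])
      fix u assume "0 \<le> u" "u \<le> s"
      then show "E u = 0"
        using integrated_volterra[OF N1 N2 T(1) _ _ sol y, of u] s by (simp add: E_def)
    qed
    then show ?thesis by (simp add: convolve_def)
  qed
  have ED: "convolve one_fn E s = convolve one_fn (convolve one_fn D) s" if "0 \<le> s" for s
  proof (rule lap_inject[OF cE causal_convolve[OF C(5) cD] q(3) _ that])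
    fix p assume p: "q \<le> p"
    then have p': "\<bar>m\<bar> + 1 \<le> p" "q1 \<le> p" "0 < p" using q by linarith+
    note lk = lap_kern[OF N1 p'(1)] lap_kern[OF N2 p'(1)] lap_kern[OF Lpm(1) p'(1)] lap_kern[OF Lpm(2) p'(1)]
    define r where "r = (LINT s|L. 1 / (p + s))"
    have lE: "lap E p = (lap ?y p - symbol 0 c0 N1 N2 p * lap ?x p) / p"
      unfolding E_def symbol_def using p p'(3) by (simp add: Lap C lk) (simp add: field_simps)
    have Rp: "(LINT s|Lp. 1 / (p + s)) = k - p * r + (LINT s|Lm. 1 / (p + s))"
      using R[OF p'(1)] unfolding k_def r_def by linarith
    have "lap W p = lap (kern Lp) p * lap ?x p / p - (lap (kern Lm) p * lap ?x p / p + k * (lap ?x p / p))"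
      unfolding W_def using p p'(3) by (simp add: Lap C)
    also have "\<dots> = - r * lap ?x p"
      unfolding lk Rp using p'(3) by (simp add: field_simps)
    finally have lW: "lap W p = - r * lap ?x p" .
    have "lap (convolve one_fn D) p = (lap ?y p - lap W p) / p"
      unfolding D_def using p p'(3) by (simp add: Lap C cW)
    then show "lap E p = lap (convolve one_fn D) p"
      unfolding lE lW q1[OF p'(2)] r_def by simp
  qed
  have cont1: "continuous_on {0<..<T} (convolve one_fn f)" if "causal q f" for f
    by (rule continuous_on_subset[OF continuous_convolve_one[OF that]]) auto
  have D0: "D s = 0" if s: "0 < s" "s < T" for s
  proof (rule convolve_one_convolve_one_eq_0D[OF cD q(3) _ _ s])
    show "convolve one_fn (convolve one_fn D) u = 0" if "0 < u" "u < T" for u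
      using E0[OF that(2)] ED[of u] that(1) by simp
    show "continuous_on {0<..<T} D"
      unfolding D_def W_def
      by (intro continuous_intros cont1 C continuous_on_subset[OF continuous_on_stopped_closed[OF y T(1)]]) auto
  qed
  have at: "at t within {0..} = at t within {0<..<T}" using at_within_Ici(2)[of t T] t T by simp
  have xcont: "isCont ?x t"
    using continuous_on_stopped[OF xc T(1)] t by (simp add: continuous_on_eq_continuous_at)
  \<comment> \<open>Here the kernel and x may both be unbounded at the origin, so the continuity
    result for two singular factors is needed.\<close>
  have kc: "isCont (convolve (kern N) ?x) t" if "admissible m N" for N
    by (rule isCont_convolve[OF causal_kern[OF that q(1)] cx continuous_on_kern[OF that] continuous_on_stopped[OF xc T(1)] t])
  have "(W has_vector_derivative convolve (kern Lp) ?x t - (convolve (kern Lm) ?x t + k * ?x t)) (at t within {0..})"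
    unfolding W_def
    by (intro has_vector_derivative_diff has_vector_derivative_add has_vector_derivative_mult_right
        convolve_one_has_derivative[where q = q] C t xcont kc Lpm)
  then have "(y has_vector_derivative convolve (kern Lp) ?x t - (convolve (kern Lm) ?x t + k * ?x t)) (at t within {0..})"
    unfolding at
  proof (rule has_vector_derivative_transform[rotated 2])
    fix s assume "s \<in> {0<..<T}"
    then show "y s = W s" using D0[of s] by (simp add: D_def stopped_eq)
  qed (use t T in auto)
  then show ?thesis by (auto simp: has_vector_derivative_def differentiable_def)
qed

text \<open>A point is a null set, so the value at 0 affects no integral. For c1 = 0 the solution
  formula need not give that value any meaning.\<close>

lemma conv_discrete_difference:
  assumes "\<And>t. 0 < t \<Longrightarrow> x t = x' t"
  shows "set_integrable lborel {0..t} (\<lambda>\<tau>. K (t - \<tau>) * x \<tau>) \<longleftrightarrow> set_integrable lborel {0..t} (\<lambda>\<tau>. K (t - \<tau>) * x' \<tau>)"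
    "set_integrable lborel {0..t} x \<longleftrightarrow> set_integrable lborel {0..t} x'"
    "conv K x t = conv K x' t"
proof -
  have eq: "indicator {0..t} \<tau> *\<^sub>R (f \<tau> * x \<tau>) = indicator {0..t} \<tau> *\<^sub>R (f \<tau> * x' \<tau>)" if "\<tau> \<notin> {0}"
    for f :: "real \<Rightarrow> real" and \<tau>
    using assms[of \<tau>] that by (cases "0 \<le> \<tau>") auto
  show "set_integrable lborel {0..t} (\<lambda>\<tau>. K (t - \<tau>) * x \<tau>) \<longleftrightarrow> set_integrable lborel {0..t} (\<lambda>\<tau>. K (t - \<tau>) * x' \<tau>)"
    unfolding set_integrable_def by (rule integrable_discrete_difference[of "{0}"]) (use eq[of _ "\<lambda>\<tau>. K (t - \<tau>)"] in auto)
  show "set_integrable lborel {0..t} x \<longleftrightarrow> set_integrable lborel {0..t} x'"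
    unfolding set_integrable_def
    by (rule integrable_discrete_difference[of "{0}"]) (use eq[of _ "\<lambda>_. 1"] in auto)
  show "conv K x t = conv K x' t"
    unfolding conv_def set_lebesgue_integral_def
    by (rule integral_discrete_difference[of "{0}"]) (use eq[of _ "\<lambda>\<tau>. K (t - \<tau>)"] in auto)
qed

lemma classical_solution_cong:
  assumes sol: "classical_solution c1 c0 K1 K2 x0 y x'" and eq: "\<And>t. 0 < t \<Longrightarrow> x t = x' t" "c1 \<noteq> 0 \<Longrightarrow> x 0 = x' 0"
  shows "classical_solution c1 c0 K1 K2 x0 y x"
proof -
  have eq0: "x t = x' t" if "c1 \<noteq> 0" "0 \<le> t" for t
    using eq that by (cases "t = 0") auto
  have conv: "conv K x = conv K x'" for K using conv_discrete_difference(3)[of x x', OF eq(1)] by blast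
  have diff: "x differentiable (at t within {0..})" "Dt x t = Dt x' t"
    if "c1 \<noteq> 0" "0 < t" "x' differentiable (at t within {0..})" for t
  proof -
    have "(x' has_vector_derivative Dt x' t) (at t within {0..})"
      using that(3) by (simp add: vector_derivative_works)
    then have d: "(x has_vector_derivative Dt x' t) (at t within {0..})"
      by (rule has_vector_derivative_transform[rotated 2]) (use that eq0 in auto)
    then show "x differentiable (at t within {0..})" by (auto simp: has_vector_derivative_def differentiable_def)
    show "Dt x t = Dt x' t"
      by (rule vector_derivative_within[OF _ d]) (use that in \<open>simp add: not_trivial_at_Ici\<close>)
  qed
  show ?thesis
    unfolding classical_solution_def
  proof (intro conjI allI impI)
    show "continuous_on {0<..} x"
      by (rule continuous_on_eq[of _ x']) (use sol eq in \<open>auto simp: classical_solution_def\<close>)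
    show "set_integrable lborel {0..T} x" if "0 < T" for T
      using conv_discrete_difference(2)[of x x', OF eq(1)] sol that by (auto simp: classical_solution_def)
    show "continuous_on {0..} x" if "c1 \<noteq> 0"
      by (rule continuous_on_eq[of _ x']) (use sol eq0 that in \<open>auto simp: classical_solution_def\<close>)
    show "x 0 = x0" if "c1 \<noteq> 0" using sol eq that by (auto simp: classical_solution_def)
    show "continuous_on {0..} (conv K2 x)" using sol by (simp add: conv classical_solution_def)
    fix t :: real assume t: "0 < t"
    then have *: "volterra_defined c1 K1 K2 x' t" "y t = volterra c1 c0 K1 K2 x' t"
      using sol by (auto simp: classical_solution_def)
    show "volterra_defined c1 K1 K2 x t"
      using * diff(1) t conv_discrete_difference(1)[of x x' t K1, OF eq(1)]
        conv_discrete_difference(1)[of x x' t K2, OF eq(1)]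
      unfolding volterra_defined_def conv by blast
    have "c1 * Dt x t = c1 * Dt x' t"
      using * diff(2) t unfolding volterra_defined_def by (cases "c1 = 0") auto
    then show "y t = volterra c1 c0 K1 K2 x t"
      using *(2) eq(1)[OF t] unfolding volterra_def conv by (simp only:)
  qed
qed

section \<open>Decomposition of the measure and conclusion\<close>

lemma locally_finite_of_intervals:
  assumes M: "sets M = sets borel" and fin: "\<And>a b. emeasure M {a..b} < \<infinity>"
  shows "locally_finite M"
  unfolding locally_finite_def
proof
  fix s :: real
  have "emeasure M {s - 1<..<s + 1} \<le> emeasure M {s - 1..s + 1}"
    by (rule emeasure_mono) (auto simp: M)
  then have "emeasure M {s - 1<..<s + 1} < \<infinity>" using fin[of "s - 1" "s + 1"] by order
  then show "\<exists>U. open U \<and> s \<in> U \<and> emeasure M U < \<infinity>"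
    by (intro exI[of _ "{s - 1<..<s + 1}"]) auto
qed

lemma M_expI:
  assumes M: "sets M = sets borel" and fin: "\<And>a b. emeasure M {a..b} < \<infinity>" and m: "AE s in M. m \<le> s"
    and int: "(\<integral>\<^sup>+ s. ennreal ((1 + s\<^sup>2) powr (- real n / 2)) \<partial>M) < \<infinity>"
  shows "M \<in> M_exp n"
  unfolding M_exp_def using M locally_finite_of_intervals[OF M fin] int msupp_subset_if_AE_ge[OF M m]
  by (auto intro!: bdd_belowI[of _ m])

lemma one_plus_square_powr: "(1 + (s::real)\<^sup>2) powr (- real 2 / 2) = inverse (1 + s\<^sup>2)"
  by (simp add: powr_minus_divide inverse_eq_divide add_nonneg_nonneg)

text \<open>The cut is made at 1: the part below has its mass in [m, 1] and is therefore finite, and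
  on the part above the weight 1/s is at most 1.\<close>

lemma M_exp_2_decomposition:
  assumes M: "M \<in> M_exp 2"
  obtains M1 M2 where "M1 \<in> M_exp 1" "M2 \<in> M_frac" "M = add_measure M1 M2"
proof -
  note sM = M_exp_sets[OF M]
  have fin: "emeasure M {a..b} < \<infinity>" for a b
    by (rule finite_interval[OF sM M_exp_2_integrable[OF M]])
  obtain m where m: "AE s in M. m \<le> s" using M_exp_bounded_below[OF M] .
  define D where "D = (\<lambda>X. density M (indicator X))"
  have sD: "sets (D X) = sets borel" for X by (simp add: D_def sM)
  have eD: "emeasure (D X) A = emeasure M (X \<inter> A)" if "X \<in> sets borel" "A \<in> sets borel" for X A
  proof -
    have "emeasure (D X) A = (\<integral>\<^sup>+ s. indicator X s * indicator A s \<partial>M)"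
      unfolding D_def by (rule emeasure_density) (use that in \<open>auto simp: sM borel_measurable_sets_borel[OF sM]\<close>)
    also have "\<dots> = (\<integral>\<^sup>+ s. indicator (X \<inter> A) s \<partial>M)" by (simp add: indicator_inter_arith)
    also have "\<dots> = emeasure M (X \<inter> A)" using that by (simp add: sM)
    finally show ?thesis .
  qed
  have aeD: "(AE s in D X. P s) \<longleftrightarrow> (AE s in M. s \<in> X \<longrightarrow> P s)" if "X \<in> sets borel" for X P
    unfolding D_def
    by (subst AE_density) (use that in \<open>auto simp: borel_measurable_sets_borel[OF sM] indicator_def zero_less_iff_neq_zero\<close>)
  have intD: "(\<integral>\<^sup>+ s. f s \<partial>D X) = (\<integral>\<^sup>+ s. indicator X s * f s \<partial>M)"
    if "X \<in> sets borel" "f \<in> borel_measurable borel" for X f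
    unfolding D_def by (rule nn_integral_density) (use that in \<open>auto simp: borel_measurable_sets_borel[OF sM]\<close>)
  have finD: "emeasure (D X) {a..b} < \<infinity>" if "X \<in> sets borel" for X a b
  proof -
    have "emeasure (D X) {a..b} \<le> emeasure M {a..b}"
      using that by (subst eD) (auto simp: sM intro!: emeasure_mono)
    then show ?thesis using fin[of a b] by order
  qed
  have 1: "D {..<1} \<in> M_exp 1"
  proof (rule M_expI[OF sD])
    show "emeasure (D {..<1}) {a..b} < \<infinity>" for a b by (rule finD) simp
    show "AE s in D {..<1}. m \<le> s"
      by (subst aeD) (use m in \<open>simp, eventually_elim, simp\<close>)
    have "(\<integral>\<^sup>+ s. ennreal ((1 + s\<^sup>2) powr (- real 1 / 2)) \<partial>D {..<1})
      = (\<integral>\<^sup>+ s. indicator {..<1} s * ennreal ((1 + s\<^sup>2) powr (- real 1 / 2)) \<partial>M)"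
      by (rule intD) auto
    also have "\<dots> \<le> (\<integral>\<^sup>+ s. indicator {m..1} s \<partial>M)"
    proof (rule nn_integral_mono_AE)
      show "AE s in M. indicator {..<1} s * ennreal ((1 + s\<^sup>2) powr (- real 1 / 2)) \<le> indicator {m..1} s"
        using m
      proof eventually_elim
        fix s :: real assume s: "m \<le> s"
        have "(1 + s\<^sup>2) powr (- real 1 / 2) \<le> 1 powr (- real 1 / 2)"
          by (rule powr_mono2') (auto simp: add_pos_nonneg)
        then have "ennreal ((1 + s\<^sup>2) powr (- real 1 / 2)) \<le> 1" by simp
        then show "indicator {..<1} s * ennreal ((1 + s\<^sup>2) powr (- real 1 / 2)) \<le> indicator {m..1} s"
          using s by (auto simp: indicator_def)
      qed
    qed
    also have "\<dots> = emeasure M {m..1}" by (simp add: sM)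
    finally show "(\<integral>\<^sup>+ s. ennreal ((1 + s\<^sup>2) powr (- real 1 / 2)) \<partial>D {..<1}) < \<infinity>"
      using fin[of m 1] by order
  qed
  have ae1: "AE s in D {1..}. 1 \<le> s" by (subst aeD) auto
  have 2: "D {1..} \<in> M_exp 2"
  proof (rule M_expI[OF sD _ ae1])
    show "emeasure (D {1..}) {a..b} < \<infinity>" for a b by (rule finD) simp
    have "(\<integral>\<^sup>+ s. ennreal ((1 + s\<^sup>2) powr (- real 2 / 2)) \<partial>D {1..})
      = (\<integral>\<^sup>+ s. indicator {1..} s * ennreal ((1 + s\<^sup>2) powr (- real 2 / 2)) \<partial>M)"
      by (rule intD) auto
    also have "\<dots> \<le> (\<integral>\<^sup>+ s. ennreal ((1 + s\<^sup>2) powr (- real 2 / 2)) \<partial>M)"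
      by (rule nn_integral_mono) (auto simp: indicator_def)
    also have "\<dots> < \<infinity>" using M by (simp add: M_exp_def)
    finally show "(\<integral>\<^sup>+ s. ennreal ((1 + s\<^sup>2) powr (- real 2 / 2)) \<partial>D {1..}) < \<infinity>" .
  qed
  have "locally_finite (inv_weighted (D {1..}))"
  proof (rule locally_finite_of_intervals)
    show "sets (inv_weighted (D {1..})) = sets borel" by (simp add: inv_weighted_def sD)
    fix a b :: real
    have "emeasure (inv_weighted (D {1..})) {a..b} = (\<integral>\<^sup>+ s. inverse (ennreal s) * indicator {a..b} s \<partial>D {1..})"
      unfolding inv_weighted_def by (rule emeasure_density) (auto simp: sD borel_measurable_sets_borel[OF sD])
    also have "\<dots> \<le> (\<integral>\<^sup>+ s. indicator {a..b} s \<partial>D {1..})"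
    proof (rule nn_integral_mono_AE)
      show "AE s in D {1..}. inverse (ennreal s) * indicator {a..b} s \<le> indicator {a..b} s"
        using ae1
      proof eventually_elim
        fix s :: real assume "1 \<le> s"
        then have "inverse (ennreal s) \<le> 1" by (simp add: inverse_ennreal inverse_le_1_iff)
        then show "inverse (ennreal s) * indicator {a..b} s \<le> indicator {a..b} s"
          by (auto simp: indicator_def)
      qed
    qed
    also have "\<dots> = emeasure (D {1..}) {a..b}" by (simp add: sD)
    also have "\<dots> < \<infinity>" by (rule finD) simp
    finally show "emeasure (inv_weighted (D {1..})) {a..b} < \<infinity>" .
  qed
  moreover have "msupp (D {1..}) \<subseteq> {0..}"
    using msupp_subset_if_AE_ge[OF sD ae1] by auto
  ultimately have 3: "D {1..} \<in> M_frac" using 2 by (simp add: M_frac_def)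
  have "M = add_measure (D {..<1}) (D {1..})"
  proof (rule measure_eqI)
    fix A assume "A \<in> sets M"
    then have A: "A \<in> sets borel" by (simp add: sM)
    have "emeasure (add_measure (D {..<1}) (D {1..})) A = emeasure M ({..<1} \<inter> A) + emeasure M ({1..} \<inter> A)"
      using A by (simp add: emeasure_add_measure[OF sD sD] eD)
    also have "\<dots> = emeasure M (({..<1} \<inter> A) \<union> ({1..} \<inter> A))"
      using A by (intro plus_emeasure) (auto simp: sM)
    also have "({..<1} \<inter> A) \<union> ({1..} \<inter> A) = A" by auto
    finally show "emeasure M A = emeasure (add_measure (D {..<1}) (D {1..})) A" by simp
  qed (simp add: sM)
  with 1 3 show thesis by (rule that)
qed

lemma add_measure_facts:
  assumes l1: "lam1 \<in> M_exp 1" "admissible m lam1" and l2: "lam2 \<in> M_frac" and m: "m \<le> 0"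
  shows "integrable (add_measure lam1 lam2) (\<lambda>s. 1 / (1 + s\<^sup>2))" "AE s in add_measure lam1 lam2. m \<le> s"
proof -
  note s1 = M_exp_sets[OF l1(1)] and s2 = M_frac_sets[OF l2]
  show "integrable (add_measure lam1 lam2) (\<lambda>s. 1 / (1 + s\<^sup>2))"
    using admissible_integrable_one_plus_square(1)[OF l1(2)] M_exp_2_integrable[of lam2] l2
    by (simp add: integrable_add_measure[OF s1 s2] M_frac_def)
  have "AE s in lam1. m \<le> s" using l1(2) by (simp add: admissible_def)
  moreover have "AE s in lam2. m \<le> s" using M_frac_AE_pos[OF l2] by eventually_elim (use m in simp)
  ultimately show "AE s in add_measure lam1 lam2. m \<le> s" by (subst AE_add_measure[OF s1 s2]) auto
qed

theorem proposition4p29: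
  fixes lam1 lam2 \<mu> :: "real measure" and K1 K2 y :: "real \<Rightarrow> real"
    and c0 c1 x0 \<zeta>0' \<zeta>1 :: real
  assumes "lam1 \<in> M_exp 1" and "lam2 \<in> M_frac"
    and "\<not> (emeasure lam1 UNIV = 0 \<and> emeasure lam2 UNIV = 0)"
    and "K1 = laplace lam1" and "generalized_cm K1"
    and "K2 = laplace (inv_weighted lam2)"
    and "c1 \<ge> 0"
    and "sufficiently_regular c1 c0 K1 K2 x0 y"
    and "is_B_reg (add_measure lam1 lam2) (c0 - pi * sigma_R lam1 - pi * xi_frac lam2) c1
           \<mu> \<zeta>0' \<zeta>1"
  shows "\<mu> \<in> M_exp 2 \<and>
    (\<exists>\<mu>1 \<mu>2. \<mu>1 \<in> M_exp 1 \<and> \<mu>2 \<in> M_frac \<and> \<mu> = add_measure \<mu>1 \<mu>2) \<and>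
    (\<forall>\<mu>1 \<mu>2 J1 J2 \<zeta>0.
       \<mu>1 \<in> M_exp 1 \<longrightarrow> \<mu>2 \<in> M_frac \<longrightarrow> \<mu> = add_measure \<mu>1 \<mu>2 \<longrightarrow>
       J1 = laplace \<mu>1 \<longrightarrow> J2 = laplace (inv_weighted \<mu>2) \<longrightarrow>
       \<zeta>0 = \<zeta>0' + pi * sigma_R \<mu>1 + pi * xi_frac \<mu>2 \<longrightarrow>
       (\<forall>t\<ge>0. t > 0 \<or> c1 \<noteq> 0 \<longrightarrow>
          volterra_defined \<zeta>1 J1 J2 y t \<and>
          (c1 \<noteq> 0 \<longrightarrow> J2 differentiable (at t within {0..}))) \<and>
       (\<forall>x. (\<forall>t\<ge>0. - (pi\<^sup>2) * x t =
               volterra \<zeta>1 \<zeta>0 J1 J2 y t - c1 * x0 * (J1 t - Dt J2 t)) \<longrightarrow>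
            classical_solution c1 c0 K1 K2 x0 y x))"
proof -
  note l1 = assms(1) and l2 = assms(2) and B = assms(9)
  let ?L = "add_measure lam1 lam2" and ?N2 = "inv_weighted lam2"
  note s1 = M_exp_sets[OF l1] and s2 = M_frac_sets[OF l2]
  obtain m1 where m1: "admissible m1 lam1" using admissible_M_exp_1[OF l1] .
  \<comment> \<open>The minimum with 0 makes the bound valid for \<open>lam2\<close> as well, which
    lives on the positive half-line.\<close>
  define ml where "ml = min m1 0"
  have a1: "admissible ml lam1" using admissible_mono[OF m1] by (simp add: ml_def)
  have ml: "ml \<le> 0" by (simp add: ml_def)
  note L = add_measure_facts[OF l1 a1 l2 ml]
  have nz: "emeasure ?L UNIV \<noteq> 0"
    using assms(3) by (simp add: emeasure_add_measure[OF s1 s2])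
  have sm: "sets \<mu> = sets borel" and z1: "0 \<le> \<zeta>1" and nn: "(\<integral>\<^sup>+ s. ennreal (inverse (1 + s\<^sup>2)) \<partial>\<mu>) < \<infinity>"
    using B by (auto simp: is_B_reg_def)
  have im: "integrable \<mu> (\<lambda>s. 1 / (1 + s\<^sup>2))"
    by (rule integrableI_nonneg) (use nn in \<open>auto simp: inverse_eq_divide borel_measurable_sets_borel[OF sm]\<close>)
  obtain P where P: "AE s in \<mu>. P \<le> s"
    and GH: "\<And>x. x < P \<Longrightarrow> nevanlinna ?L (c0 - pi * sigma_R lam1 - pi * xi_frac lam2) c1 (of_real x) *
      nevanlinna \<mu> \<zeta>0' \<zeta>1 (of_real x) = - of_real (pi\<^sup>2)"
    using is_B_reg_bounded_below[OF sets_add_measure L nz sm im assms(7) z1 B] by metis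
  have mu: "\<mu> \<in> M_exp 2"
    by (rule M_expI[OF sm finite_interval[OF sm im] P]) (use nn in \<open>simp only: one_plus_square_powr\<close>)
  obtain xs where y: "continuous_on {0..} y" and sol: "classical_solution c1 c0 K1 K2 x0 y xs"
    using assms(8) by (auto simp: sufficiently_regular_def)
  have main: "(\<forall>t\<ge>0. t > 0 \<or> c1 \<noteq> 0 \<longrightarrow>
          volterra_defined \<zeta>1 J1 J2 y t \<and>
          (c1 \<noteq> 0 \<longrightarrow> J2 differentiable (at t within {0..}))) \<and>
       (\<forall>x. (\<forall>t\<ge>0. - (pi\<^sup>2) * x t =
               volterra \<zeta>1 \<zeta>0 J1 J2 y t - c1 * x0 * (J1 t - Dt J2 t)) \<longrightarrow>
            classical_solution c1 c0 K1 K2 x0 y x)"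
    if u: "\<mu>1 \<in> M_exp 1" "\<mu>2 \<in> M_frac" "\<mu> = add_measure \<mu>1 \<mu>2"
      and J: "J1 = laplace \<mu>1" "J2 = laplace (inv_weighted \<mu>2)"
      and zeta: "\<zeta>0 = \<zeta>0' + pi * sigma_R \<mu>1 + pi * xi_frac \<mu>2" for \<mu>1 \<mu>2 J1 J2 \<zeta>0
  proof -
    let ?M2 = "inv_weighted \<mu>2"
    obtain m2 where m2: "admissible m2 \<mu>1" using admissible_M_exp_1[OF u(1)] .
    define m where "m = min ml m2"
    have m: "m \<le> 0" using ml by (simp add: m_def)
    have A: "admissible m lam1" "admissible m ?N2" "admissible m \<mu>1" "admissible m ?M2"
      using admissible_mono[OF a1] admissible_mono[OF m2] m
        admissible_mono[OF admissible_inv_weighted[OF l2]] admissible_mono[OF admissible_inv_weighted[OF u(2)]]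
      by (auto simp: m_def)
    \<comment> \<open>Beyond this threshold p is large enough for all four kernels, and -p lies
      below P, where the product identity has been extended to the real axis.\<close>
    have sym: "symbol c1 c0 lam1 ?N2 p * symbol \<zeta>1 \<zeta>0 \<mu>1 ?M2 p = - pi\<^sup>2" if p: "\<bar>m\<bar> + \<bar>P\<bar> + 1 \<le> p" for p
    proof -
      have p': "\<bar>m\<bar> + 1 \<le> p" "- p < P" using p by linarith+
      have z: "\<zeta>0' = \<zeta>0 - pi * sigma_R \<mu>1 - pi * xi_frac \<mu>2" by (simp add: zeta)
      have "complex_of_real (symbol c1 c0 lam1 ?N2 p * symbol \<zeta>1 \<zeta>0 \<mu>1 ?M2 p) = - of_real (pi\<^sup>2)"
        using GH[OF p'(2)] unfolding nevanlinna_symbol[OF l1 A(1) l2 p'(1)] u(3) z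
          nevanlinna_symbol[OF u(1) A(3) u(2) p'(1)] by simp
      then show ?thesis by (metis of_real_eq_iff of_real_minus)
    qed
    then have symev: "\<forall>\<^sub>F p in at_top. symbol c1 c0 lam1 ?N2 p * symbol \<zeta>1 \<zeta>0 \<mu>1 ?M2 p = - pi\<^sup>2"
      unfolding eventually_at_top_linorder by blast
    then have symev': "\<forall>\<^sub>F p in at_top. symbol \<zeta>1 \<zeta>0 \<mu>1 ?M2 p * symbol c1 c0 lam1 ?N2 p = - pi\<^sup>2"
      by (simp add: mult.commute)
    note lim1 = tendsto_symbol_div[OF A(1,2), of c1 c0] and lim2 = tendsto_symbol_div[OF A(3,4), of \<zeta>1 \<zeta>0]
    have cz: "c1 * \<zeta>1 = 0" by (rule reciprocal_symbols(1)[OF lim1 lim2 symev])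
    interpret R: reciprocal c1 c0 \<zeta>1 \<zeta>0 m "\<bar>m\<bar> + \<bar>P\<bar> + 1" lam1 ?N2 \<mu>1 ?M2
      by unfold_locales (use A sym cz in auto)
    note sol' = sol[unfolded assms(4,6)]
    \<comment> \<open>For c1 nonzero the second symbol decays like 1/p, which forces
      \<open>\<mu>1\<close> and \<open>\<mu>2\<close> to be finite and so makes the kernels regular
      at the origin.\<close>
    have fin: "continuous_on {0..} J1 \<and> continuous_on {0..} J2 \<and> (\<forall>t\<ge>0. J2 differentiable (at t within {0..}))"
      if c: "c1 \<noteq> 0"
    proof -
      have "\<zeta>1 = 0" using cz c by simp
      then obtain C where "\<forall>\<^sub>F p in at_top. \<bar>p * symbol 0 \<zeta>0 \<mu>1 ?M2 p\<bar> \<le> C"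
        using reciprocal_symbols(2)[OF lim1 lim2 symev c] by auto
      note F = symbol_bounded_imp_finite[OF u(1,2) this]
      interpret F1: finite_measure \<mu>1 by (rule F(1))
      have "continuous_on {0..} J1" unfolding J
        by (rule continuous_on_laplace) (use A(3) in \<open>auto simp: admissible_def\<close>)
      moreover have "continuous_on {0..} J2" unfolding J
        by (rule laplace_inv_weighted_derivative(2)[OF u(2) F(2) order_refl])
      moreover have "J2 differentiable (at t within {0..})" if "0 \<le> t" for t
        using laplace_inv_weighted_derivative(3)[OF u(2) F(2) that] unfolding J
        by (auto simp: has_vector_derivative_def differentiable_def)
      ultimately show ?thesis by blast
    qed
    \<comment> \<open>The same argument with the two symbols exchanged; now c1 = 0, so t is
      positive.\<close>
    have yd: "y differentiable (at t within {0..})" if z: "\<zeta>1 \<noteq> 0" and t: "0 < t \<or> c1 \<noteq> 0" for t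
    proof -
      have c: "c1 = 0" using cz z by simp
      then obtain C where "\<forall>\<^sub>F p in at_top. \<bar>p * symbol 0 c0 lam1 ?N2 p\<bar> \<le> C"
        using reciprocal_symbols(2)[OF lim2 lim1 symev' z] by auto
      note F = symbol_bounded_imp_finite[OF l1 l2 this]
      interpret F1: finite_measure lam1 by (rule F(1))
      interpret F2: finite_measure lam2 by (rule F(2))
      have sp: "space lam1 = UNIV" "space lam2 = UNIV" "space ?L = UNIV"
        using sets_eq_imp_space_eq[OF s1] sets_eq_imp_space_eq[OF s2] sets_eq_imp_space_eq[OF sets_add_measure] by simp_all
      have "emeasure ?L UNIV \<noteq> \<infinity>"
        using F1.emeasure_finite[of UNIV] F2.emeasure_finite[of UNIV]
        by (simp add: emeasure_add_measure[OF s1 s2])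
      then have fL: "finite_measure ?L" by (intro finite_measureI) (simp add: sp)
      have "\<forall>\<^sub>F p in at_top. symbol 0 c0 lam1 ?N2 p = - (LINT s|?L. 1 / (p + s))"
        using F(4) eventually_ge_at_top[of "\<bar>m\<bar> + 1"]
      proof eventually_elim
        fix p assume p: "symbol 0 c0 lam1 ?N2 p = - (LINT s|lam1. 1 / (p + s)) - (LINT s|lam2. 1 / (p + s))"
          "\<bar>m\<bar> + 1 \<le> p"
        have "integrable lam1 (\<lambda>s. 1 / (p + s))" by (rule admissible_integrable_resolvent[OF A(1) p(2)])
        moreover have "integrable lam2 (\<lambda>s. 1 / (p + s))"
          by (rule admissible_integrable_resolvent[OF finite_inv_weighted(1)[OF l2 F(2)]]) (use p(2) in simp)
        ultimately show "symbol 0 c0 lam1 ?N2 p = - (LINT s|?L. 1 / (p + s))"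
          using p(1) by (simp add: integral_add_measure[OF s1 s2])
      qed
      then show ?thesis
        using t c sol' add_measure_facts(2)[OF l1 A(1) l2 m] fL y A
        by (intro output_differentiable[where L = ?L and m = m and ?N1.0 = lam1 and ?N2.0 = ?N2 and x = xs and ?x0.0 = x0 and ?c0.0 = c0]) auto
    qed
    have formula: "volterra_defined \<zeta>1 J1 J2 y t \<and>
        - (pi\<^sup>2) * xs t = volterra \<zeta>1 \<zeta>0 J1 J2 y t - c1 * x0 * (J1 t - Dt J2 t)"
      if t: "0 \<le> t" "0 < t \<or> c1 \<noteq> 0" for t
      using R.solution_formula[OF y sol' t] fin yd t unfolding J by blast
    show ?thesis
    proof (intro conjI allI impI)
      fix t :: real assume t: "0 \<le> t" "0 < t \<or> c1 \<noteq> 0"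
      show "volterra_defined \<zeta>1 J1 J2 y t" using formula[OF t] by simp
      show "J2 differentiable (at t within {0..})" if "c1 \<noteq> 0" using fin[OF that] t by simp
    next
      fix x assume x: "\<forall>t\<ge>0. - (pi\<^sup>2) * x t = volterra \<zeta>1 \<zeta>0 J1 J2 y t - c1 * x0 * (J1 t - Dt J2 t)"
      \<comment> \<open>As pi is nonzero, the formula pins x down to the given solution, except
        possibly at 0 when c1 = 0.\<close>
      have "x t = xs t" if t: "0 \<le> t" "0 < t \<or> c1 \<noteq> 0" for t
      proof -
        have "- (pi\<^sup>2) * x t = - (pi\<^sup>2) * xs t" using formula[OF t] x t(1) by simp
        then show ?thesis by simp
      qed
      then show "classical_solution c1 c0 K1 K2 x0 y x"
        by (intro classical_solution_cong[OF sol]) auto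
    qed
  qed
  obtain M1 M2 where "M1 \<in> M_exp 1" "M2 \<in> M_frac" "\<mu> = add_measure M1 M2"
    using M_exp_2_decomposition[OF mu] .
  then have ex: "\<exists>\<mu>1 \<mu>2. \<mu>1 \<in> M_exp 1 \<and> \<mu>2 \<in> M_frac \<and> \<mu> = add_measure \<mu>1 \<mu>2" by blast
  show ?thesis
    by (intro conjI[OF mu] conjI[OF ex] allI impI) (rule main; assumption)
qed

end
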